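(* The optimization problem ILMTP-SD (the Integrated Last-Mile Transportation Problem with a single destination per trip: find a feasible solution minimizing $f(\alpha)$) is NP-hard.
   Context: Instance of the ILMTP-SD (all times are integers; numbers are encoded in the usual way): - A terminal $\mathbf{T}_0$, a finite set $\mathcal{S}$ of stations, and a finite set $\mathcal{C}$ of mass transit trips. Each trip $c\in\mathcal{C}$ stops at all stations of $\mathcal{S}$ and ends at $\mathbf{T}_0$; it leaves station $s$ at time $\tilde t(c,s)$ and arrives at $\mathbf{T}_0$ at time $\tilde t(c)$. Trips are regular: the travel time $\tilde t(c)-\tilde t(c,s)$ from station $s$ to $\mathbf{T}_0$ is the same for all trips $c$. - A finite set $\mathcal{D}$ of destinations (with $\mathbf{T}_0\in\mathcal{D}$ by convention). For each $d\in\mathcal{D}$, nonnegative times $\tau^1(d)$ (travel from $\mathbf{T}_0$ to $d$), $\tau^2(d)$ (stop at $d$), $\tau^3(d)$ (return to $\mathbf{T}_0$), with round-trip time $\tau(d)=\tau^1(d)+\tau^2(d)+\tau^3(d)$. - A time horizon $\mathcal{T}=\{1,\dots,t^{\max}\}$. - A finite set $V$ of commuter vehicles (CVs), each able to carry at most $v^{\mathrm{cap}}\ge 1$ passengers per trip. All CVs are initially at $\mathbf{T}_0$. - A finite set $\mathcal{J}$ of passengers. Each $j\in\mathcal{J}$ has an origin station $s(j)\in\mathcal{S}$, a destination $d(j)\in\mathcal{D}$, and a requested arrival time $t^r(j)$. A time-window length $T_w\ge 0$ common to all passengers. - A weight $\alpha\in[0,1]$. Feasible solution: a partition $\mathsf{g}=\{g_1,\dots,g_\gamma\}$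 of $\mathcal{J}$ into nonempty groups together with departure times $t^{\mathsf g}_1,\dots,t^{\mathsf g}_\gamma\in\mathcal{T}$ from $\mathbf{T}_0$ such that, for every $l$: (1) all passengers of $g_l$ have the same destination, denoted $d_l$, and $|g_l|\le v^{\mathrm{cap}}$; (2) every $j\in g_l$ satisfies $t^r(j)-T_w\le t^{\mathsf g}_l+\tau^1(d_l)\le t^r(j)+T_w$; (3) there is a trip $c\in\mathcal{C}$ with $\tilde t(c)\le t^{\mathsf g}_l$; (4) $t^{\mathsf g}_l+\tau(d_l)\le t^{\max}$; and (5) for every $t\in\mathcal{T}$ the number of indices $l$ with $t^{\mathsf g}_l\le t<t^{\mathsf g}_l+\tau(d_l)$ is at most $|V|$. Objective: the total travel time of a passenger $j$ whose CV departs $\mathbf{T}_0$ at time $t$ is $$\mathrm{tt}_{j,t}=t+\tau^1(d(j))-\max_{c\in\mathcal{C}:\ \tilde t(c)\le t}\tilde t(c,s(j)),$$ and the objective to be minimized is $$f(\alpha)=\alpha\sum_{l=1}^{\gamma}\sum_{j\in g_l}\mathrm{tt}_{j,t^{\mathsf g}_l}+(1-\alpha)\,\gamma ,$$ where $\gamma$ is the number of groups, i.e. of CV trips. *)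

theory Defs
  imports
    Complex_Main
    "HOL-Library.Disjoint_Sets"
    "HOL-Computational_Algebra.Polynomial"
begin

section \<open>Deterministic multi-tape oracle Turing machines\<close>

text \<open>
  Tapes are two-way infinite. Symbol 0 is the blank, symbols 1 and 2 stand for the bits
  \<^const>\<open>False\<close> and \<^const>\<open>True\<close>, and a machine may use finitely many further symbols.
  Tape 0 is the input tape. Tape 1 holds the second input (the certificate, when a machine is
  used as a verifier) and also serves as the oracle tape.
\<close>

type_synonym tape = "(int \<Rightarrow> nat) \<times> int"

datatype move = MoveL | Stay | MoveR

fun offset :: "move \<Rightarrow> int" where
  "offset MoveL = -1"
| "offset Stay = 0"
| "offset MoveR = 1"

datatype action =
    Step nat "(nat \<times> move) list" \<comment> \<open>next state; for each tape the symbol written and the move\<close>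
  | Query nat                    \<comment> \<open>consult the oracle, then continue in the given state\<close>
  | Halt bool                    \<comment> \<open>accept or reject\<close>

text \<open>
  The program lists, for each state, the action as a function of the symbols under the heads.
  Only the finitely many symbol lists over the alphabet whose length is the number of tapes
  matter. State 0 is the initial state.
\<close>

record machine =
  num_tapes :: nat
  num_symbols :: nat
  program :: "(nat list \<Rightarrow> action) list"

definition read_lists :: "machine \<Rightarrow> nat list set" where
  "read_lists M = {rs. length rs = num_tapes M \<and> set rs \<subseteq> {..<num_symbols M}}"

fun action_ok :: "machine \<Rightarrow> action \<Rightarrow> bool" where
  "action_ok M (Step q as) \<longleftrightarrow>
     q < length (program M) \<and> length as = num_tapes M \<and> fst ` set as \<subseteq> {..<num_symbols M}"
| "action_ok M (Query q) \<longleftrightarrow> q < length (program M)"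
| "action_ok M (Halt b) \<longleftrightarrow> True"

definition turing_machine :: "machine \<Rightarrow> bool" where
  "turing_machine M \<longleftrightarrow>
     num_tapes M \<ge> 2 \<and> num_symbols M \<ge> 3 \<and> program M \<noteq> [] \<and>
     (\<forall>p\<in>set (program M). \<forall>rs\<in>read_lists M. action_ok M (p rs))"

definition oracle_free :: "machine \<Rightarrow> bool" where
  "oracle_free M \<longleftrightarrow> (\<forall>p\<in>set (program M). \<forall>rs\<in>read_lists M. \<forall>q. p rs \<noteq> Query q)"

definition tape_of :: "bool list \<Rightarrow> tape" where
  "tape_of w =
     (\<lambda>i. if 0 \<le> i \<and> i < int (length w) then (if w ! nat i then 2 else 1) else 0, 0)"

text \<open>The word on a tape extends from cell 0 up to the first cell that does not hold a bit.\<close>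

definition word_of :: "tape \<Rightarrow> bool list" where
  "word_of t =
     map (\<lambda>n. fst t (int n) = 2) [0..<(LEAST n. fst t (int n) \<notin> {1, 2})]"

type_synonym config = "nat \<times> tape list"

definition initial :: "machine \<Rightarrow> bool list \<Rightarrow> bool list \<Rightarrow> config" where
  "initial M x y = (0, tape_of x # tape_of y # replicate (num_tapes M - 2) (tape_of []))"

definition current_action :: "machine \<Rightarrow> config \<Rightarrow> action" where
  "current_action M c = (program M ! fst c) (map (\<lambda>(f, h). f h) (snd c))"

definition write_move :: "nat \<times> move \<Rightarrow> tape \<Rightarrow> tape" where
  "write_move a t = ((fst t)(snd t := fst a), snd t + offset (snd a))"

text \<open>An oracle call replaces the word on tape 1 by the answer, in one step.\<close>

definition step :: "(bool list \<Rightarrow> bool list) \<Rightarrow> machine \<Rightarrow> config \<Rightarrow> config" where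
  "step orc M c =
     (case current_action M c of
        Step q as \<Rightarrow> (q, map2 write_move as (snd c))
      | Query q \<Rightarrow> (q, (snd c)[1 := tape_of (orc (word_of (snd c ! 1)))])
      | Halt b \<Rightarrow> c)"

definition halts_within ::
  "(bool list \<Rightarrow> bool list) \<Rightarrow> machine \<Rightarrow> bool list \<Rightarrow> bool list \<Rightarrow> nat \<Rightarrow> bool \<Rightarrow> bool" where
  "halts_within orc M x y T b \<longleftrightarrow>
     (\<exists>n\<le>T. current_action M ((step orc M ^^ n) (initial M x y)) = Halt b)"


section \<open>The class NP and NP-hardness of optimization problems\<close>

text \<open>Verifiers make no queries, so the oracle passed to \<^const>\<open>halts_within\<close> is irrelevant here.\<close>

definition NP :: "bool list set set" where
  "NP = {L. \<exists>M (p :: nat poly) (q :: nat poly).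
     turing_machine M \<and> oracle_free M \<and>
     (\<forall>x y. \<exists>b. halts_within (\<lambda>_. []) M x y (poly p (length x + length y)) b) \<and>
     (\<forall>x. x \<in> L \<longleftrightarrow>
        (\<exists>y. length y \<le> poly q (length x) \<and>
             halts_within (\<lambda>_. []) M x y (poly p (length x + length y)) True))}"

record ('i, 's) min_problem =
  instances :: "'i set"
  solutions :: "'i \<Rightarrow> 's set"
  objective :: "'i \<Rightarrow> 's \<Rightarrow> rat"
  encode_instance :: "'i \<Rightarrow> bool list"
  encode_solution :: "'s \<Rightarrow> bool list"

definition optimal :: "('i, 's) min_problem \<Rightarrow> 'i \<Rightarrow> 's \<Rightarrow> bool" where
  "optimal P I s \<longleftrightarrow>
     s \<in> solutions P I \<and> (\<forall>s'\<in>solutions P I. objective P I s \<le> objective P I s')"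

text \<open>
  An oracle solves the problem if on every encoded instance it answers with an optimal solution,
  or reports that there is no feasible one. Its behaviour on other words is unconstrained.
\<close>

definition solver :: "('i, 's) min_problem \<Rightarrow> (bool list \<Rightarrow> bool list) \<Rightarrow> bool" where
  "solver P orc \<longleftrightarrow>
     (\<forall>I\<in>instances P.
        (solutions P I = {} \<and> orc (encode_instance P I) = [False]) \<or>
        (\<exists>s. optimal P I s \<and> orc (encode_instance P I) = True # encode_solution P s))"

text \<open>Polynomial-time Turing (Cook) reducibility of a language to an optimization problem.\<close>

definition turing_reducible :: "bool list set \<Rightarrow> ('i, 's) min_problem \<Rightarrow> bool" where
  "turing_reducible L P \<longleftrightarrow>
     (\<exists>M (p :: nat poly). turing_machine M \<and>
        (\<forall>orc. solver P orc \<longrightarrow>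
           (\<forall>x. halts_within orc M x [] (poly p (length x)) (x \<in> L))))"

definition NP_hard :: "('i, 's) min_problem \<Rightarrow> bool" where
  "NP_hard P \<longleftrightarrow> (\<forall>L\<in>NP. turing_reducible L P)"


section \<open>Binary encodings\<close>

text \<open>
  All encodings are self-delimiting: every binary digit (least significant first, without
  leading zeros) and every list element is announced by \<^const>\<open>True\<close>, and \<^const>\<open>False\<close> ends
  the number or list.
\<close>

fun enc_nat :: "nat \<Rightarrow> bool list" where
  "enc_nat n = (if n = 0 then [False] else True # odd n # enc_nat (n div 2))"

declare enc_nat.simps [simp del]

definition enc_int :: "int \<Rightarrow> bool list" where
  "enc_int z = (z < 0) # enc_nat (nat \<bar>z\<bar>)"

definition enc_rat :: "rat \<Rightarrow> bool list" where
  "enc_rat r = (case quotient_of r of (a, b) \<Rightarrow> enc_int a @ enc_int b)"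

definition enc_list :: "('a \<Rightarrow> bool list) \<Rightarrow> 'a list \<Rightarrow> bool list" where
  "enc_list e xs = concat (map (\<lambda>x. True # e x) xs) @ [False]"


section \<open>The problem ILMTP-SD\<close>

text \<open>
  The finite sets of an instance are initial segments of the natural numbers; destination 0 is
  the terminal.
\<close>

record ilmtp =
  num_stations :: nat
  num_trips :: nat
  trip_dep :: "nat \<Rightarrow> nat \<Rightarrow> int"  \<comment> \<open>departure time of a trip from a station\<close>
  trip_arr :: "nat \<Rightarrow> int"        \<comment> \<open>arrival time of a trip at the terminal\<close>
  num_dests :: nat
  tau1 :: "nat \<Rightarrow> int"
  tau2 :: "nat \<Rightarrow> int"
  tau3 :: "nat \<Rightarrow> int"
  t_max :: int
  num_cvs :: nat
  v_cap :: nat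
  num_passengers :: nat
  origin :: "nat \<Rightarrow> nat"
  dest :: "nat \<Rightarrow> nat"
  t_req :: "nat \<Rightarrow> int"
  t_win :: int
  weight :: rat

abbreviation Stations :: "ilmtp \<Rightarrow> nat set" where "Stations I \<equiv> {..<num_stations I}"
abbreviation Trips :: "ilmtp \<Rightarrow> nat set" where "Trips I \<equiv> {..<num_trips I}"
abbreviation Dests :: "ilmtp \<Rightarrow> nat set" where "Dests I \<equiv> {..<num_dests I}"
abbreviation CVs :: "ilmtp \<Rightarrow> nat set" where "CVs I \<equiv> {..<num_cvs I}"
abbreviation Passengers :: "ilmtp \<Rightarrow> nat set" where "Passengers I \<equiv> {..<num_passengers I}"
abbreviation Horizon :: "ilmtp \<Rightarrow> int set" where "Horizon I \<equiv> {1..t_max I}"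

definition tau :: "ilmtp \<Rightarrow> nat \<Rightarrow> int" where
  "tau I d = tau1 I d + tau2 I d + tau3 I d"

definition ilmtp_instance :: "ilmtp \<Rightarrow> bool" where
  "ilmtp_instance I \<longleftrightarrow>
     (\<forall>c\<in>Trips I. \<forall>s\<in>Stations I. trip_dep I c s \<le> trip_arr I c) \<and>
     (\<forall>c\<in>Trips I. \<forall>c'\<in>Trips I. \<forall>s\<in>Stations I.
        trip_arr I c - trip_dep I c s = trip_arr I c' - trip_dep I c' s) \<and>
     0 \<in> Dests I \<and>
     (\<forall>d\<in>Dests I. 0 \<le> tau1 I d \<and> 0 \<le> tau2 I d \<and> 0 \<le> tau3 I d) \<and>
     1 \<le> t_max I \<and>
     1 \<le> v_cap I \<and>
     (\<forall>j\<in>Passengers I. origin I j \<in> Stations I \<and> dest I j \<in> Dests I) \<and>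
     0 \<le> t_win I \<and>
     0 \<le> weight I \<and> weight I \<le> 1"

text \<open>
  A solution lists the groups together with their departure times from the terminal.
  The common destination of a group is only meaningful for groups meeting condition (1).
\<close>

type_synonym schedule = "(nat set \<times> int) list"

definition group_dest :: "ilmtp \<Rightarrow> nat set \<Rightarrow> nat" where
  "group_dest I g = the_elem (dest I ` g)"

definition feasible :: "ilmtp \<Rightarrow> schedule \<Rightarrow> bool" where
  "feasible I gs \<longleftrightarrow>
     distinct (map fst gs) \<and> partition_on (Passengers I) (set (map fst gs)) \<and>
     (\<forall>(g, t)\<in>set gs.
        t \<in> Horizon I \<and>
        (\<forall>i\<in>g. \<forall>j\<in>g. dest I i = dest I j) \<and> card g \<le> v_cap I \<and>
        (\<forall>j\<in>g. t_req I j - t_win I \<le> t + tau1 I (group_dest I g) \<and>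
               t + tau1 I (group_dest I g) \<le> t_req I j + t_win I) \<and>
        (\<exists>c\<in>Trips I. trip_arr I c \<le> t) \<and>
        t + tau I (group_dest I g) \<le> t_max I) \<and>
     (\<forall>t\<in>Horizon I.
        card {l. l < length gs \<and> snd (gs ! l) \<le> t \<and>
                 t < snd (gs ! l) + tau I (group_dest I (fst (gs ! l)))} \<le> card (CVs I))"

definition travel_time :: "ilmtp \<Rightarrow> nat \<Rightarrow> int \<Rightarrow> int" where
  "travel_time I j t =
     t + tau1 I (dest I j) - Max {trip_dep I c (origin I j) |c. c \<in> Trips I \<and> trip_arr I c \<le> t}"

definition ilmtp_objective :: "ilmtp \<Rightarrow> schedule \<Rightarrow> rat" where
  "ilmtp_objective I gs =
     weight I * (\<Sum>(g, t)\<leftarrow>gs. \<Sum>j\<in>g. of_int (travel_time I j t))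
       + (1 - weight I) * of_nat (length gs)"

text \<open>Every set is encoded by listing its elements, every function by listing its values.\<close>

definition enc_ilmtp :: "ilmtp \<Rightarrow> bool list" where
  "enc_ilmtp I =
     enc_list enc_nat [0..<num_stations I]
     @ enc_list (\<lambda>c. enc_int (trip_arr I c) @
                     enc_list (\<lambda>s. enc_int (trip_dep I c s)) [0..<num_stations I])
         [0..<num_trips I]
     @ enc_list (\<lambda>d. enc_int (tau1 I d) @ enc_int (tau2 I d) @ enc_int (tau3 I d))
         [0..<num_dests I]
     @ enc_int (t_max I)
     @ enc_list enc_nat [0..<num_cvs I]
     @ enc_nat (v_cap I)
     @ enc_list (\<lambda>j. enc_nat (origin I j) @ enc_nat (dest I j) @ enc_int (t_req I j))
         [0..<num_passengers I]
     @ enc_int (t_win I)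
     @ enc_rat (weight I)"

definition enc_schedule :: "schedule \<Rightarrow> bool list" where
  "enc_schedule =
     enc_list (\<lambda>(g, t). enc_list enc_nat (sorted_list_of_set g) @ enc_int t)"

definition ILMTP_SD :: "(ilmtp, schedule) min_problem" where
  "ILMTP_SD =
     \<lparr>instances = Collect ilmtp_instance,
      solutions = (\<lambda>I. Collect (feasible I)),
      objective = ilmtp_objective,
      encode_instance = enc_ilmtp,
      encode_solution = enc_schedule\<rparr>"

end

theory Submission
  imports Defs
begin

text \<open>
  A language in NP is reduced to the question whether an instance has a feasible schedule, which
  any answer of the oracle reveals in its first bit.

  By the Cook-Levin argument, acceptance by a verifier is a satisfiability problem whose clauses
  come from finitely many templates, each instantiated for polynomially many values of a time and
  a position. Adding a variable for falsity turns it into not-all-equal satisfiability, and the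
  digit encoding of the literals turns this into the partition problem: split numbers
  \<open>a\<^sub>0, a\<^sub>1, \<dots>\<close> of total \<open>2 * T\<close> into two halves. With two vehicles of capacity one, and a
  destination of round-trip time \<open>2 * a\<^sub>j\<close> for passenger \<open>j\<close>, a schedule within \<open>{1..2 * T + 1}\<close> is
  exactly such a split.

  The instances are printed by nested loops with polynomially bounded counters, and such programs
  are compiled to Turing machines once and for all.
\<close>

section \<open>Counter programs on Turing machines\<close>

text \<open>The obstacle is size: the numbers of the partition instance have polynomially many bits,
  whereas unary counters hold only polynomially bounded values. So no such number is ever computed.
  Clauses have a constant width \<open>m\<close> and the digit base is a power of two; hence a digit
  is a block of \<open>Suc m\<close> bits, columns add up without carries, and a number is printed
  block by block. This is also why clauses come from templates: the block belonging to a clause is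
  found by comparing the fixed number of literals of its template with the literal at hand, and
  their indices are polynomial expressions in loop counters, the input length and single input
  symbols. Round trips are doubled for the same reason: the horizon \<open>2 * T + 1\<close> is the
  bit one followed by the bits of \<open>T\<close>, while \<open>T + 1\<close> would need a carry.
  The leading digit of every item and of the target is 1, so an encoding without leading zeros can
  be printed as well.\<close>

text \<open>Tape 0 is the input tape, \<open>Emit\<close> appends to the oracle tape 1, and register \<open>r\<close> is kept on tape
  \<open>r + 2\<close> as the distance of the head from cell 0, the only cell that is not blank.\<close>

datatype test = NonZero nat | Reads "nat set"

datatype com =
    Skip | Inc nat | Dec nat | Emit bool | Head move
  | Seq com com (infixr ";;" 60)
  | Cond test com com
  | While test com

type_synonym cstate = "int \<times> bool list \<times> (nat \<Rightarrow> nat)"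

fun holds :: "bool list \<Rightarrow> test \<Rightarrow> cstate \<Rightarrow> bool" where
  "holds x (NonZero r) (h, w, v) \<longleftrightarrow> v r \<noteq> 0"
| "holds x (Reads S) (h, w, v) \<longleftrightarrow> fst (tape_of x) h \<in> S"

text \<open>The time index is the exact number of steps of the compiled machine: a test costs one
  step, sequencing none. \<open>Dec\<close> of an empty register has no derivation, since the head
  would move to the left of the marker.\<close>

inductive exec :: "bool list \<Rightarrow> com \<Rightarrow> cstate \<Rightarrow> nat \<Rightarrow> cstate \<Rightarrow> bool" for x where
  exec_Skip: "exec x Skip s 1 s"
| exec_Inc: "exec x (Inc r) (h, w, v) 1 (h, w, v(r := v r + 1))"
| exec_Dec: "v r > 0 \<Longrightarrow> exec x (Dec r) (h, w, v) 1 (h, w, v(r := v r - 1))"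
| exec_Emit: "exec x (Emit b) (h, w, v) 1 (h, w @ [b], v)"
| exec_Head: "exec x (Head m) (h, w, v) 1 (h + offset m, w, v)"
| exec_Seq: "exec x c s t s' \<Longrightarrow> exec x c' s' t' s'' \<Longrightarrow> exec x (c ;; c') s (t + t') s''"
| exec_CondT: "holds x b s \<Longrightarrow> exec x c s t s' \<Longrightarrow> exec x (Cond b c c') s (Suc t) s'"
| exec_CondF: "\<not> holds x b s \<Longrightarrow> exec x c' s t s' \<Longrightarrow> exec x (Cond b c c') s (Suc t) s'"
| exec_WhileF: "\<not> holds x b s \<Longrightarrow> exec x (While b c) s 1 s"
| exec_WhileT: "holds x b s \<Longrightarrow> exec x c s t s' \<Longrightarrow> exec x (While b c) s' t' s'' \<Longrightarrow>
     exec x (While b c) s (Suc (t + t')) s''"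

fun csize :: "com \<Rightarrow> nat" where
  "csize (c ;; c') = csize c + csize c'"
| "csize (Cond b c c') = Suc (csize c + csize c')"
| "csize (While b c) = Suc (csize c)"
| "csize _ = 1"

fun test_regs :: "test \<Rightarrow> nat" where
  "test_regs (NonZero r) = Suc r"
| "test_regs (Reads S) = 0"

fun regs :: "com \<Rightarrow> nat" where
  "regs (Inc r) = Suc r"
| "regs (Dec r) = Suc r"
| "regs (c ;; c') = max (regs c) (regs c')"
| "regs (Cond b c c') = max (test_regs b) (max (regs c) (regs c'))"
| "regs (While b c) = max (test_regs b) (regs c)"
| "regs _ = 0"

section \<open>Translation of programs into machine code\<close>

definition keep :: "nat list \<Rightarrow> (nat \<times> move) list" where
  "keep rs = map (\<lambda>s. (s, Stay)) rs"

text \<open>On a register tape only cell 0 holds the marker 1 and all others are blank, so a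
  register is zero iff its head reads 1.\<close>

fun test_reads :: "test \<Rightarrow> nat list \<Rightarrow> bool" where
  "test_reads (NonZero r) rs \<longleftrightarrow> rs ! (r + 2) \<noteq> 1"
| "test_reads (Reads S) rs \<longleftrightarrow> rs ! 0 \<in> S"

text \<open>The code of a command is placed at address \<open>a\<close> and leaves to address \<open>k\<close>.\<close>

fun assemble :: "com \<Rightarrow> nat \<Rightarrow> nat \<Rightarrow> (nat list \<Rightarrow> action) list" where
  "assemble Skip a k = [\<lambda>rs. Step k (keep rs)]"
| "assemble (Inc r) a k = [\<lambda>rs. Step k ((keep rs)[r + 2 := (rs ! (r + 2), MoveR)])]"
| "assemble (Dec r) a k = [\<lambda>rs. Step k ((keep rs)[r + 2 := (rs ! (r + 2), MoveL)])]"
| "assemble (Emit b) a k = [\<lambda>rs. Step k ((keep rs)[1 := (if b then 2 else 1, MoveR)])]"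
| "assemble (Head m) a k = [\<lambda>rs. Step k ((keep rs)[0 := (rs ! 0, m)])]"
| "assemble (c ;; c') a k = assemble c a (a + csize c) @ assemble c' (a + csize c) k"
| "assemble (Cond b c c') a k =
     (\<lambda>rs. Step (if test_reads b rs then Suc a else Suc a + csize c) (keep rs))
     # assemble c (Suc a) k @ assemble c' (Suc a + csize c) k"
| "assemble (While b c) a k =
     (\<lambda>rs. Step (if test_reads b rs then Suc a else k) (keep rs)) # assemble c (Suc a) a"

lemma length_comp [simp]: "length (assemble c a k) = csize c"
  by (induction c arbitrary: a k) auto

lemma csize_pos [simp]: "csize c > 0"
  by (induction c) auto

definition counter :: "nat \<Rightarrow> tape" where
  "counter n = (\<lambda>i. if i = 0 then 1 else 0, int n)"

definition tapes :: "bool list \<Rightarrow> nat \<Rightarrow> cstate \<Rightarrow> tape list" where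
  "tapes x R s = (case s of (h, w, v) \<Rightarrow>
     (fst (tape_of x), h) # (fst (tape_of w), int (length w)) # map (\<lambda>r. counter (v r)) [0..<R])"

lemma length_tapes [simp]: "length (tapes x R s) = R + 2"
  by (cases s) (simp add: tapes_def)

definition reads :: "tape list \<Rightarrow> nat list" where
  "reads ts = map (\<lambda>(f, h). f h) ts"

lemma length_reads [simp]: "length (reads ts) = length ts"
  by (simp add: reads_def)

lemma write_keep [simp]: "map2 write_move (keep (reads ts)) ts = ts"
  by (rule nth_equalityI) (auto simp: keep_def reads_def write_move_def split: prod.split)

lemma write_keep_update:
  "i < length ts \<Longrightarrow>
   map2 write_move ((keep (reads ts))[i := a]) ts = ts[i := write_move a (ts ! i)]"
  by (rule nth_equalityI)
    (auto simp: keep_def reads_def write_move_def nth_list_update split: prod.split)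

lemma nth_tapes:
  "tapes x R (h, w, v) ! 0 = (fst (tape_of x), h)"
  "tapes x R (h, w, v) ! 1 = (fst (tape_of w), int (length w))"
  "tapes x R (h, w, v) ! (Suc 0) = (fst (tape_of w), int (length w))"
  "r < R \<Longrightarrow> tapes x R (h, w, v) ! (r + 2) = counter (v r)"
  by (auto simp: tapes_def)

lemma test_reads_tapes:
  assumes "test_regs b \<le> R"
  shows "test_reads b (reads (tapes x R s)) \<longleftrightarrow> holds x b s"
proof (cases s)
  case (fields h w v)
  show ?thesis
  proof (cases b)
    case (NonZero r)
    then show ?thesis using assms fields
      by (simp add: reads_def nth_tapes counter_def del: add_2_eq_Suc')
  next
    case (Reads S)
    then show ?thesis using fields by (simp add: reads_def tapes_def)
  qed
qed

lemma tape_of_snoc: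
  "fst (tape_of (w @ [b])) = (fst (tape_of w))(int (length w) := (if b then 2 else 1))"
  by (rule ext) (auto simp: tape_of_def nth_append)

lemma tapes_update:
  "r < R \<Longrightarrow> (tapes x R (h, w, v))[r + 2 := counter n] = tapes x R (h, w, v(r := n))"
  "(tapes x R (h, w, v))[0 := (fst (tape_of x), h')] = tapes x R (h', w, v)"
  "(tapes x R (h, w, v))[1 := (fst (tape_of w'), int (length w'))] = tapes x R (h, w', v)"
  by (auto simp: tapes_def intro!: nth_equalityI simp: nth_list_update)

definition located :: "machine \<Rightarrow> nat \<Rightarrow> (nat list \<Rightarrow> action) list \<Rightarrow> bool" where
  "located M a ps \<longleftrightarrow> (\<forall>i<length ps. program M ! (a + i) = ps ! i)"

lemma located_Cons: "located M a (p # ps) \<longleftrightarrow> program M ! a = p \<and> located M (Suc a) ps"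
  by (auto simp: located_def nth_Cons split: nat.splits)

lemma located_append:
  "located M a (ps @ qs) \<longleftrightarrow> located M a ps \<and> located M (a + length ps) qs"
  apply (auto simp: located_def nth_append)
  apply (metis add_diff_cancel_left' add.assoc nat_add_left_cancel_less not_add_less1)
  by (metis add.assoc le_add_diff_inverse nat_add_left_cancel_less not_less)

lemma step_Step:
  "(program M ! a) (reads ts) = Step q as \<Longrightarrow> step orc M (a, ts) = (q, map2 write_move as ts)"
  by (simp add: step_def current_action_def reads_def)

lemma step_shift:
  "program M ! a = (\<lambda>rs. Step q ((keep rs)[i := (rs ! i, m)])) \<Longrightarrow> i < length ts \<Longrightarrow>
   step orc M (a, ts) = (q, ts[i := (fst (ts ! i), snd (ts ! i) + offset m)])"
  by (simp add: step_Step write_keep_update)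
    (simp add: write_move_def reads_def split: prod.split)

text \<open>Because the time index is exact, consecutive runs are glued with
  \<open>funpow_add\<close>. The addresses \<open>a\<close> and \<open>k\<close> stay arbitrary in
  the induction: subprograms are placed elsewhere, and the body of a loop exits to the test of that
  loop.\<close>

lemma comp_correct:
  "exec x c s t s' \<Longrightarrow> regs c \<le> R \<Longrightarrow> located M a (assemble c a k) \<Longrightarrow>
   (step orc M ^^ t) (a, tapes x R s) = (k, tapes x R s')"
proof (induction arbitrary: a k rule: exec.induct)
  case (exec_Skip s)
  then show ?case by (simp add: located_Cons step_Step)
next
  case (exec_Inc r h w v)
  let ?ts = "tapes x R (h, w, v)"
  have "step orc M (a, ?ts) = (k, ?ts[r + 2 := (fst (?ts ! (r + 2)), snd (?ts ! (r + 2)) + offset MoveR)])"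
    using exec_Inc by (intro step_shift) (auto simp: located_Cons)
  also have "(fst (?ts ! (r + 2)), snd (?ts ! (r + 2)) + offset MoveR) = counter (v r + 1)"
    using exec_Inc by (simp add: nth_tapes counter_def del: add_2_eq_Suc')
  finally show ?case using exec_Inc by (simp add: tapes_update del: add_2_eq_Suc')
next
  case (exec_Dec v r h w)
  let ?ts = "tapes x R (h, w, v)"
  have "step orc M (a, ?ts) = (k, ?ts[r + 2 := (fst (?ts ! (r + 2)), snd (?ts ! (r + 2)) + offset MoveL)])"
    using exec_Dec by (intro step_shift) (auto simp: located_Cons)
  also have "(fst (?ts ! (r + 2)), snd (?ts ! (r + 2)) + offset MoveL) = counter (v r - 1)"
    using exec_Dec by (simp add: nth_tapes counter_def of_nat_diff del: add_2_eq_Suc')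
  finally show ?case using exec_Dec by (simp add: tapes_update del: add_2_eq_Suc')
next
  case (exec_Emit b h w v)
  then have "step orc M (a, tapes x R (h, w, v)) =
      (k, (tapes x R (h, w, v))[1 := (fst (tape_of (w @ [b])), int (length (w @ [b])))])"
    by (subst step_Step[where q = k])
       (auto simp: located_Cons write_keep_update nth_tapes write_move_def tape_of_snoc add.commute)
  then show ?case using tapes_update(3)[of x R h w v "w @ [b]"] by (simp del: length_append)
next
  case (exec_Head m h w v)
  let ?ts = "tapes x R (h, w, v)"
  have "step orc M (a, ?ts) = (k, ?ts[0 := (fst (?ts ! 0), snd (?ts ! 0) + offset m)])"
    using exec_Head by (intro step_shift) (auto simp: located_Cons)
  then show ?case by (simp add: tapes_update nth_tapes del: list_update_code)
next
  case (exec_Seq c s t s' c' t' s'')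
  have "(step orc M ^^ t) (a, tapes x R s) = (a + csize c, tapes x R s')"
    using exec_Seq.prems by (intro exec_Seq.IH) (auto simp: located_append)
  moreover have "(step orc M ^^ t') (a + csize c, tapes x R s') = (k, tapes x R s'')"
    using exec_Seq.prems by (intro exec_Seq.IH) (auto simp: located_append)
  ultimately show ?case by (simp add: add.commute[of t] funpow_add)
next
  case (exec_CondT b s c t s' c')
  have "step orc M (a, tapes x R s) = (Suc a, tapes x R s)"
    using exec_CondT.prems exec_CondT.hyps by (simp add: located_Cons test_reads_tapes step_Step)
  moreover have "(step orc M ^^ t) (Suc a, tapes x R s) = (k, tapes x R s')"
    using exec_CondT.prems by (intro exec_CondT.IH) (auto simp: located_Cons located_append)
  ultimately show ?case by (simp add: funpow_Suc_right del: funpow.simps)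
next
  case (exec_CondF b s c' t s' c)
  have "step orc M (a, tapes x R s) = (Suc a + csize c, tapes x R s)"
    using exec_CondF.prems exec_CondF.hyps by (simp add: located_Cons test_reads_tapes step_Step)
  moreover have "(step orc M ^^ t) (Suc a + csize c, tapes x R s) = (k, tapes x R s')"
    using exec_CondF.prems by (intro exec_CondF.IH) (auto simp: located_Cons located_append)
  ultimately show ?case by (simp add: funpow_Suc_right del: funpow.simps)
next
  case (exec_WhileF b s c)
  then show ?case by (simp add: located_Cons test_reads_tapes step_Step)
next
  case (exec_WhileT b s c t s' t' s'')
  have "step orc M (a, tapes x R s) = (Suc a, tapes x R s)"
    using exec_WhileT.prems exec_WhileT.hyps by (simp add: located_Cons test_reads_tapes step_Step)
  moreover have "(step orc M ^^ t) (Suc a, tapes x R s) = (a, tapes x R s')"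
    using exec_WhileT.prems by (intro exec_WhileT.IH) (auto simp: located_Cons)
  moreover have "(step orc M ^^ t') (a, tapes x R s') = (k, tapes x R s'')"
    using exec_WhileT.prems by (intro exec_WhileT.IH)
  ultimately show ?case
    by (simp add: add.commute[of t] funpow_add funpow_Suc_right del: funpow.simps)
qed

section \<open>Upper bounds on running times and counted loops\<close>

definition runs :: "bool list \<Rightarrow> com \<Rightarrow> cstate \<Rightarrow> nat \<Rightarrow> cstate \<Rightarrow> bool" where
  "runs x c s T s' \<longleftrightarrow> (\<exists>t\<le>T. exec x c s t s')"

lemma runs_mono: "runs x c s T s' \<Longrightarrow> T \<le> T' \<Longrightarrow> runs x c s T' s'"
  by (auto simp: runs_def intro: le_trans)

lemma runs_exec: "exec x c s t s' \<Longrightarrow> runs x c s t s'"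
  by (auto simp: runs_def)

lemma runs_conv:
  "runs x c s T s' \<Longrightarrow> s = r \<Longrightarrow> s' = r' \<Longrightarrow> T \<le> T' \<Longrightarrow> runs x c r T' r'"
  by (auto intro: runs_mono)

lemma runs_Skip: "runs x Skip s 1 s"
  by (intro runs_exec exec.intros)

lemma runs_Inc: "runs x (Inc r) (h, w, v) 1 (h, w, v(r := Suc (v r)))"
  using runs_exec[OF exec_Inc] by simp

lemma runs_Dec: "v r > 0 \<Longrightarrow> runs x (Dec r) (h, w, v) 1 (h, w, v(r := v r - 1))"
  by (intro runs_exec exec.intros)

lemma runs_Emit: "runs x (Emit b) (h, w, v) 1 (h, w @ [b], v)"
  by (intro runs_exec exec.intros)

lemma runs_Head: "runs x (Head m) (h, w, v) 1 (h + offset m, w, v)"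
  by (intro runs_exec exec.intros)

lemma runs_Seq: "runs x c s t s' \<Longrightarrow> runs x c' s' t' s'' \<Longrightarrow> runs x (c ;; c') s (t + t') s''"
  unfolding runs_def by (meson add_mono exec_Seq)

lemma runs_CondT: "holds x b s \<Longrightarrow> runs x c s t s' \<Longrightarrow> runs x (Cond b c c') s (Suc t) s'"
  unfolding runs_def by (meson Suc_le_mono exec_CondT)

lemma runs_CondF: "\<not> holds x b s \<Longrightarrow> runs x c' s t s' \<Longrightarrow> runs x (Cond b c c') s (Suc t) s'"
  unfolding runs_def by (meson Suc_le_mono exec_CondF)

lemma runs_WhileF: "\<not> holds x b s \<Longrightarrow> runs x (While b c) s 1 s"
  by (intro runs_exec exec.intros)

lemma runs_WhileT:
  "holds x b s \<Longrightarrow> runs x c s t s' \<Longrightarrow> runs x (While b c) s' t' s'' \<Longrightarrow>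
   runs x (While b c) s (Suc (t + t')) s''"
  unfolding runs_def by (meson Suc_le_mono add_mono exec_WhileT)

lemma runs_loop:
  assumes "\<And>i. i < n \<Longrightarrow> holds x b (S i)" "\<And>i. i < n \<Longrightarrow> runs x c (S i) T (S (Suc i))"
    and "\<not> holds x b (S n)"
  shows "runs x (While b c) (S 0) (n * (T + 1) + 1) (S n)"
proof -
  have "runs x (While b c) (S k) ((n - k) * (T + 1) + 1) (S n)" if "k \<le> n" for k
    using that
  proof (induction rule: inc_induct)
    case base
    show ?case using runs_WhileF[OF assms(3)] by simp
  next
    case (step k)
    have "(n - k) * (T + 1) + 1 = Suc (T + ((n - Suc k) * (T + 1) + 1))"
      using step.hyps by (simp add: Suc_diff_Suc[symmetric])
    then show ?case using runs_WhileT[OF assms(1,2) step.IH] step.hyps by simp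
  qed
  from this[of 0] show ?thesis by simp
qed

text \<open>The counter \<open>a\<close> is overwritten in \<open>v i\<close>, so the family
  \<open>v\<close> has to describe only the other registers. Each round pays two extra steps, for
  the test and for \<open>Dec a\<close>.\<close>

lemma runs_drain:
  assumes "\<And>i. i < n \<Longrightarrow> runs x c (h i, w i, (v i)(a := n - Suc i)) T
      (h (Suc i), w (Suc i), (v (Suc i))(a := n - Suc i))"
  shows "runs x (While (NonZero a) (Dec a ;; c)) (h 0, w 0, (v 0)(a := n)) (n * (T + 2) + 1)
      (h n, w n, (v n)(a := 0))"
proof -
  define S where "S i = (h i, w i, (v i)(a := n - i))" for i
  have "runs x (Dec a ;; c) (S i) (1 + T) (S (Suc i))" if "i < n" for i
  proof (rule runs_Seq)
    show "runs x (Dec a) (S i) 1 (h i, w i, (v i)(a := n - Suc i))"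
      using runs_Dec[of "(v i)(a := n - i)" a x "h i" "w i"] that by (simp add: S_def)
  qed (use assms[OF that] in \<open>simp add: S_def\<close>)
  then have "runs x (While (NonZero a) (Dec a ;; c)) (S 0) (n * (1 + T + 1) + 1) (S n)"
    by (intro runs_loop) (auto simp: S_def)
  then show ?thesis by (simp add: S_def)
qed

lemmas runs_drain' = runs_drain[where h = "\<lambda>_. h" and w = "\<lambda>_. w" for h w]

lemma runs_conv':
  "runs x c s T s' \<Longrightarrow> s' = r' \<Longrightarrow> T \<le> T' \<Longrightarrow> runs x c s T' r'"
  by (auto intro: runs_mono)

text \<open>The \<open>Skip\<close> gives the loop the shape that \<open>runs_drain\<close>
  handles.\<close>

definition clear :: "nat \<Rightarrow> com" where
  "clear a = While (NonZero a) (Dec a ;; Skip)"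

definition move :: "nat \<Rightarrow> nat \<Rightarrow> com" where
  "move a b = While (NonZero a) (Dec a ;; Inc b)"

text \<open>Reading out a counter destroys it, so a copy fills two registers, one of which is moved
  back afterwards.\<close>

definition dup :: "nat \<Rightarrow> nat \<Rightarrow> nat \<Rightarrow> com" where
  "dup a b c = While (NonZero a) (Dec a ;; Inc b ;; Inc c)"

lemma runs_clear: "runs x (clear a) (h, w, v) (3 * v a + 1) (h, w, v(a := 0))"
  unfolding clear_def
  by (rule runs_conv[OF runs_drain'[of "v a" x Skip h w "\<lambda>_. v" a 1]]) (auto intro: runs_Skip[unfolded One_nat_def])

lemma runs_move:
  assumes "a \<noteq> b"
  shows "runs x (move a b) (h, w, v) (3 * v a + 1) (h, w, v(a := 0, b := v b + v a))"
proof -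
  have "runs x (Inc b) (h, w, (v(b := v b + i))(a := v a - Suc i)) 1
      (h, w, (v(b := v b + Suc i))(a := v a - Suc i))" for i
    by (rule runs_conv'[OF runs_Inc[of x b h w "(v(b := v b + i))(a := v a - Suc i)"]])
      (use assms in \<open>auto simp: fun_eq_iff\<close>)
  then show ?thesis unfolding move_def
    by (intro runs_conv[OF runs_drain'[of "v a" x "Inc b" h w "\<lambda>i. v(b := v b + i)" a 1]])
      (use assms in \<open>auto simp: fun_eq_iff\<close>)
qed

lemma runs_dup:
  assumes "a \<noteq> b" "a \<noteq> c" "b \<noteq> c"
  shows "runs x (dup a b c) (h, w, v) (4 * v a + 1)
    (h, w, v(a := 0, b := v b + v a, c := v c + v a))"
proof -
  have "runs x (Inc b ;; Inc c) (h, w, (v(b := v b + i, c := v c + i))(a := v a - Suc i)) 2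
      (h, w, (v(b := v b + Suc i, c := v c + Suc i))(a := v a - Suc i))" for i
    by (rule runs_conv'[OF runs_Seq[OF runs_Inc runs_Inc]])
      (use assms in \<open>auto simp: fun_eq_iff\<close>)
  then show ?thesis unfolding dup_def
    by (intro runs_conv[OF runs_drain'[of "v a" x _ h w "\<lambda>i. v(b := v b + i, c := v c + i)" a 2]])
      (use assms in \<open>auto simp: fun_eq_iff\<close>)
qed

section \<open>Arithmetic expressions in unary registers\<close>

datatype nexp = Const nat | Len | Var nat | Add nexp nexp | Mul nexp nexp | Inp nexp

fun nval :: "bool list \<Rightarrow> (nat \<Rightarrow> nat) \<Rightarrow> nexp \<Rightarrow> nat" where
  "nval x v (Const c) = c"
| "nval x v Len = length x"
| "nval x v (Var r) = v r"
| "nval x v (Add a b) = nval x v a + nval x v b"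
| "nval x v (Mul a b) = nval x v a * nval x v b"
| "nval x v (Inp a) = fst (tape_of x) (int (nval x v a))"

fun nvars :: "nexp \<Rightarrow> nat set" where
  "nvars (Var r) = {r}"
| "nvars (Add a b) = nvars a \<union> nvars b"
| "nvars (Mul a b) = nvars a \<union> nvars b"
| "nvars (Inp a) = nvars a"
| "nvars _ = {}"

fun incs :: "nat \<Rightarrow> nat \<Rightarrow> com" where
  "incs 0 d = Skip"
| "incs (Suc c) d = Inc d ;; incs c d"

text \<open>Registers from \<open>d\<close> on are free; the result is left in \<open>d\<close>.\<close>

fun cnexp :: "nexp \<Rightarrow> nat \<Rightarrow> com" where
  "cnexp (Const c) d = incs c d"
| "cnexp Len d =
     While (Reads {1, 2}) (Head MoveR ;; Inc d ;; Inc (d + 1)) ;;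
     While (NonZero (d + 1)) (Dec (d + 1) ;; Head MoveL)"
| "cnexp (Var r) d = dup r d (d + 1) ;; move (d + 1) r"
| "cnexp (Add a b) d = cnexp a d ;; cnexp b (d + 1) ;; move (d + 1) d"
| "cnexp (Mul a b) d = cnexp a d ;; cnexp b (d + 1) ;;
     While (NonZero d) (Dec d ;; dup (d + 1) (d + 2) (d + 3) ;; move (d + 3) (d + 1)) ;;
     clear (d + 1) ;; move (d + 2) d"
| "cnexp (Inp a) d = cnexp a d ;;
     While (NonZero d) (Dec d ;; Head MoveR ;; Inc (d + 1)) ;;
     Cond (Reads {1}) (Inc d) (Cond (Reads {2}) (Inc d ;; Inc d) Skip) ;;
     While (NonZero (d + 1)) (Dec (d + 1) ;; Head MoveL)"

lemma runs_incs: "runs x (incs c d) (h, w, v) (c + 1) (h, w, v(d := v d + c))"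
proof (induction c arbitrary: v)
  case 0
  then show ?case using runs_Skip[of x "(h, w, v)"] by simp
next
  case (Suc c)
  show ?case unfolding incs.simps
    by (rule runs_conv'[OF runs_Seq[OF runs_Inc Suc]]) (auto simp: fun_eq_iff)
qed

lemma poly_nat_mono: "B \<le> B' \<Longrightarrow> poly p B \<le> poly (p :: nat poly) B'"
  by (induction p) (auto intro: add_mono mult_mono)

lemma runs_head_left:
  "runs x (While (NonZero d) (Dec d ;; Head MoveL)) (h, w, v) (3 * v d + 1)
    (h - int (v d), w, v(d := 0))"
proof -
  have "runs x (Head MoveL) (h - int i, w, v(d := v d - Suc i)) 1
      (h - int (Suc i), w, v(d := v d - Suc i))" for i
    by (rule runs_conv'[OF runs_Head]) auto
  then show ?thesis
    by (intro runs_conv[OF runs_drain[of "v d" x _ "\<lambda>i. h - int i" "\<lambda>_. w" "\<lambda>_. v" d 1]]) auto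
qed

lemma runs_head_right:
  assumes "d \<noteq> e"
  shows "runs x (While (NonZero d) (Dec d ;; Head MoveR ;; Inc e)) (h, w, v) (4 * v d + 1)
    (h + int (v d), w, v(d := 0, e := v e + v d))"
proof -
  have "runs x (Head MoveR ;; Inc e) (h + int i, w, (v(e := v e + i))(d := v d - Suc i)) 2
      (h + int (Suc i), w, (v(e := v e + Suc i))(d := v d - Suc i))" for i
    by (rule runs_conv'[OF runs_Seq[OF runs_Head runs_Inc]]) (use assms in \<open>auto simp: fun_eq_iff\<close>)
  then show ?thesis
    by (intro runs_conv[OF runs_drain[of "v d" x _ "\<lambda>i. h + int i" "\<lambda>_. w" "\<lambda>i. v(e := v e + i)" d 2]])
      (use assms in \<open>auto simp: fun_eq_iff\<close>)
qed

text \<open>One polynomial bounds both the value and the running time: registers are unary, so later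
  loops take time proportional to the value. \<open>B\<close> bounds the variables and the input
  length, and the polynomial depends neither on the input nor on the base register
  \<open>d\<close>.\<close>

definition nspec :: "nexp \<Rightarrow> nat \<Rightarrow> nat poly \<Rightarrow> bool" where
  "nspec e D p \<longleftrightarrow> (\<forall>x env B v w d. D \<le> d \<longrightarrow> (\<forall>r<D. v r = env r \<and> env r \<le> B) \<longrightarrow>
     (\<forall>r\<ge>d. v r = 0) \<longrightarrow> length x \<le> B \<longrightarrow>
     nval x env e \<le> poly p B \<and>
     runs x (cnexp e d) (0, w, v) (poly p B) (0, w, v(d := nval x env e)))"

lemma nspecD:
  assumes "nspec e D p" "D \<le> d" "\<And>r. r < D \<Longrightarrow> v r = env r \<and> env r \<le> B"
    "\<And>r. r \<ge> d \<Longrightarrow> v r = 0" "length x \<le> B"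
  shows "nval x env e \<le> poly p B"
    and "runs x (cnexp e d) (0, w, v) (poly p B) (0, w, v(d := nval x env e))"
  using assms unfolding nspec_def by blast+

lemma nspecI:
  assumes "\<And>x env B v w d. D \<le> d \<Longrightarrow> (\<And>r. r < D \<Longrightarrow> v r = env r \<and> env r \<le> B) \<Longrightarrow>
     (\<And>r. r \<ge> d \<Longrightarrow> v r = 0) \<Longrightarrow> length x \<le> B \<Longrightarrow>
     nval x env e \<le> poly p B \<and>
     runs x (cnexp e d) (0, w, v) (poly p B) (0, w, v(d := nval x env e))"
  shows "nspec e D p"
  using assms unfolding nspec_def by blast

lemma nspec_Const: "nspec (Const c) D [:c + 1:]"
proof (rule nspecI, rule conjI)
  fix x w :: "bool list" and d :: nat and v env :: "nat \<Rightarrow> nat"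
  assume "\<And>r. r \<ge> d \<Longrightarrow> v r = 0"
  then show "runs x (cnexp (Const c) d) (0, w, v) (poly [:c + 1:] B) (0, w, v(d := nval x env (Const c)))" for B
    using runs_incs[of x c d 0 w v] by simp
qed simp

lemma nspec_Len: "nspec Len D [:2, 7:]"
proof (rule nspecI, rule conjI)
  fix x w :: "bool list" and B d :: nat and v env :: "nat \<Rightarrow> nat"
  assume d: "\<And>r. r \<ge> d \<Longrightarrow> v r = 0" and B: "length x \<le> B"
  then show "nval x env Len \<le> poly [:2, 7:] B" by simp
  define S where "S i = (int i, w, v(d := i, d + 1 := i))" for i
  have "runs x (Head MoveR ;; Inc d ;; Inc (d + 1)) (S i) 3 (S (Suc i))" for i
    unfolding S_def
    by (rule runs_conv'[OF runs_Seq[OF runs_Head runs_Seq[OF runs_Inc runs_Inc]]])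
      (auto simp: fun_eq_iff)
  then have "runs x (While (Reads {1, 2}) (Head MoveR ;; Inc d ;; Inc (d + 1)))
      (S 0) (length x * (3 + 1) + 1) (S (length x))"
    by (intro runs_loop) (auto simp: S_def tape_of_def)
  from runs_Seq[OF this runs_head_left[of x "d + 1" "int (length x)" w "v(d := length x, d + 1 := length x)",
      folded S_def]]
  show "runs x (cnexp Len d) (0, w, v) (poly [:2, 7:] B) (0, w, v(d := nval x env Len))"
    unfolding cnexp.simps
    by (rule runs_conv) (use B d in \<open>auto simp: S_def fun_eq_iff\<close>)
qed

lemma nspec_Var:
  assumes "r < D"
  shows "nspec (Var r) D [:2, 7:]"
proof (rule nspecI, rule conjI)
  fix x w :: "bool list" and B d :: nat and v env :: "nat \<Rightarrow> nat"
  assume D: "D \<le> d" and B: "\<And>r. r < D \<Longrightarrow> v r = env r \<and> env r \<le> B"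
    and d: "\<And>r. r \<ge> d \<Longrightarrow> v r = 0"
  have r: "v r = env r" "env r \<le> B" "r < d" using assms B D by auto
  then show "nval x env (Var r) \<le> poly [:2, 7:] B" by simp
  show "runs x (cnexp (Var r) d) (0, w, v) (poly [:2, 7:] B) (0, w, v(d := nval x env (Var r)))"
    unfolding cnexp.simps
    by (rule runs_conv'[OF runs_Seq[OF runs_dup runs_move]])
      (use r d in \<open>auto simp: fun_eq_iff\<close>)
qed

lemma nspec_Add:
  assumes a: "nspec a D p" and b: "nspec b D q"
  shows "nspec (Add a b) D (p + 4 * q + 1)"
proof (rule nspecI, rule conjI)
  fix x w :: "bool list" and B d :: nat and v env :: "nat \<Rightarrow> nat"
  assume D: "D \<le> d" and B: "\<And>r. r < D \<Longrightarrow> v r = env r \<and> env r \<le> B"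
    and d: "\<And>r. r \<ge> d \<Longrightarrow> v r = 0" and x: "length x \<le> B"
  note a = nspecD[OF a, where d = d and v = v and env = env and x = x, OF D B d x]
  define v' where "v' = v(d := nval x env a)"
  have prems: "D \<le> d + 1" "\<And>r. r < D \<Longrightarrow> v' r = env r \<and> env r \<le> B" "\<And>r. r \<ge> d + 1 \<Longrightarrow> v' r = 0"
    using D B d by (auto simp: v'_def)
  note b = nspecD[OF b, where v = v' and env = env and d = "d + 1" and x = x, OF prems x]
  show "nval x env (Add a b) \<le> poly (p + 4 * q + 1) B" using a(1) b(1) by simp
  show "runs x (cnexp (Add a b) d) (0, w, v) (poly (p + 4 * q + 1) B) (0, w, v(d := nval x env (Add a b)))"
    unfolding cnexp.simps
    by (rule runs_conv'[OF runs_Seq[OF a(2)[folded v'_def] runs_Seq[OF b(2) runs_move]]])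
      (use b(1) d in \<open>auto simp: fun_eq_iff v'_def\<close>)
qed

text \<open>The summands of the bound follow the code: both factors, a loop that adds the second
  factor once per unit of the first, \<open>clear\<close>, and the final \<open>move\<close> of a
  value up to \<open>p * q\<close>.\<close>

lemma nspec_Mul:
  assumes a: "nspec a D p" and b: "nspec b D q"
  shows "nspec (Mul a b) D (p + q + p * (7 * q + 4) + 3 * q + 3 * p * q + 3)"
proof (rule nspecI, rule conjI)
  fix x w :: "bool list" and B d :: nat and v env :: "nat \<Rightarrow> nat"
  assume D: "D \<le> d" and B: "\<And>r. r < D \<Longrightarrow> v r = env r \<and> env r \<le> B"
    and d: "\<And>r. r \<ge> d \<Longrightarrow> v r = 0" and x: "length x \<le> B"
  let ?m = "nval x env a" and ?n = "nval x env b"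
  note a = nspecD[OF a, where d = d and v = v and env = env and x = x, OF D B d x]
  define v' where "v' = v(d := ?m)"
  have prems: "D \<le> d + 1" "\<And>r. r < D \<Longrightarrow> v' r = env r \<and> env r \<le> B" "\<And>r. r \<ge> d + 1 \<Longrightarrow> v' r = 0"
    using D B d by (auto simp: v'_def)
  note b = nspecD[OF b, where v = v' and env = env and d = "d + 1" and x = x, OF prems x]
  have mn: "?m * ?n \<le> poly p B * poly q B" using a(1) b(1) by (rule mult_mono) auto
  have mn': "?m * (7 * ?n + 4) \<le> poly p B * (7 * poly q B + 4)" using a(1) b(1) by (intro mult_mono) auto
  show "nval x env (Mul a b) \<le> poly (p + q + p * (7 * q + 4) + 3 * q + 3 * p * q + 3) B"
    using mn by simp
  define V where "V i = v(d + 1 := ?n, d + 2 := i * ?n)" for i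
  have "runs x (dup (d + 1) (d + 2) (d + 3) ;; move (d + 3) (d + 1))
      (0, w, (V i)(d := ?m - Suc i)) (7 * ?n + 2) (0, w, (V (Suc i))(d := ?m - Suc i))" for i
    by (rule runs_conv'[OF runs_Seq[OF runs_dup runs_move]])
      (use d in \<open>auto simp: fun_eq_iff V_def\<close>)
  then have "runs x (While (NonZero d) (Dec d ;; dup (d + 1) (d + 2) (d + 3) ;; move (d + 3) (d + 1)))
      (0, w, (V 0)(d := ?m)) (?m * (7 * ?n + 2 + 2) + 1) (0, w, (V ?m)(d := 0))"
    by (rule runs_drain')
  then have *: "runs x (While (NonZero d) (Dec d ;; dup (d + 1) (d + 2) (d + 3) ;; move (d + 3) (d + 1)))
      (0, w, v'(d + 1 := ?n)) (?m * (7 * ?n + 4) + 1) (0, w, (V ?m)(d := 0))"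
    by (rule runs_conv) (use d in \<open>auto simp: fun_eq_iff V_def v'_def algebra_simps\<close>)
  show "runs x (cnexp (Mul a b) d) (0, w, v)
      (poly (p + q + p * (7 * q + 4) + 3 * q + 3 * p * q + 3) B) (0, w, v(d := nval x env (Mul a b)))"
    unfolding cnexp.simps
    by (rule runs_conv'[OF runs_Seq[OF a(2)[folded v'_def] runs_Seq[OF b(2) runs_Seq[OF * runs_Seq[OF runs_clear runs_move]]]]])
      (use b(1) d mn mn' in \<open>auto simp: fun_eq_iff V_def\<close>)
qed

lemma nspec_Inp:
  assumes a: "nspec a D p"
  shows "nspec (Inp a) D (8 * p + 8)"
proof (rule nspecI, rule conjI)
  fix x w :: "bool list" and B d :: nat and v env :: "nat \<Rightarrow> nat"
  assume D: "D \<le> d" and B: "\<And>r. r < D \<Longrightarrow> v r = env r \<and> env r \<le> B"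
    and d: "\<And>r. r \<ge> d \<Longrightarrow> v r = 0" and x: "length x \<le> B"
  let ?m = "nval x env a"
  note a = nspecD[OF a, where d = d and v = v and env = env and x = x, OF D B d x]
  let ?s = "fst (tape_of x) (int ?m)"
  have s: "?s \<in> {0, 1, 2}" by (auto simp: tape_of_def)
  then show "nval x env (Inp a) \<le> poly (8 * p + 8) B" by auto
  have 1: "runs x (While (NonZero d) (Dec d ;; Head MoveR ;; Inc (d + 1))) (0, w, v(d := ?m))
      (4 * ?m + 1) (int ?m, w, v(d + 1 := ?m))"
    by (rule runs_conv[OF runs_head_right[of d "d + 1" x 0 w "v(d := ?m)"]]) (use d in \<open>auto simp: fun_eq_iff\<close>)
  have 2: "runs x (Cond (Reads {1}) (Inc d) (Cond (Reads {2}) (Inc d ;; Inc d) Skip))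
     (int ?m, w, v(d + 1 := ?m)) 4 (int ?m, w, v(d + 1 := ?m, d := ?s))"
    using s
  proof (elim insertE emptyE)
    assume "?s = 0"
    then show ?thesis
      by (intro runs_conv'[OF runs_CondF[OF _ runs_CondF[OF _ runs_Skip]]]) (use d in \<open>auto simp: fun_eq_iff\<close>)
  next
    assume "?s = 1"
    then show ?thesis
      by (intro runs_conv'[OF runs_CondT[OF _ runs_Inc]]) (use d in \<open>auto simp: fun_eq_iff\<close>)
  next
    assume "?s = 2"
    then show ?thesis
      by (intro runs_conv'[OF runs_CondF[OF _ runs_CondT[OF _ runs_Seq[OF runs_Inc runs_Inc]]]])
        (use d in \<open>auto simp: fun_eq_iff\<close>)
  qed
  show "runs x (cnexp (Inp a) d) (0, w, v) (poly (8 * p + 8) B) (0, w, v(d := nval x env (Inp a)))"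
    unfolding cnexp.simps
    by (rule runs_conv'[OF runs_Seq[OF a(2) runs_Seq[OF 1 runs_Seq[OF 2 runs_head_left]]]])
      (use a(1) d in \<open>auto simp: fun_eq_iff\<close>)
qed

lemma nspec_exists: "nvars e \<subseteq> {..<D} \<Longrightarrow> \<exists>p. nspec e D p"
proof (induction e)
  case (Const c)
  show ?case using nspec_Const by blast
next
  case Len
  show ?case using nspec_Len by blast
next
  case (Var r)
  then show ?case using nspec_Var by auto
next
  case (Add a b)
  then show ?case using nspec_Add by (metis Un_subset_iff nvars.simps(2))
next
  case (Mul a b)
  then show ?case using nspec_Mul by (metis Un_subset_iff nvars.simps(3))
next
  case (Inp a)
  then show ?case using nspec_Inp by (metis nvars.simps(4))
qed

section \<open>A printing language\<close>

definition halve :: "nat \<Rightarrow> com" where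
  "halve d = While (NonZero d)
     (Dec d ;; Cond (NonZero d) (Dec d ;; Inc (d + 1)) (Inc (d + 2)))"

lemma runs_halve:
  "v (d + 2) = 0 \<Longrightarrow> runs x (halve d) (h, w, v) (5 * v d + 1)
     (h, w, v(d := 0, d + 1 := v (d + 1) + v d div 2, d + 2 := v d mod 2))"
proof (induction "v d" arbitrary: v rule: less_induct)
  case less
  consider "v d = 0" | "v d = 1" | "v d \<ge> 2" by linarith
  then show ?case
  proof cases
    case 1
    with less.prems show ?thesis unfolding halve_def
      by (intro runs_conv'[OF runs_WhileF]) (auto simp: fun_eq_iff)
  next
    case 2
    let ?v = "v(d := 0, d + 2 := 1)"
    have "runs x (Dec d ;; Cond (NonZero d) (Dec d ;; Inc (d + 1)) (Inc (d + 2))) (h, w, v) 3 (h, w, ?v)"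
      by (rule runs_conv'[OF runs_Seq[OF runs_Dec runs_CondF[OF _ runs_Inc]]])
        (use 2 less.prems in \<open>auto simp: fun_eq_iff\<close>)
    from runs_WhileT[where b = "NonZero d", OF _ this runs_WhileF]
    have "runs x (halve d) (h, w, v) (Suc (3 + 1)) (h, w, ?v)"
      unfolding halve_def using 2 by simp
    then show ?thesis
      by (rule runs_conv') (use 2 less.prems in \<open>auto simp: fun_eq_iff\<close>)
  next
    case 3
    then obtain k where k: "v d = k + 2" by (metis le_add_diff_inverse2)
    let ?v = "v(d := k, d + 1 := v (d + 1) + 1)"
    have "runs x (Dec d ;; Cond (NonZero d) (Dec d ;; Inc (d + 1)) (Inc (d + 2))) (h, w, v) 4 (h, w, ?v)"
      by (rule runs_conv'[OF runs_Seq[OF runs_Dec runs_CondT[OF _ runs_Seq[OF runs_Dec runs_Inc]]]])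
        (use k in \<open>auto simp: fun_eq_iff\<close>)
    moreover have "runs x (halve d) (h, w, ?v) (5 * ?v d + 1)
       (h, w, ?v(d := 0, d + 1 := ?v (d + 1) + ?v d div 2, d + 2 := ?v d mod 2))"
      by (rule less.hyps) (use k less.prems in auto)
    ultimately have "runs x (halve d) (h, w, v) (Suc (4 + (5 * ?v d + 1)))
       (h, w, ?v(d := 0, d + 1 := ?v (d + 1) + ?v d div 2, d + 2 := ?v d mod 2))"
      unfolding halve_def by (rule runs_WhileT[rotated]) (use k in simp)
    then show ?thesis
      by (rule runs_conv') (use k in \<open>auto simp: fun_eq_iff\<close>)
  qed
qed

text \<open>Meant for polynomially bounded values such as passenger indices: the running time is
  quadratic in the value, not in its number of digits.\<close>

definition emit_nat :: "nat \<Rightarrow> com" where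
  "emit_nat d = While (NonZero d) (Emit True ;; halve d ;;
     Cond (NonZero (d + 2)) (Dec (d + 2) ;; Emit True) (Emit False) ;; move (d + 1) d) ;; Emit False"

lemma enc_nat_0 [simp]: "enc_nat 0 = [False]"
  by (subst enc_nat.simps) simp

lemma enc_nat_pos: "m \<noteq> 0 \<Longrightarrow> enc_nat m = True # odd m # enc_nat (m div 2)"
  by (subst enc_nat.simps) simp

text \<open>The loop of \<open>emit_nat\<close> prints everything except the closing
  \<open>False\<close>, so its invariant speaks of \<open>butlast\<close>.\<close>

lemma enc_nat_butlast: "butlast (enc_nat m) @ [False] = enc_nat m"
proof (induction m rule: less_induct)
  case (less m)
  show ?case
  proof (cases "m = 0")
    case False
    then show ?thesis using less[of "m div 2"] by (auto simp: enc_nat_pos[OF False])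
  qed simp
qed

lemma butlast_enc_nat_pos:
  assumes "m \<noteq> 0"
  shows "butlast (enc_nat m) = [True, odd m] @ butlast (enc_nat (m div 2))"
proof -
  have "enc_nat (m div 2) \<noteq> []" using enc_nat_butlast[of "m div 2"] by auto
  then show ?thesis by (simp add: enc_nat_pos[OF assms])
qed

lemma runs_emit_nat:
  assumes "v (d + 1) = 0" "v (d + 2) = 0"
  shows "runs x (emit_nat d) (h, w, v) (v d * (8 * v d + 10) + 2) (h, w @ enc_nat (v d), v(d := 0))"
proof -
  let ?c = "Emit True ;; halve d ;;
     Cond (NonZero (d + 2)) (Dec (d + 2) ;; Emit True) (Emit False) ;; move (d + 1) d"
  have loop: "runs x (While (NonZero d) ?c) (h, w, v) (v d * (8 * v d + 10) + 1)
      (h, w @ butlast (enc_nat (v d)), v(d := 0))"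
    using assms
  proof (induction "v d" arbitrary: v w rule: less_induct)
    case less
    show ?case
    proof (cases "v d = 0")
      case True
      then show ?thesis by (intro runs_conv'[OF runs_WhileF]) (auto simp: fun_eq_iff)
    next
      case False
      let ?m = "v d"
      let ?v1 = "v(d := 0, d + 1 := ?m div 2, d + 2 := of_bool (odd ?m))"
      let ?v2 = "v(d := 0, d + 1 := ?m div 2)"
      let ?v3 = "v(d := ?m div 2)"
      have "?m mod 2 = of_bool (odd ?m)" by (simp add: mod2_eq_if)
      then have 1: "runs x (halve d) (h, w @ [True], v) (5 * ?m + 1) (h, w @ [True], ?v1)"
        by (intro runs_conv'[OF runs_halve]) (use less.prems in \<open>simp_all add: fun_eq_iff\<close>)
      have 2: "runs x (Cond (NonZero (d + 2)) (Dec (d + 2) ;; Emit True) (Emit False))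
         (h, w @ [True], ?v1) 3 (h, w @ [True, odd ?m], ?v2)"
      proof (cases "odd ?m")
        case True
        then show ?thesis
          by (intro runs_conv'[OF runs_CondT[OF _ runs_Seq[OF runs_Dec runs_Emit]]])
            (use less.prems in \<open>auto simp: fun_eq_iff\<close>)
      next
        case False
        then show ?thesis
          by (intro runs_conv'[OF runs_CondF[OF _ runs_Emit]])
            (use less.prems in \<open>auto simp: fun_eq_iff\<close>)
      qed
      have 3: "runs x (move (d + 1) d) (h, w @ [True, odd ?m], ?v2) (3 * ?m + 1) (h, w @ [True, odd ?m], ?v3)"
        by (rule runs_conv'[OF runs_move]) (use less.prems in \<open>auto simp: fun_eq_iff\<close>)
      have 4: "runs x ?c (h, w, v) (8 * ?m + 6) (h, w @ [True, odd ?m], ?v3)"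
        by (rule runs_conv'[OF runs_Seq[OF runs_Emit runs_Seq[OF 1 runs_Seq[OF 2 3]]]]) auto
      have "runs x (While (NonZero d) ?c) (h, w @ [True, odd ?m], ?v3) (?v3 d * (8 * ?v3 d + 10) + 1)
          (h, (w @ [True, odd ?m]) @ butlast (enc_nat (?v3 d)), ?v3(d := 0))"
        by (rule less.hyps) (use False less.prems in auto)
      from runs_WhileT[where b = "NonZero d", OF _ 4 this] False
      have "runs x (While (NonZero d) ?c) (h, w, v) (Suc (8 * ?m + 6 + (?v3 d * (8 * ?v3 d + 10) + 1)))
          (h, (w @ [True, odd ?m]) @ butlast (enc_nat (?v3 d)), ?v3(d := 0))" by simp
      moreover have "butlast (enc_nat ?m) = [True, odd ?m] @ butlast (enc_nat (?m div 2))"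
        by (rule butlast_enc_nat_pos[OF False])
      moreover have "Suc (8 * ?m + 6 + (?v3 d * (8 * ?v3 d + 10) + 1)) \<le> ?m * (8 * ?m + 10) + 1"
      proof -
        \<comment> \<open>The crude bound \<open>m - 1\<close> for the rest leaves one summand
          \<open>8 * m + 10\<close> to pay for the current round.\<close>
        have "?m div 2 \<le> ?m - 1" using False by simp
        then have "(?m div 2) * (8 * (?m div 2) + 10) \<le> (?m - 1) * (8 * ?m + 10)"
          by (intro mult_mono) auto
        moreover have "?m * (8 * ?m + 10) = (?m - 1) * (8 * ?m + 10) + (8 * ?m + 10)"
          using False by (cases ?m) auto
        ultimately show ?thesis by simp
      qed
      ultimately show ?thesis by (elim runs_conv') auto
    qed
  qed
  show ?thesis unfolding emit_nat_def
    by (rule runs_conv'[OF runs_Seq[OF loop runs_Emit]]) (auto simp: enc_nat_butlast)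
qed

fun emits :: "bool list \<Rightarrow> com" where
  "emits [] = Skip"
| "emits (b # bs) = Emit b ;; emits bs"

lemma runs_emits: "runs x (emits bs) (h, w, v) (length bs + 1) (h, w @ bs, v)"
proof (induction bs arbitrary: w)
  case Nil
  then show ?case using runs_Skip[of x "(h, w, v)"] by simp
next
  case (Cons b bs)
  show ?case unfolding emits.simps
    by (rule runs_conv'[OF runs_Seq[OF runs_Emit Cons]]) auto
qed

section \<open>Printers built from bounded loops\<close>

datatype pr = Out "bool list" | OutNat nexp | Cat pr pr | For nat nexp pr | IfEq nexp nexp pr pr

fun out :: "bool list \<Rightarrow> (nat \<Rightarrow> nat) \<Rightarrow> pr \<Rightarrow> bool list" where
  "out x v (Out bs) = bs"
| "out x v (OutNat e) = enc_nat (nval x v e)"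
| "out x v (Cat P Q) = out x v P @ out x v Q"
| "out x v (For r e P) = concat (map (\<lambda>i. out x (v(r := i)) P) [0..<nval x v e])"
| "out x v (IfEq a b P Q) = (if nval x v a = nval x v b then out x v P else out x v Q)"

text \<open>\<open>A\<close> collects the variables of the enclosing loops. A loop must not reuse
  one of them, as it would change and finally clear its register.\<close>

fun wf_pr :: "nat \<Rightarrow> nat set \<Rightarrow> pr \<Rightarrow> bool" where
  "wf_pr D A (Out bs) \<longleftrightarrow> True"
| "wf_pr D A (OutNat e) \<longleftrightarrow> nvars e \<subseteq> {..<D}"
| "wf_pr D A (Cat P Q) \<longleftrightarrow> wf_pr D A P \<and> wf_pr D A Q"
| "wf_pr D A (For r e P) \<longleftrightarrow> nvars e \<subseteq> {..<D} \<and> r < D \<and> r \<notin> A \<and> wf_pr D (insert r A) P"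
| "wf_pr D A (IfEq a b P Q) \<longleftrightarrow>
     nvars a \<subseteq> {..<D} \<and> nvars b \<subseteq> {..<D} \<and> wf_pr D A P \<and> wf_pr D A Q"

text \<open>\<open>IfEq\<close> leaves the absolute difference of the two values in
  \<open>d + 2\<close>, the sum of both truncated differences. On equality all scratch registers are
  therefore empty already.\<close>

fun cpr :: "pr \<Rightarrow> nat \<Rightarrow> com" where
  "cpr (Out bs) d = emits bs"
| "cpr (OutNat e) d = cnexp e d ;; emit_nat d"
| "cpr (Cat P Q) d = cpr P d ;; cpr Q d"
| "cpr (For r e P) d = cnexp e d ;; While (NonZero d) (Dec d ;; cpr P (d + 1) ;; Inc r) ;; clear r"
| "cpr (IfEq a b P Q) d = cnexp a d ;; cnexp b (d + 1) ;;
     While (NonZero d) (Dec d ;; Cond (NonZero (d + 1)) (Dec (d + 1)) (Inc (d + 2))) ;;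
     move (d + 1) (d + 2) ;;
     Cond (NonZero (d + 2)) (clear (d + 2) ;; cpr Q d) (cpr P d)"

text \<open>All registers end as they began, which lets printers be concatenated and repeated.
  Variables outside \<open>A\<close> hold 0, the value with which their loop has to start.\<close>

definition pspec :: "pr \<Rightarrow> nat set \<Rightarrow> nat \<Rightarrow> nat poly \<Rightarrow> bool" where
  "pspec P A D p \<longleftrightarrow> (\<forall>x env B v w d. D \<le> d \<longrightarrow> (\<forall>r<D. v r = env r \<and> env r \<le> B) \<longrightarrow>
     (\<forall>r<D. r \<notin> A \<longrightarrow> env r = 0) \<longrightarrow> (\<forall>r\<ge>d. v r = 0) \<longrightarrow> length x \<le> B \<longrightarrow>
     runs x (cpr P d) (0, w, v) (poly p B) (0, w @ out x env P, v))"

lemma pspecD: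
  assumes "pspec P A D p" "D \<le> d" "\<And>r. r < D \<Longrightarrow> v r = env r \<and> env r \<le> B"
    "\<And>r. r < D \<Longrightarrow> r \<notin> A \<Longrightarrow> env r = 0" "\<And>r. r \<ge> d \<Longrightarrow> v r = 0" "length x \<le> B"
  shows "runs x (cpr P d) (0, w, v) (poly p B) (0, w @ out x env P, v)"
  using assms unfolding pspec_def by blast

lemma pspecI:
  assumes "\<And>x env B v w d. D \<le> d \<Longrightarrow> (\<And>r. r < D \<Longrightarrow> v r = env r \<and> env r \<le> B) \<Longrightarrow>
     (\<And>r. r < D \<Longrightarrow> r \<notin> A \<Longrightarrow> env r = 0) \<Longrightarrow>
     (\<And>r. r \<ge> d \<Longrightarrow> v r = 0) \<Longrightarrow> length x \<le> B \<Longrightarrow>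
     runs x (cpr P d) (0, w, v) (poly p B) (0, w @ out x env P, v)"
  shows "pspec P A D p"
  using assms unfolding pspec_def by blast

lemma pspec_Out: "pspec (Out bs) A D [:length bs + 1:]"
  using runs_emits by (intro pspecI) simp

lemma pspec_OutNat:
  assumes e: "nspec e D p"
  shows "pspec (OutNat e) A D (p + p * (8 * p + 10) + 2)"
proof (rule pspecI)
  fix x w :: "bool list" and B d :: nat and v env :: "nat \<Rightarrow> nat"
  assume D: "D \<le> d" and B: "\<And>r. r < D \<Longrightarrow> v r = env r \<and> env r \<le> B"
    and d: "\<And>r. r \<ge> d \<Longrightarrow> v r = 0" and x: "length x \<le> B"
  let ?m = "nval x env e"
  note e = nspecD[OF e, where d = d and v = v and env = env and x = x, OF D B d x]
  have m: "?m * (8 * ?m + 10) \<le> poly p B * (8 * poly p B + 10)" using e(1) by (intro mult_mono) auto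
  show "runs x (cpr (OutNat e) d) (0, w, v) (poly (p + p * (8 * p + 10) + 2) B)
     (0, w @ out x env (OutNat e), v)"
    unfolding cpr.simps
    by (rule runs_conv'[OF runs_Seq[OF e(2) runs_emit_nat]]) (use m d in \<open>auto simp: fun_eq_iff\<close>)
qed

lemma pspec_Cat:
  assumes P: "pspec P A D p" and Q: "pspec Q A D q"
  shows "pspec (Cat P Q) A D (p + q)"
proof (rule pspecI)
  fix x w :: "bool list" and B d :: nat and v env :: "nat \<Rightarrow> nat"
  assume prems: "D \<le> d" "\<And>r. r < D \<Longrightarrow> v r = env r \<and> env r \<le> B"
    "\<And>r. r < D \<Longrightarrow> r \<notin> A \<Longrightarrow> env r = 0" "\<And>r. r \<ge> d \<Longrightarrow> v r = 0" "length x \<le> B"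
  show "runs x (cpr (Cat P Q) d) (0, w, v) (poly (p + q) B) (0, w @ out x env (Cat P Q), v)"
    unfolding cpr.simps
    by (rule runs_conv'[OF runs_Seq[OF pspecD[OF P prems] pspecD[OF Q prems]]]) auto
qed

text \<open>Inside the body the loop variable can be as large as the value of \<open>e\<close>, so
  the bound of the body is taken at \<open>B + poly p B\<close>; hence the composition of
  polynomials.\<close>

lemma pspec_For:
  assumes e: "nspec e D p" and P: "pspec P (insert r A) D q" and r: "r < D" "r \<notin> A"
  shows "pspec (For r e P) A D (p + p * (pcompose q ([:0, 1:] + p) + 3) + 3 * p + 2)"
    (is "pspec _ A D ?T")
proof (rule pspecI)
  fix x w :: "bool list" and B d :: nat and v env :: "nat \<Rightarrow> nat"
  assume D: "D \<le> d" and B: "\<And>r. r < D \<Longrightarrow> v r = env r \<and> env r \<le> B"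
    and A: "\<And>r. r < D \<Longrightarrow> r \<notin> A \<Longrightarrow> env r = 0"
    and d: "\<And>r. r \<ge> d \<Longrightarrow> v r = 0" and x: "length x \<le> B"
  let ?n = "nval x env e"
  note e = nspecD[OF e, where d = d and v = v and env = env and x = x, OF D B d x]
  define q' where "q' = poly q (B + poly p B)"
  define W where "W i = w @ concat (map (\<lambda>i. out x (env(r := i)) P) [0..<i])" for i
  have "runs x (cpr P (d + 1) ;; Inc r) (0, W i, (v(r := i))(d := ?n - Suc i)) (q' + 1)
      (0, W (Suc i), (v(r := Suc i))(d := ?n - Suc i))" if "i < ?n" for i
  proof -
    have "runs x (cpr P (d + 1)) (0, W i, (v(r := i))(d := ?n - Suc i)) q'
        (0, W i @ out x (env(r := i)) P, (v(r := i))(d := ?n - Suc i))"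
      unfolding q'_def
    proof (rule pspecD[OF P])
      fix s assume "s < D"
      then show "((v(r := i))(d := ?n - Suc i)) s = (env(r := i)) s \<and> (env(r := i)) s \<le> B + poly p B"
        using B[of s] D that e(1) by (auto intro: trans_le_add1)
    qed (use A d D r x in auto)
    then show ?thesis
      by (rule runs_conv'[OF runs_Seq[OF _ runs_Inc]]) (use D r in \<open>auto simp: fun_eq_iff W_def\<close>)
  qed
  then have "runs x (While (NonZero d) (Dec d ;; cpr P (d + 1) ;; Inc r)) (0, W 0, (v(r := 0))(d := ?n))
      (?n * (q' + 1 + 2) + 1) (0, W ?n, (v(r := ?n))(d := 0))"
    by (rule runs_drain)
  moreover have v0: "v(r := 0) = v" using B[of r] A[of r] r by auto
  ultimately have loop: "runs x (While (NonZero d) (Dec d ;; cpr P (d + 1) ;; Inc r)) (0, w, v(d := ?n))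
      (?n * (q' + 3) + 1) (0, W ?n, v(r := ?n))"
    by (elim runs_conv) (use d D r in \<open>auto simp: W_def fun_upd_idem distrib_left\<close>)
  have "?n * (q' + 3) \<le> poly p B * (q' + 3)" using e(1) by (intro mult_mono) auto
  moreover have "poly ?T B = poly p B + poly p B * (q' + 3) + 3 * poly p B + 2"
    by (simp add: q'_def poly_pcompose)
  ultimately have T: "poly p B + (?n * (q' + 3) + 1 + (3 * ?n + 1)) \<le> poly ?T B"
    using e(1) by linarith
  show "runs x (cpr (For r e P) d) (0, w, v) (poly ?T B) (0, w @ out x env (For r e P), v)"
    unfolding cpr.simps
    by (rule runs_conv'[OF runs_Seq[OF e(2) runs_Seq[OF loop runs_clear]]])
      (use T v0 in \<open>simp_all add: W_def\<close>)
qed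

lemma pspec_IfEq:
  assumes a: "nspec a D pa" and b: "nspec b D pb" and P: "pspec P A D p" and Q: "pspec Q A D q"
  shows "pspec (IfEq a b P Q) A D (11 * pa + 7 * pb + p + q + 6)" (is "pspec _ A D ?T")
proof (rule pspecI)
  fix x w :: "bool list" and B d :: nat and v env :: "nat \<Rightarrow> nat"
  assume prems: "D \<le> d" "\<And>r. r < D \<Longrightarrow> v r = env r \<and> env r \<le> B"
    "\<And>r. r < D \<Longrightarrow> r \<notin> A \<Longrightarrow> env r = 0" "\<And>r. r \<ge> d \<Longrightarrow> v r = 0" "length x \<le> B"
  let ?m = "nval x env a" and ?n = "nval x env b"
  note a = nspecD[OF a, where d = d and v = v and env = env and x = x, OF prems(1,2,4,5)]
  define v' where "v' = v(d := ?m)"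
  have "D \<le> d + 1" "\<And>r. r < D \<Longrightarrow> v' r = env r \<and> env r \<le> B" "\<And>r. r \<ge> d + 1 \<Longrightarrow> v' r = 0"
    using prems by (auto simp: v'_def)
  note b = nspecD[OF b, where v = v' and env = env and d = "d + 1" and x = x, OF this prems(5)]
  define V where "V i = v(d + 1 := ?n - i, d + 2 := i - ?n)" for i
  have "runs x (Cond (NonZero (d + 1)) (Dec (d + 1)) (Inc (d + 2))) (0, w, (V i)(d := ?m - Suc i)) 2
      (0, w, (V (Suc i))(d := ?m - Suc i))" for i
  proof (cases "i < ?n")
    case True
    then show ?thesis
      by (intro runs_conv'[OF runs_CondT[OF _ runs_Dec]]) (auto simp: V_def fun_eq_iff)
  next
    case False
    then show ?thesis
      by (intro runs_conv'[OF runs_CondF[OF _ runs_Inc]]) (auto simp: V_def fun_eq_iff)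
  qed
  then have "runs x (While (NonZero d) (Dec d ;; Cond (NonZero (d + 1)) (Dec (d + 1)) (Inc (d + 2))))
      (0, w, (V 0)(d := ?m)) (?m * (2 + 2) + 1) (0, w, (V ?m)(d := 0))"
    by (rule runs_drain')
  then have loop: "runs x (While (NonZero d) (Dec d ;; Cond (NonZero (d + 1)) (Dec (d + 1)) (Inc (d + 2))))
      (0, w, v'(d + 1 := ?n)) (4 * ?m + 1) (0, w, V ?m)"
    by (rule runs_conv) (use prems(4) in \<open>auto simp: V_def v'_def fun_eq_iff\<close>)
  let ?k = "?m - ?n + (?n - ?m)"
  have move: "runs x (move (d + 1) (d + 2)) (0, w, V ?m) (3 * ?n + 1) (0, w, v(d + 2 := ?k))"
    by (rule runs_conv'[OF runs_move]) (use prems(4) in \<open>auto simp: V_def fun_eq_iff\<close>)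
  have "runs x (Cond (NonZero (d + 2)) (clear (d + 2) ;; cpr Q d) (cpr P d)) (0, w, v(d + 2 := ?k))
      (3 * ?k + poly p B + poly q B + 3) (0, w @ out x env (IfEq a b P Q), v)"
  proof (cases "?m = ?n")
    case True
    then show ?thesis
      by (intro runs_conv[OF runs_CondF[OF _ pspecD[OF P prems]]]) (use prems(4) in \<open>auto simp: fun_eq_iff\<close>)
  next
    case False
    have *: "runs x (clear (d + 2)) (0, w, v(d + 2 := ?k)) (3 * ?k + 1) (0, w, v)"
      by (rule runs_conv'[OF runs_clear]) (use prems(4) in \<open>auto simp: fun_eq_iff\<close>)
    show ?thesis
      by (rule runs_conv'[OF runs_CondT[OF _ runs_Seq[OF * pspecD[OF Q prems]]]]) (use False in auto)
  qed
  note runs_Seq[OF a(2)[folded v'_def] runs_Seq[OF b(2) runs_Seq[OF loop runs_Seq[OF move this]]]]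
  then show "runs x (cpr (IfEq a b P Q) d) (0, w, v) (poly ?T B) (0, w @ out x env (IfEq a b P Q), v)"
    unfolding cpr.simps by (rule runs_mono) (use a(1) b(1) in auto)
qed

lemma pspec_exists: "wf_pr D A P \<Longrightarrow> \<exists>p. pspec P A D p"
proof (induction P arbitrary: A)
  case (Out bs)
  show ?case using pspec_Out by blast
next
  case (OutNat e)
  then show ?case using nspec_exists pspec_OutNat by (metis wf_pr.simps(2))
next
  case (Cat P Q)
  then show ?case using pspec_Cat by (metis wf_pr.simps(3))
next
  case (For r e P)
  then show ?case using nspec_exists pspec_For by (metis wf_pr.simps(4))
next
  case (IfEq a b P Q)
  then show ?case using nspec_exists pspec_IfEq by (metis wf_pr.simps(5))
qed

text \<open>State 0 writes the marker into cell 0 of every register tape. An oracle call puts the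
  head of tape 1 back to cell 0, so the last state sees the first bit of the answer.\<close>

definition printer :: "com \<Rightarrow> machine" where
  "printer c = \<lparr>num_tapes = regs c + 2, num_symbols = 3,
     program = (\<lambda>rs. Step 1 ((rs ! 0, Stay) # (rs ! 1, Stay) # replicate (regs c) (1, Stay)))
       # assemble c 1 (csize c + 1)
       @ [\<lambda>rs. Query (csize c + 2), \<lambda>rs. Halt (rs ! 1 = 2)]\<rparr>"

lemma nth_less: "set rs \<subseteq> {..<3} \<Longrightarrow> i < length rs \<Longrightarrow> rs ! i < (3::nat)"
  using nth_mem by blast

lemma assemble_Step:
  assumes "p \<in> set (assemble c a k)" "regs c + 2 \<le> length rs" "set rs \<subseteq> {..<3}" "k < L" "a + csize c \<le> L"
  shows "\<exists>q as. p rs = Step q as \<and> q < L \<and> length as = length rs \<and> fst ` set as \<subseteq> {..<3}"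
  using assms
proof (induction c arbitrary: a k)
  case (Seq c1 c2)
  have "a + csize c1 < L" using Seq.prems csize_pos[of c2] by (simp del: csize_pos)
  then show ?case using Seq.prems Seq.IH(1)[of a "a + csize c1"] Seq.IH(2)[of "a + csize c1" k]
    by auto
next
  case (Cond b c1 c2)
  have *: "Suc a < L" "Suc a + csize c1 < L" 
    using Cond.prems csize_pos[of c2] csize_pos[of c1] by (simp_all del: csize_pos)
  moreover have "s < 3" if "s \<in> set rs" for s using Cond.prems that by blast
  ultimately show ?case using Cond.prems Cond.IH(1)[of "Suc a" k] Cond.IH(2)[of "Suc a + csize c1" k]
    by (auto simp: keep_def)
next
  case (While b c)
  have *: "Suc a < L" using While.prems csize_pos[of c] by (simp_all del: csize_pos)
  moreover have "s < 3" if "s \<in> set rs" for s using While.prems that by blast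
  ultimately show ?case using While.prems While.IH[of "Suc a" a]
    by (auto simp: keep_def)
qed (auto simp: keep_def dest!: set_update_subset_insert[THEN subsetD] intro!: nth_less)

lemma turing_machine_printer: "turing_machine (printer c)"
  unfolding turing_machine_def
proof (intro conjI ballI)
  fix p rs assume p: "p \<in> set (program (printer c))" and rs: "rs \<in> read_lists (printer c)"
  have len: "length (program (printer c)) = csize c + 3" by (simp add: printer_def)
  have rs: "length rs = regs c + 2" "set rs \<subseteq> {..<3}" using rs by (auto simp: read_lists_def printer_def)
  then have "rs ! 0 < 3" "rs ! 1 < 3" by (simp_all add: nth_less)
  moreover have "action_ok (printer c) (p rs)" if "p \<in> set (assemble c 1 (csize c + 1))"
    using assemble_Step[OF that, of rs "csize c + 3"] rs len by (auto simp: printer_def)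
  ultimately show "action_ok (printer c) (p rs)" using p len by (auto simp: printer_def)
qed (auto simp: printer_def)

lemma word_of_append: "word_of (fst (tape_of w), h) = w"
proof -
  have "(LEAST n. fst (tape_of w) (int n) \<notin> {1, 2}) = length w"
    by (rule Least_equality) (auto simp: tape_of_def split: if_splits)
  then show ?thesis by (auto simp: word_of_def tape_of_def intro!: nth_equalityI)
qed

text \<open>The two extra steps are the writing of the markers and the query.\<close>

lemma printer_halts:
  assumes "exec x c (0, [], \<lambda>_. 0) t (0, w, v)"
  shows "halts_within orc (printer c) x [] (t + 2) (orc w \<noteq> [] \<and> hd (orc w))"
proof -
  let ?M = "printer c" and ?R = "regs c"
  have read: "map (\<lambda>(f, h). f h) ts = reads ts" for ts by (simp add: reads_def)
  have init: "step orc ?M (initial ?M x []) = (1, tapes x ?R (0, [], \<lambda>_. 0))"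
  proof -
    obtain f where x: "tape_of x = (f, 0)" by (simp add: tape_of_def)
    have blank: "tape_of [] = (\<lambda>_. 0, 0)" by (simp add: tape_of_def fun_eq_iff)
    have "step orc ?M (initial ?M x []) = (1, map2 write_move
       ((f 0, Stay) # (0, Stay) # replicate ?R (1, Stay)) (snd (initial ?M x [])))"
      by (simp add: initial_def step_def current_action_def printer_def x blank)
    also have "\<dots> = (1, tapes x ?R (0, [], \<lambda>_. 0))"
      by (auto simp: initial_def printer_def tapes_def x blank write_move_def counter_def
          fun_eq_iff intro!: nth_equalityI)
    finally show ?thesis .
  qed
  have located: "located ?M 1 (assemble c 1 (csize c + 1))"
    by (auto simp: located_def printer_def nth_append)
  have run: "(step orc ?M ^^ t) (1, tapes x ?R (0, [], \<lambda>_. 0)) = (csize c + 1, tapes x ?R (0, w, v))"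
    by (rule comp_correct[OF assms _ located]) simp
  have query: "step orc ?M (csize c + 1, tapes x ?R (0, w, v)) =
      (csize c + 2, (tapes x ?R (0, w, v))[1 := tape_of (orc w)])"
    by (simp add: step_def current_action_def printer_def nth_append nth_tapes word_of_append)
  have "(step orc ?M ^^ (t + 2)) (initial ?M x []) = (csize c + 2, (tapes x ?R (0, w, v))[1 := tape_of (orc w)])"
    using init run query by (simp add: funpow_swap1)
  moreover have "current_action ?M (csize c + 2, (tapes x ?R (0, w, v))[1 := tape_of (orc w)]) =
      Halt (orc w \<noteq> [] \<and> hd (orc w))"
    by (auto simp: current_action_def printer_def nth_append tape_of_def hd_conv_nth)
  ultimately show ?thesis unfolding halts_within_def by (intro exI[of _ "t + 2"]) simp
qed

text \<open>\<open>P\<close> is one program for all inputs and starts with all variables 0, so a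
  single polynomial in \<open>length x\<close> bounds its running time.\<close>

theorem turing_reducible_by_printer:
  assumes wf: "wf_pr D {} P"
    and out: "\<And>x. out x (\<lambda>_. 0) P = encode_instance Pb (I x)"
    and inst: "\<And>x. I x \<in> instances Pb"
    and corr: "\<And>x. x \<in> L \<longleftrightarrow> solutions Pb (I x) \<noteq> {}"
  shows "turing_reducible L Pb"
proof -
  obtain p where p: "pspec P {} D p" using pspec_exists[OF wf] by blast
  let ?c = "cpr P D"
  have "halts_within orc (printer ?c) x [] (poly (p + 2) (length x)) (x \<in> L)" if orc: "solver Pb orc" for orc x
  proof -
    let ?w = "out x (\<lambda>_. 0) P"
    have "runs x ?c (0, [], \<lambda>_. 0) (poly p (length x)) (0, [] @ ?w, \<lambda>_. 0)"
      by (rule pspecD[OF p]) auto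
    then obtain t where t: "t \<le> poly p (length x)" "exec x ?c (0, [], \<lambda>_. 0) t (0, ?w, \<lambda>_. 0)"
      by (auto simp: runs_def)
    have "(orc ?w \<noteq> [] \<and> hd (orc ?w)) = (x \<in> L)"
      using orc inst[of x] unfolding solver_def out corr by (auto simp: optimal_def)
    with printer_halts[OF t(2), of orc] obtain n where "n \<le> t + 2"
       "current_action (printer ?c) ((step orc (printer ?c) ^^ n) (initial (printer ?c) x [])) = Halt (x \<in> L)"
      by (auto simp: halts_within_def)
    then show ?thesis using t(1) unfolding halts_within_def by (intro exI[of _ n]) auto
  qed
  then show ?thesis unfolding turing_reducible_def using turing_machine_printer by blast
qed

section \<open>Partition as a scheduling problem\<close>

text \<open>The only trip arrives at time 0 and the time window is as long as the horizon, so every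
  departure in the horizon meets conditions (2) and (3). What constrains a schedule is that each
  passenger needs a separate round trip and that two vehicles must share these.\<close>

definition partition_instance :: "nat list \<Rightarrow> nat \<Rightarrow> ilmtp" where
  "partition_instance as T =
     \<lparr>num_stations = 1, num_trips = 1, trip_dep = (\<lambda>_ _. 0), trip_arr = (\<lambda>_. 0),
      num_dests = length as, tau1 = (\<lambda>_. 0), tau2 = (\<lambda>d. int (2 * as ! d)), tau3 = (\<lambda>_. 0),
      t_max = int (2 * T + 1), num_cvs = 2, v_cap = 1, num_passengers = length as,
      origin = (\<lambda>_. 0), dest = (\<lambda>j. j), t_req = (\<lambda>_. 0), t_win = int (2 * T + 1), weight = 0\<rparr>"

lemma partition_instance_simps [simp]:
  "num_stations (partition_instance as T) = 1" "num_trips (partition_instance as T) = 1"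
  "trip_dep (partition_instance as T) c s = 0" "trip_arr (partition_instance as T) c = 0"
  "num_dests (partition_instance as T) = length as" "tau1 (partition_instance as T) d = 0"
  "tau2 (partition_instance as T) d = int (2 * as ! d)" "tau3 (partition_instance as T) d = 0"
  "t_max (partition_instance as T) = int (2 * T + 1)" "num_cvs (partition_instance as T) = 2"
  "v_cap (partition_instance as T) = 1" "num_passengers (partition_instance as T) = length as"
  "origin (partition_instance as T) j = 0" "dest (partition_instance as T) j = j"
  "t_req (partition_instance as T) j = 0" "t_win (partition_instance as T) = int (2 * T + 1)"
  "weight (partition_instance as T) = 0" "tau (partition_instance as T) d = int (2 * as ! d)"
  "group_dest (partition_instance as T) {j} = j"
  by (simp_all add: partition_instance_def tau_def group_dest_def)

lemma ilmtp_instance_partition: "as \<noteq> [] \<Longrightarrow> ilmtp_instance (partition_instance as T)"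
  by (simp add: ilmtp_instance_def)

text \<open>Greedy colouring of an interval graph of clique number at most 2: intervals are added in
  the order of their starting points, so a new one can only clash with earlier ones that contain its
  starting point.\<close>

lemma two_colouring:
  fixes s d :: "'a \<Rightarrow> int"
  assumes "finite J" "\<And>t. card {l \<in> J. s l \<le> t \<and> t < s l + d l} \<le> 2"
  shows "\<exists>A\<subseteq>J. disjoint_family_on (\<lambda>l. {s l..<s l + d l}) A \<and>
     disjoint_family_on (\<lambda>l. {s l..<s l + d l}) (J - A)"
  using assms
proof (induction J rule: finite_ranking_induct[where f = s])
  case empty
  then show ?case by (auto simp: disjoint_family_on_def)
next
  case (insert j J)
  let ?I = "\<lambda>l. {s l..<s l + d l}"
  have "card {l \<in> J. s l \<le> t \<and> t < s l + d l} \<le> 2" for t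
    by (rule order.trans[OF card_mono insert.prems[of t]]) (use insert.hyps in auto)
  then obtain A where A: "A \<subseteq> J" "disjoint_family_on ?I A" "disjoint_family_on ?I (J - A)"
    using insert.IH by blast
  have add: "disjoint_family_on ?I (insert j X)"
    if "X \<subseteq> J" "disjoint_family_on ?I X" "\<And>i. i \<in> X \<Longrightarrow> s j \<notin> ?I i" for X
  proof -
    \<comment> \<open>As \<open>s i \<le> s j\<close>, two intervals that meet both contain
      \<open>s j\<close>.\<close>
    have "?I j \<inter> ?I i = {}" if "i \<in> X" for i
      using insert.hyps(2)[of i] \<open>X \<subseteq> J\<close> that \<open>\<And>i. i \<in> X \<Longrightarrow> s j \<notin> ?I i\<close>[of i] by force
    then show ?thesis using that(2) unfolding disjoint_family_on_def by blast
  qed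
  show ?case
  proof (cases "j \<in> J")
    case True
    then show ?thesis using A by (auto simp: insert_absorb)
  next
    case j: False
    show ?thesis
    proof (cases "\<exists>i\<in>A. s j \<in> ?I i")
      case False
      moreover have "insert j J - insert j A = J - A" using j A(1) by auto
      ultimately show ?thesis using A add[of A] by (intro exI[of _ "insert j A"]) auto
    next
      case True
      then obtain i where i: "i \<in> A" "s j \<in> ?I i" by blast
      \<comment> \<open>A third interval through \<open>s j\<close>, besides those of
        \<open>i\<close> and \<open>j\<close>, would exceed the bound 2; \<open>0 < d j\<close> puts
        \<open>s j\<close> into the interval of \<open>j\<close>.\<close>
      have free: "s j \<notin> ?I i'" if "i' \<in> J - A" "0 < d j" for i'
      proof
        assume "s j \<in> ?I i'"
        then have "{i, i', j} \<subseteq> {l \<in> insert j J. s l \<le> s j \<and> s j < s l + d l}"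
          using i A(1) that by auto
        then have "card {i, i', j} \<le> 2"
          using insert.hyps(1) by (intro order.trans[OF card_mono insert.prems[of "s j"]]) simp_all
        moreover have "i \<noteq> i'" "i \<noteq> j" "i' \<noteq> j" using i A(1) that j by auto
        ultimately show False by simp
      qed
      have *: "disjoint_family_on ?I (insert j (J - A))"
      proof (cases "0 < d j")
        case True
        show ?thesis by (rule add) (use A(3) free True in auto)
      next
        case False
        then have "?I j = {}" by simp
        then show ?thesis using A(3) unfolding disjoint_family_on_def by blast
      qed
      have "insert j J - A = insert j (J - A)" using j A(1) by auto
      then show ?thesis using A * by (intro exI[of _ A]) auto
    qed
  qed
qed

text \<open>The total length is the number of integer points covered, and these all lie in
  \<open>{a..<b}\<close>.\<close>

lemma sum_disjoint_intervals:
  fixes s d :: "'a \<Rightarrow> int"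
  assumes "finite A" "disjoint_family_on (\<lambda>l. {s l..<s l + d l}) A"
    and "\<And>l. l \<in> A \<Longrightarrow> 0 \<le> d l \<and> a \<le> s l \<and> s l + d l \<le> b" "a \<le> b"
  shows "(\<Sum>l\<in>A. d l) \<le> b - a"
proof -
  have "card (\<Union>l\<in>A. {s l..<s l + d l}) = (\<Sum>l\<in>A. card {s l..<s l + d l})"
    using assms(1,2) by (intro card_UN_disjoint) (auto simp: disjoint_family_on_def)
  moreover have "(\<Union>l\<in>A. {s l..<s l + d l}) \<subseteq> {a..<b}" using assms(3) by fastforce
  then have "card (\<Union>l\<in>A. {s l..<s l + d l}) \<le> card {a..<b}" by (intro card_mono) auto
  ultimately have "(\<Sum>l\<in>A. nat (d l)) \<le> nat (b - a)" by simp
  then have "int (\<Sum>l\<in>A. nat (d l)) \<le> b - a" using assms(4) by linarith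
  moreover have "int (\<Sum>l\<in>A. nat (d l)) = (\<Sum>l\<in>A. d l)" using assms(3) by simp
  ultimately show ?thesis by simp
qed

text \<open>Capacity one makes every group a singleton. A two-colouring of the trips assigns them to
  the vehicles; each class fits into a time span of length \<open>2 * T\<close>, so its items sum to
  at most \<open>T\<close>, and the total \<open>2 * T\<close> forces equality.\<close>

lemma feasible_imp_partition:
  assumes feas: "feasible (partition_instance as T) gs" and total: "sum_list as = 2 * T"
  shows "\<exists>A\<subseteq>{..<length as}. (\<Sum>i\<in>A. as ! i) = T"
proof -
  let ?I = "partition_instance as T" and ?n = "length gs"
  have dist: "distinct (map fst gs)" and part: "partition_on {..<length as} (set (map fst gs))"
    using feas by (auto simp: feasible_def)
  have grp: "1 \<le> t \<and> card g \<le> 1 \<and> t + tau ?I (group_dest ?I g) \<le> t_max ?I" if "(g, t) \<in> set gs" for g t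
    using feas that unfolding feasible_def by auto
  have act_le: "card {l. l < length gs \<and> snd (gs ! l) \<le> t \<and>
      t < snd (gs ! l) + tau ?I (group_dest ?I (fst (gs ! l)))} \<le> card (CVs ?I)" if "t \<in> Horizon ?I" for t
    using feas that unfolding feasible_def by blast
  have single: "\<exists>p. fst (gs ! l) = {p}" if "l < ?n" for l
  proof -
    have "gs ! l \<in> set gs" using that by simp
    then have card: "card (fst (gs ! l)) \<le> 1" using grp[of "fst (gs ! l)" "snd (gs ! l)"] by simp
    have g: "fst (gs ! l) \<in> set (map fst gs)" using that by auto
    moreover have "{} \<notin> set (map fst gs)" "\<Union> (set (map fst gs)) = {..<length as}"
      using part unfolding partition_on_def by blast+
    ultimately have "fst (gs ! l) \<noteq> {}" "fst (gs ! l) \<subseteq> {..<length as}"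
      by (metis, metis Union_upper)
    then have "fst (gs ! l) \<noteq> {}" "finite (fst (gs ! l))" by (auto intro: finite_subset)
    then have "card (fst (gs ! l)) = 1" using card by (simp add: card_gt_0_iff le_Suc_eq)
    then show ?thesis by (auto simp: card_1_singleton_iff)
  qed
  then obtain p where p: "\<And>l. l < ?n \<Longrightarrow> fst (gs ! l) = {p l}" by metis
  have sets: "set (map fst gs) = (\<lambda>l. {p l}) ` {..<?n}"
  proof -
    have "set (map fst gs) = (\<lambda>l. fst (gs ! l)) ` {..<?n}" by (force simp: set_conv_nth)
    then show ?thesis using p by simp
  qed
  have inj: "inj_on p {..<?n}"
  proof (rule inj_onI)
    fix l l' assume "l \<in> {..<?n}" "l' \<in> {..<?n}" "p l = p l'"
    then show "l = l'" using dist p[of l] p[of l'] nth_eq_iff_index_eq[OF dist, of l l'] by simp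
  qed
  have img: "p ` {..<?n} = {..<length as}"
    using part sets by (auto simp: partition_on_def)
  define s where "s l = snd (gs ! l)" for l
  define d where "d l = int (2 * as ! p l)" for l
  have sl: "1 \<le> s l" "s l + d l \<le> int (2 * T + 1)" if "l < ?n" for l
  proof -
    have mem: "gs ! l \<in> set gs" using that by simp
    moreover have "gs ! l = ({p l}, s l)" using p[OF that] by (simp add: s_def prod_eq_iff)
    ultimately have "({p l}, s l) \<in> set gs" by simp
    then show "1 \<le> s l" "s l + d l \<le> int (2 * T + 1)" using grp[of "{p l}" "s l"] by (simp_all add: d_def)
  qed
  have act: "{l. l < ?n \<and> snd (gs ! l) \<le> t \<and> t < snd (gs ! l) + tau ?I (group_dest ?I (fst (gs ! l)))} =
      {l \<in> {..<?n}. s l \<le> t \<and> t < s l + d l}" for t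
    using p by (auto simp: s_def d_def)
  \<comment> \<open>Feasibility bounds the active trips only within the horizon, but
    \<open>two_colouring\<close> asks for every integer time; outside the horizon no trip is
    active.\<close>
  have "card {l \<in> {..<?n}. s l \<le> t \<and> t < s l + d l} \<le> 2" for t
  proof (cases "1 \<le> t \<and> t \<le> int (2 * T + 1)")
    case True
    then show ?thesis using act_le[of t] unfolding act by simp
  next
    case False
    then have empty: "{l \<in> {..<?n}. s l \<le> t \<and> t < s l + d l} = {}" using sl by force
    show ?thesis unfolding empty by simp
  qed
  then obtain A where A: "A \<subseteq> {..<?n}" "disjoint_family_on (\<lambda>l. {s l..<s l + d l}) A"
     "disjoint_family_on (\<lambda>l. {s l..<s l + d l}) ({..<?n} - A)"
    using two_colouring[of "{..<?n}" s d] by auto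
  have half: "(\<Sum>l\<in>X. as ! p l) \<le> T"
    if "X \<subseteq> {..<?n}" "disjoint_family_on (\<lambda>l. {s l..<s l + d l}) X" for X
  proof -
    have "(\<Sum>l\<in>X. d l) \<le> int (2 * T + 1) - 1"
      using that sl by (intro sum_disjoint_intervals[where s = s]) (auto simp: d_def intro: finite_subset)
    also have "(\<Sum>l\<in>X. d l) = int (2 * (\<Sum>l\<in>X. as ! p l))" by (simp add: d_def sum_distrib_left)
    finally show ?thesis by linarith
  qed
  have "(\<Sum>l\<in>A. as ! p l) + (\<Sum>l\<in>{..<?n} - A. as ! p l) = (\<Sum>l<?n. as ! p l)"
    using A(1) by (metis add.commute finite_lessThan sum.subset_diff)
  also have "\<dots> = (\<Sum>i\<in>p ` {..<?n}. as ! i)" by (simp add: sum.reindex[OF inj])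
  also have "\<dots> = 2 * T" using img total by (simp add: sum_list_sum_nth atLeast0LessThan)
  finally have "(\<Sum>l\<in>A. as ! p l) = T" using half[OF A(1,2)] half[OF _ A(3)] by simp
  moreover have "(\<Sum>l\<in>A. as ! p l) = (\<Sum>i\<in>p ` A. as ! i)"
    using inj_on_subset[OF inj A(1)] by (simp add: sum.reindex)
  moreover have "p ` A \<subseteq> {..<length as}" using img A(1) by auto
  ultimately show ?thesis by auto
qed

text \<open>Each vehicle serves one side of the partition, running its trips back to back in the
  order of the indices: \<open>st j\<close> sums the earlier items on the side of \<open>j\<close>.
  Hence at most one trip per side is active at any time.\<close>

lemma partition_imp_feasible:
  assumes A: "A \<subseteq> {..<length as}" "(\<Sum>i\<in>A. as ! i) = T" and total: "sum_list as = 2 * T"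
  shows "\<exists>gs. feasible (partition_instance as T) gs"
proof -
  let ?I = "partition_instance as T" and ?n = "length as"
  define C where "C j = (if j \<in> A then A else {..<?n} - A)" for j
  have finC: "finite (C j)" for j using A(1) by (auto simp: C_def intro: finite_subset)
  have "(\<Sum>i<?n. as ! i) = 2 * T" using total by (simp add: sum_list_sum_nth atLeast0LessThan)
  moreover have "(\<Sum>i<?n. as ! i) = (\<Sum>i\<in>{..<?n} - A. as ! i) + (\<Sum>i\<in>A. as ! i)"
    using A(1) by (intro sum.subset_diff) auto
  ultimately have sumC: "(\<Sum>i\<in>C j. as ! i) = T" for j using A(2) by (simp add: C_def)
  define st where "st j = (\<Sum>i\<in>{i \<in> C j. i < j}. as ! i)" for j
  have st_less: "st i + as ! i \<le> st j" if "i < j" "C i = C j" "i \<in> C i" for i j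
  proof -
    have "st i + as ! i = (\<Sum>k\<in>insert i {k \<in> C i. k < i}. as ! k)"
      using finC[of i] by (simp add: st_def)
    also have "\<dots> \<le> st j" unfolding st_def
      using that finC[of j] by (intro sum_mono2) auto
    finally show ?thesis .
  qed
  have st_le: "st j + as ! j \<le> T" if "j < ?n" for j
  proof -
    have "st j + as ! j = (\<Sum>k\<in>insert j {k \<in> C j. k < j}. as ! k)"
      using finC[of j] by (simp add: st_def)
    also have "\<dots> \<le> (\<Sum>i\<in>C j. as ! i)"
      using that finC[of j] by (intro sum_mono2) (auto simp: C_def)
    finally show ?thesis by (simp add: sumC)
  qed
  \<comment> \<open>The summand 1 is the first instant of the horizon; by \<open>st_le\<close> every
    trip is back no later than \<open>2 * T + 1\<close>.\<close>
  define f where "f j = ({j}, int (1 + 2 * st j))" for j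
  define gs where "gs = map f [0..<?n]"
  have fst_gs: "map fst gs = map (\<lambda>j. {j}) [0..<?n]" by (simp add: gs_def f_def)
  have act: "card {l. l < length gs \<and> snd (gs ! l) \<le> t \<and>
      t < snd (gs ! l) + tau ?I (group_dest ?I (fst (gs ! l)))} \<le> 2" for t
  proof -
    define S where "S = {l. l < ?n \<and> int (1 + 2 * st l) \<le> t \<and> t < int (1 + 2 * st l) + int (2 * as ! l)}"
    have eq: "{l. l < length gs \<and> snd (gs ! l) \<le> t \<and>
      t < snd (gs ! l) + tau ?I (group_dest ?I (fst (gs ! l)))} = S"
      by (auto simp: gs_def f_def S_def)
    have "\<not> (i < j \<and> i \<in> S \<and> j \<in> S \<and> C i = C j)" for i j
      using st_less[of i j] by (auto simp: S_def C_def)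
    then have uniq: "i = j" if "i \<in> S" "j \<in> S" "C i = C j" for i j
      using that by (metis nat_neq_iff)
    have [simp]: "finite S" by (simp add: S_def)
    have "card (S \<inter> A) \<le> Suc 0" "card (S - A) \<le> Suc 0"
      by (auto simp: card_le_Suc0_iff_eq intro!: uniq) (auto simp: C_def)
    moreover have "card S = card (S \<inter> A) + card (S - A)" by (metis \<open>finite S\<close> card_Int_Diff)
    ultimately show ?thesis unfolding eq by simp
  qed
  have "feasible ?I gs"
    unfolding feasible_def
  proof (intro conjI)
    show "distinct (map fst gs)" by (simp add: fst_gs distinct_map)
    show "partition_on (Passengers ?I) (set (map fst gs))"
      unfolding fst_gs by (auto simp: partition_on_def disjoint_def)
    have "(case x of (g, t) \<Rightarrow>
        t \<in> Horizon ?I \<and>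
        (\<forall>i\<in>g. \<forall>j\<in>g. dest ?I i = dest ?I j) \<and> card g \<le> v_cap ?I \<and>
        (\<forall>j\<in>g. t_req ?I j - t_win ?I \<le> t + tau1 ?I (group_dest ?I g) \<and>
               t + tau1 ?I (group_dest ?I g) \<le> t_req ?I j + t_win ?I) \<and>
        (\<exists>c\<in>Trips ?I. trip_arr ?I c \<le> t) \<and>
        t + tau ?I (group_dest ?I g) \<le> t_max ?I)" if "x \<in> set gs" for x
    proof -
      have "x \<in> f ` {..<?n}" using that by (simp add: gs_def atLeast0LessThan)
      then obtain j where j: "j < ?n" "x = f j" by blast
      show ?thesis using st_le[OF j(1)] by (simp add: j(2) f_def)
    qed
    then show "\<forall>(g, t)\<in>set gs. t \<in> Horizon ?I \<and>
        (\<forall>i\<in>g. \<forall>j\<in>g. dest ?I i = dest ?I j) \<and> card g \<le> v_cap ?I \<and>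
        (\<forall>j\<in>g. t_req ?I j - t_win ?I \<le> t + tau1 ?I (group_dest ?I g) \<and>
               t + tau1 ?I (group_dest ?I g) \<le> t_req ?I j + t_win ?I) \<and>
        (\<exists>c\<in>Trips ?I. trip_arr ?I c \<le> t) \<and>
        t + tau ?I (group_dest ?I g) \<le> t_max ?I" by blast
    show "\<forall>t\<in>Horizon ?I. card {l. l < length gs \<and> snd (gs ! l) \<le> t \<and>
        t < snd (gs ! l) + tau ?I (group_dest ?I (fst (gs ! l)))} \<le> card (CVs ?I)"
      using act by simp
  qed
  then show ?thesis by blast
qed

section \<open>Not-all-equal satisfiability as a partition problem\<close>

datatype item = Lit nat bool | Slack nat nat

definition nae_sat :: "(bool \<times> nat) list list \<Rightarrow> bool" where
  "nae_sat cls \<longleftrightarrow> (\<exists>\<phi>. \<forall>cl\<in>set cls.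
     (\<exists>(b, u)\<in>set cl. \<phi> u = b) \<and> (\<exists>(b, u)\<in>set cl. \<phi> u \<noteq> b))"

text \<open>Column \<open>c < length cls\<close> belongs to clause \<open>c\<close> and column \<open>length cls + u\<close> to variable \<open>u\<close>. The
  two sides of a partition are the true and the false literals; the slack items fill up the
  clause columns, which succeeds iff neither side has all literals of the clause.\<close>

fun digit :: "(bool \<times> nat) list list \<Rightarrow> item \<Rightarrow> nat \<Rightarrow> nat" where
  "digit cls (Lit u b) c =
     (if c < length cls then count_list (cls ! c) (b, u) else of_bool (c = length cls + u))"
| "digit cls (Slack c' l) c = of_bool (c = c')"

text \<open>Each side has to reach \<open>m - 1\<close> in a clause column. With \<open>k\<close>
  true literals, where \<open>1 \<le> k \<le> m - 1\<close>, the missing amount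
  \<open>m - 1 - k\<close> lies between 0 and \<open>m - 2\<close>, so \<open>m - 2\<close> slacks
  suffice, and they are too few to replace all literals.\<close>

definition items :: "(bool \<times> nat) list list \<Rightarrow> nat \<Rightarrow> nat \<Rightarrow> item list" where
  "items cls n m = concat (map (\<lambda>u. [Lit u True, Lit u False]) [0..<n]) @
     concat (map (\<lambda>c. map (Slack c) [0..<m - 2]) [0..<length cls])"

section \<open>Positional numerals and column sums\<close>

definition numeral_of :: "nat \<Rightarrow> nat \<Rightarrow> (nat \<Rightarrow> nat) \<Rightarrow> nat" where
  "numeral_of B k f = (\<Sum>c<k. f c * B ^ c)"

text \<open>Uniqueness of the base \<open>B\<close> expansion: the lowest digit is the remainder
  modulo \<open>B\<close>, and the rest follows by induction.\<close>

lemma numeral_of_inject: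
  assumes "numeral_of B k f = numeral_of B k g" "\<And>c. c < k \<Longrightarrow> f c < B" "\<And>c. c < k \<Longrightarrow> g c < B" "c < k"
  shows "f c = g c"
  using assms
proof (induction k arbitrary: f g c)
  case (Suc k)
  have shift: "numeral_of B (Suc k) h = h 0 + B * numeral_of B k (h \<circ> Suc)" for h
    by (simp add: numeral_of_def sum.lessThan_Suc_shift sum_distrib_left algebra_simps del: sum.lessThan_Suc)
  have B: "f 0 < B" "g 0 < B" using Suc.prems by auto
  have eq: "f 0 + B * numeral_of B k (f \<circ> Suc) = g 0 + B * numeral_of B k (g \<circ> Suc)"
    using Suc.prems(1) by (simp add: shift)
  have 0: "f 0 = g 0" using arg_cong[OF eq, of "\<lambda>n. n mod B"] B by simp
  with eq B have rest: "numeral_of B k (f \<circ> Suc) = numeral_of B k (g \<circ> Suc)" by simp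
  show ?case
  proof (cases c)
    case (Suc c')
    then show ?thesis using Suc.IH[OF rest, of c'] Suc.prems by simp
  qed (use 0 in simp)
qed simp

lemma sum_numeral_of:
  "(\<Sum>x\<in>S. numeral_of B k (f x)) = numeral_of B k (\<lambda>c. \<Sum>x\<in>S. f x c)"
  unfolding numeral_of_def by (subst sum.swap) (simp add: sum_distrib_right)

text \<open>Padding repeats a literal within a clause, so occurrences have to be counted with
  multiplicity.\<close>

lemma sum_count_list:
  "finite X \<Longrightarrow> set xs \<subseteq> X \<Longrightarrow> (\<Sum>x\<in>X. of_bool (P x) * count_list xs x) = length (filter P xs)"
proof (induction xs)
  case (Cons a xs)
  have "(\<Sum>x\<in>X. of_bool (P x) * count_list (a # xs) x) =
     (\<Sum>x\<in>X. of_bool (P x) * count_list xs x + of_bool (x = a \<and> P x))"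
    by (intro sum.cong) auto
  also have "\<dots> = (\<Sum>x\<in>X. of_bool (P x) * count_list xs x) + (\<Sum>x\<in>X. if x = a then of_bool (P a) else 0)"
    by (subst sum.distrib, intro arg_cong2[where f = "(+)"] sum.cong) auto
  also have "(\<Sum>x\<in>X. if x = a then of_bool (P a) else 0) = (of_bool (P a) :: nat)"
    using Cons.prems by simp
  finally show ?case using Cons by simp
qed simp

text \<open>The base is a power of two to make digits into blocks of bits, and it exceeds
  \<open>2 * m\<close>, which no column total surpasses, so that additions never carry.\<close>

definition item_number :: "(bool \<times> nat) list list \<Rightarrow> nat \<Rightarrow> nat \<Rightarrow> item \<Rightarrow> nat" where
  "item_number cls n m x = numeral_of (2 ^ Suc m) (length cls + n) (digit cls x)"

text \<open>Half of each column total: a clause column holds \<open>m\<close> literal occurrences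
  and \<open>m - 2\<close> slacks, a variable column holds two literals.\<close>

definition target :: "(bool \<times> nat) list list \<Rightarrow> nat \<Rightarrow> nat \<Rightarrow> nat" where
  "target cls n m =
     numeral_of (2 ^ Suc m) (length cls + n) (\<lambda>c. if c < length cls then m - 1 else 1)"

context
  fixes cls :: "(bool \<times> nat) list list" and n m :: nat
  assumes m: "2 \<le> m" and len: "\<And>cl. cl \<in> set cls \<Longrightarrow> length cl = m"
    and vars: "\<And>cl b u. cl \<in> set cls \<Longrightarrow> (b, u) \<in> set cl \<Longrightarrow> u < n"
begin

lemma set_items: "set (items cls n m) =
    (\<lambda>(b, u). Lit u b) ` (UNIV \<times> {..<n}) \<union> (\<lambda>(c, l). Slack c l) ` ({..<length cls} \<times> {..<m - 2})"
proof -
  have "\<exists>x\<in>UNIV \<times> {..<n}. Lit u b = (case x of (b, u) \<Rightarrow> Lit u b)" if "u < n" for u b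
    using that by (intro bexI[of _ "(b, u)"]) auto
  then show ?thesis by (auto simp: items_def image_iff)
qed

lemma distinct_items: "distinct (items cls n m)"
proof -
  have "distinct (concat (map (\<lambda>u. [Lit u True, Lit u False]) [0..<k]))" for k
    by (induction k) auto
  moreover have "distinct (concat (map (\<lambda>c. map (Slack c) [0..<m - 2]) [0..<k]))" for k
    by (induction k) (auto simp: distinct_map inj_on_def)
  ultimately show ?thesis by (auto simp: items_def)
qed

lemma sum_items:
  assumes "S \<subseteq> set (items cls n m)"
  shows "(\<Sum>x\<in>S. f x) = (\<Sum>(b, u)\<in>UNIV \<times> {..<n}. of_bool (Lit u b \<in> S) * f (Lit u b)) +
     (\<Sum>(c, l)\<in>{..<length cls} \<times> {..<m - 2}. of_bool (Slack c l \<in> S) * (f (Slack c l) :: nat))"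
proof -
  have "(\<Sum>x\<in>S. f x) = (\<Sum>x\<in>set (items cls n m). of_bool (x \<in> S) * f x)"
    using assms by (intro sum.mono_neutral_cong_left) auto
  also have "\<dots> = (\<Sum>x\<in>(\<lambda>(b, u). Lit u b) ` (UNIV \<times> {..<n}). of_bool (x \<in> S) * f x) +
      (\<Sum>x\<in>(\<lambda>(c, l). Slack c l) ` ({..<length cls} \<times> {..<m - 2}). of_bool (x \<in> S) * f x)"
    unfolding set_items by (intro sum.union_disjoint) auto
  also have "(\<Sum>x\<in>(\<lambda>(b, u). Lit u b) ` (UNIV \<times> {..<n}). of_bool (x \<in> S) * f x) =
      (\<Sum>(b, u)\<in>UNIV \<times> {..<n}. of_bool (Lit u b \<in> S) * f (Lit u b))"
    by (subst sum.reindex) (auto simp: inj_on_def case_prod_unfold)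
  also have "(\<Sum>x\<in>(\<lambda>(c, l). Slack c l) ` ({..<length cls} \<times> {..<m - 2}). of_bool (x \<in> S) * f x) =
      (\<Sum>(c, l)\<in>{..<length cls} \<times> {..<m - 2}. of_bool (Slack c l \<in> S) * f (Slack c l))"
    by (subst sum.reindex) (auto simp: inj_on_def case_prod_unfold)
  finally show ?thesis .
qed

lemma clause_column:
  assumes "S \<subseteq> set (items cls n m)" "c < length cls"
  shows "(\<Sum>x\<in>S. digit cls x c) = length (filter (\<lambda>(b, u). Lit u b \<in> S) (cls ! c)) +
     card {l. l < m - 2 \<and> Slack c l \<in> S}"
proof -
  have c: "cls ! c \<in> set cls" using assms by simp
  have 1: "(\<Sum>(b, u)\<in>UNIV \<times> {..<n}. of_bool (Lit u b \<in> S) * digit cls (Lit u b) c) =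
     length (filter (\<lambda>(b, u). Lit u b \<in> S) (cls ! c))" (is "?l = _")
  proof -
    have "?l = (\<Sum>x\<in>UNIV \<times> {..<n}. of_bool (case x of (b, u) \<Rightarrow> Lit u b \<in> S) * count_list (cls ! c) x)"
    using assms by (intro sum.cong) auto
  also have "\<dots> = length (filter (\<lambda>(b, u). Lit u b \<in> S) (cls ! c))"
    using vars[OF c] by (intro sum_count_list) auto
    finally show ?thesis .
  qed
  have "(\<Sum>(c', l)\<in>{..<length cls} \<times> {..<m - 2}. of_bool (Slack c' l \<in> S) * digit cls (Slack c' l) c) =
      (\<Sum>c'<length cls. \<Sum>l<m - 2. of_bool (Slack c' l \<in> S) * of_bool (c = c'))"
    unfolding sum.cartesian_product by (intro sum.cong) auto
  also have "\<dots> = (\<Sum>c'<length cls. of_bool (c' = c) * (\<Sum>l<m - 2. of_bool (Slack c' l \<in> S)))"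
    by (intro sum.cong) (auto simp: sum_distrib_left)
  also have "\<dots> = (\<Sum>l<m - 2. of_bool (Slack c l \<in> S))" using assms(2) by (simp add: of_bool_def if_distrib[of "\<lambda>x. x * _"] cong: if_cong)
  also have "\<dots> = card {l. l < m - 2 \<and> Slack c l \<in> S}"
    by (simp add: sum.If_cases of_bool_def Int_def)
  finally show ?thesis unfolding sum_items[OF assms(1)] 1 by (rule arg_cong)
qed

lemma variable_column:
  assumes "S \<subseteq> set (items cls n m)" "u < n"
  shows "(\<Sum>x\<in>S. digit cls x (length cls + u)) = of_bool (Lit u True \<in> S) + of_bool (Lit u False \<in> S)"
proof -
  have "(\<Sum>(b, u')\<in>UNIV \<times> {..<n}. of_bool (Lit u' b \<in> S) * digit cls (Lit u' b) (length cls + u)) =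
      (\<Sum>b\<in>UNIV. \<Sum>u'<n. of_bool (Lit u' b \<in> S) * of_bool (u = u'))"
    unfolding sum.cartesian_product by (intro sum.cong) auto
  also have "\<dots> = (\<Sum>b\<in>UNIV. of_bool (Lit u b \<in> S))"
    using assms(2) by (simp add: of_bool_def if_distrib[of "\<lambda>x. _ * x"] cong: if_cong)
  finally have 1: "(\<Sum>(b, u')\<in>UNIV \<times> {..<n}. of_bool (Lit u' b \<in> S) * digit cls (Lit u' b) (length cls + u)) =
      of_bool (Lit u True \<in> S) + of_bool (Lit u False \<in> S)"
    by (simp add: UNIV_bool)
  have 2: "(\<Sum>(c, l)\<in>{..<length cls} \<times> {..<m - 2}.
      of_bool (Slack c l \<in> S) * digit cls (Slack c l) (length cls + u)) = 0"
    by (intro sum.neutral) auto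
  show ?thesis unfolding sum_items[OF assms(1)] 1 2 by simp
qed

lemma base: "2 * m < 2 ^ Suc m"
  using less_exp[of m] by simp

text \<open>This is the absence of carries: the column sums are themselves the digits of the sum of
  the numbers.\<close>

lemma column_bound:
  assumes "S \<subseteq> set (items cls n m)" "c < length cls + n"
  shows "(\<Sum>x\<in>S. digit cls x c) < 2 ^ Suc m"
proof (cases "c < length cls")
  case True
  have "length (filter (\<lambda>(b, u). Lit u b \<in> S) (cls ! c)) \<le> m"
    using len[of "cls ! c"] True length_filter_le[of _ "cls ! c"] by simp
  moreover have "card {l. l < m - 2 \<and> Slack c l \<in> S} \<le> card {..<m - 2}" by (intro card_mono) auto
  moreover have "card {..<m - 2} \<le> m" by simp
  ultimately show ?thesis using clause_column[OF assms(1) True] base by linarith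
next
  case False
  then have "(\<Sum>x\<in>S. digit cls x c) \<le> 2"
    using variable_column[OF assms(1), of "c - length cls"] assms by simp
  then show ?thesis using base m by linarith
qed

lemma sum_item_number: "(\<Sum>x\<in>S. item_number cls n m x) =
    numeral_of (2 ^ Suc m) (length cls + n) (\<lambda>c. \<Sum>x\<in>S. digit cls x c)"
  unfolding item_number_def by (rule sum_numeral_of)

lemma sum_all_items: "(\<Sum>x\<in>set (items cls n m). item_number cls n m x) = 2 * target cls n m"
proof -
  have "(\<Sum>x\<in>set (items cls n m). digit cls x c) = 2 * (if c < length cls then m - 1 else 1)"
    if "c < length cls + n" for c
  proof (cases "c < length cls")
    case True
    have "Lit u b \<in> set (items cls n m)" if "(b, u) \<in> set (cls ! c)" for u b
      using vars[of "cls ! c" b u] that True by (auto simp: set_items image_iff)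
    then have "filter (\<lambda>(b, u). Lit u b \<in> set (items cls n m)) (cls ! c) = cls ! c"
      by (intro filter_True) auto
    moreover have "{l. l < m - 2 \<and> Slack c l \<in> set (items cls n m)} = {..<m - 2}"
      using True by (auto simp: set_items)
    ultimately show ?thesis using clause_column[of "set (items cls n m)" c] True len[of "cls ! c"] m by simp
  next
    case False
    then have "c - length cls < n" using that by simp
    then have "Lit (c - length cls) b \<in> set (items cls n m)" for b
      by (auto simp: set_items image_iff)
    then show ?thesis using variable_column[of "set (items cls n m)" "c - length cls"] False that by simp
  qed
  then show ?thesis unfolding sum_item_number by (simp add: numeral_of_def target_def sum_distrib_left mult.assoc)
qed

lemma nae_sat_iff: "nae_sat cls \<longleftrightarrow> (\<exists>S\<subseteq>set (items cls n m). (\<Sum>x\<in>S. item_number cls n m x) = target cls n m)"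
proof
  assume "nae_sat cls"
  then obtain \<phi> where \<phi>: "\<And>cl. cl \<in> set cls \<Longrightarrow> \<exists>(b, u)\<in>set cl. \<phi> u = b"
      "\<And>cl. cl \<in> set cls \<Longrightarrow> \<exists>(b, u)\<in>set cl. \<phi> u \<noteq> b"
    by (auto simp: nae_sat_def)
  define tr where "tr c = length (filter (\<lambda>(b, u). \<phi> u = b) (cls ! c))" for c
  have tr: "1 \<le> tr c" "tr c \<le> m - 1" if "c < length cls" for c
  proof -
    have cl: "cls ! c \<in> set cls" using that by simp
    have "filter (\<lambda>(b, u). \<phi> u = b) (cls ! c) \<noteq> []" using \<phi>(1)[OF cl] by (auto simp: filter_empty_conv)
    then show "1 \<le> tr c" unfolding tr_def by (simp add: Suc_le_eq)
    have "tr c < length (cls ! c)" unfolding tr_def using \<phi>(2)[OF cl] by (auto intro!: length_filter_less)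
    then show "tr c \<le> m - 1" using len[OF cl] by simp
  qed
  \<comment> \<open>The true literals, with \<open>m - 1 - tr c\<close> slacks that raise the column
    of clause \<open>c\<close> to \<open>m - 1\<close>.\<close>
  define S where "S = {Lit u b |u b. u < n \<and> \<phi> u = b} \<union>
      {Slack c l |c l. c < length cls \<and> l < m - 1 - tr c}"
  have "l < m - 2" if "c < length cls" "l < m - 1 - tr c" for c l using tr[OF that(1)] that(2) by simp
  then have sub: "S \<subseteq> set (items cls n m)" by (auto simp: S_def set_items image_iff)
  have "(\<Sum>x\<in>S. digit cls x c) = (if c < length cls then m - 1 else 1)" if "c < length cls + n" for c
  proof (cases "c < length cls")
    case True
    have "filter (\<lambda>(b, u). Lit u b \<in> S) (cls ! c) = filter (\<lambda>(b, u). \<phi> u = b) (cls ! c)"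
      using vars[of "cls ! c"] True by (intro filter_cong) (auto simp: S_def)
    moreover have "{l. l < m - 2 \<and> Slack c l \<in> S} = {..<m - 1 - tr c}"
      using tr[OF True] True by (auto simp: S_def)
    ultimately show ?thesis using clause_column[OF sub True] tr[OF True] True by (simp add: tr_def)
  next
    case False
    then have "c - length cls < n" using that by simp
    then show ?thesis using variable_column[OF sub, of "c - length cls"] False by (simp add: S_def)
  qed
  then have "(\<Sum>x\<in>S. item_number cls n m x) = target cls n m"
    unfolding sum_item_number target_def numeral_of_def by (intro sum.cong) auto
  then show "\<exists>S\<subseteq>set (items cls n m). (\<Sum>x\<in>S. item_number cls n m x) = target cls n m" using sub by (intro exI[of _ S]) simp
next
  assume "\<exists>S\<subseteq>set (items cls n m). (\<Sum>x\<in>S. item_number cls n m x) = target cls n m"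
  then obtain S where S: "S \<subseteq> set (items cls n m)" "(\<Sum>x\<in>S. item_number cls n m x) = target cls n m" by blast
  have small: "(if c < length cls then m - 1 else 1) < 2 ^ Suc m" for c
  proof -
    have "(if c < length cls then m - 1 else 1) \<le> m" using m by simp
    then show ?thesis using base by linarith
  qed
  \<comment> \<open>Both numbers are base \<open>2 ^ Suc m\<close> expansions with admissible
    digits, so their equality splits into columns.\<close>
  have col: "(\<Sum>x\<in>S. digit cls x c) = (if c < length cls then m - 1 else 1)" if "c < length cls + n" for c
    by (rule numeral_of_inject[OF S(2)[unfolded sum_item_number target_def] column_bound[OF S(1)] small that])
  define \<phi> where "\<phi> u \<longleftrightarrow> Lit u True \<in> S" for u
  have \<phi>: "Lit u b \<in> S \<longleftrightarrow> \<phi> u = b" if "u < n" for u b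
  proof -
    have "(\<Sum>x\<in>S. digit cls x (length cls + u)) = 1"
      using col[of "length cls + u"] that by simp
    then have "of_bool (Lit u True \<in> S) + of_bool (Lit u False \<in> S) = (1 :: nat)"
      unfolding variable_column[OF S(1) that] .
    then show ?thesis
      by (cases b; cases "Lit u True \<in> S"; cases "Lit u False \<in> S") (simp_all add: \<phi>_def)
  qed
  have "(\<exists>(b, u)\<in>set cl. \<phi> u = b) \<and> (\<exists>(b, u)\<in>set cl. \<phi> u \<noteq> b)" if "cl \<in> set cls" for cl
  proof -
    from that have "\<exists>c<length cls. cls ! c = cl" by (simp only: in_set_conv_nth)
    then obtain c where "c < length cls" "cls ! c = cl" by blast
    then have c: "c < length cls" "cl = cls ! c" by simp_all
    let ?true = "filter (\<lambda>(b, u). \<phi> u = b) cl" and ?slack = "{l. l < m - 2 \<and> Slack c l \<in> S}"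
    have filter: "filter (\<lambda>(b, u). Lit u b \<in> S) cl = ?true"
    proof (rule filter_cong[OF refl])
      fix x assume x: "x \<in> set cl"
      obtain b u where bu: "x = (b, u)" by fastforce
      show "(case x of (b, u) \<Rightarrow> Lit u b \<in> S) = (case x of (b, u) \<Rightarrow> \<phi> u = b)"
        using vars[OF that, of b u] \<phi>[of u b] x unfolding bu by simp
    qed
    have "(\<Sum>x\<in>S. digit cls x c) = m - 1" using col[of c] c(1) by simp
    then have "length ?true + card ?slack = m - 1"
      unfolding clause_column[OF S(1) c(1)] c(2)[symmetric] filter .
    moreover have "card ?slack \<le> card {..<m - 2}" by (intro card_mono) auto
    then have "card ?slack \<le> m - 2" by simp
    \<comment> \<open>The slacks contribute at most \<open>m - 2\<close>, so some literal is true;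
      the total \<open>m - 1\<close> leaves one of the \<open>m\<close> literals false.\<close>
    ultimately have "0 < length ?true" "length ?true < m" using m by arith+
    then have "?true \<noteq> []" "?true \<noteq> cl" using len[OF that] by auto
    then show ?thesis by (auto simp: filter_empty_conv filter_id_conv)
  qed
  then show "nae_sat cls" unfolding nae_sat_def by blast
qed

text \<open>Subsets of items are exchanged for sets of list indices, which is possible because the
  items are distinct, although several of them carry the same number.\<close>

theorem nae_sat_iff_feasible:
  "nae_sat cls \<longleftrightarrow>
   (\<exists>gs. feasible (partition_instance (map (item_number cls n m) (items cls n m)) (target cls n m)) gs)"
proof -
  let ?xs = "items cls n m"
  have total: "sum_list (map (item_number cls n m) ?xs) = 2 * target cls n m"
    using distinct_items sum_all_items by (simp add: sum_list_distinct_conv_sum_set)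
  have bij: "bij_betw ((!) ?xs) {..<length ?xs} (set ?xs)"
    using distinct_items by (rule bij_betw_nth) simp_all
  have sum: "(\<Sum>i\<in>A. map (item_number cls n m) ?xs ! i) = (\<Sum>x\<in>(!) ?xs ` A. item_number cls n m x)"
    if "A \<subseteq> {..<length ?xs}" for A
  proof -
    have inj: "inj_on ((!) ?xs) A"
      using bij_betw_imp_inj_on[OF bij] that by (rule inj_on_subset)
    have "(\<Sum>i\<in>A. map (item_number cls n m) ?xs ! i) = (\<Sum>i\<in>A. (item_number cls n m) (?xs ! i))"
      using that by (intro sum.cong) auto
    then show ?thesis by (simp add: sum.reindex[OF inj])
  qed
  have "(\<exists>S\<subseteq>set ?xs. (\<Sum>x\<in>S. item_number cls n m x) = target cls n m) \<longleftrightarrow>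
      (\<exists>A\<subseteq>{..<length ?xs}. (\<Sum>i\<in>A. map (item_number cls n m) ?xs ! i) = target cls n m)"
  proof
    assume "\<exists>S\<subseteq>set ?xs. (\<Sum>x\<in>S. item_number cls n m x) = target cls n m"
    then obtain S where S: "S \<subseteq> set ?xs" "(\<Sum>x\<in>S. item_number cls n m x) = target cls n m" by (elim exE conjE)
    have "\<exists>A\<subseteq>{..<length ?xs}. S = (!) ?xs ` A"
      using S(1) unfolding bij_betw_imp_surj_on[OF bij, symmetric] by (simp only: subset_image_iff)
    then obtain A where A: "A \<subseteq> {..<length ?xs}" "S = (!) ?xs ` A" by (elim exE conjE)
    then show "\<exists>A\<subseteq>{..<length ?xs}. (\<Sum>i\<in>A. map (item_number cls n m) ?xs ! i) = target cls n m"
      using sum[OF A(1)] S(2) by (intro exI[of _ A]) simp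
  next
    assume "\<exists>A\<subseteq>{..<length ?xs}. (\<Sum>i\<in>A. map (item_number cls n m) ?xs ! i) = target cls n m"
    then obtain A where A: "A \<subseteq> {..<length ?xs}" "(\<Sum>i\<in>A. map (item_number cls n m) ?xs ! i) = target cls n m" by (elim exE conjE)
    moreover have "(!) ?xs ` A \<subseteq> set ?xs" using A(1) by auto
    ultimately show "\<exists>S\<subseteq>set ?xs. (\<Sum>x\<in>S. item_number cls n m x) = target cls n m"
      using sum[OF A(1)] by (intro exI[of _ "(!) ?xs ` A"]) simp
  qed
  also have "\<dots> \<longleftrightarrow> (\<exists>gs. feasible (partition_instance (map (item_number cls n m) ?xs) (target cls n m)) gs)"
  proof
    assume "\<exists>A\<subseteq>{..<length ?xs}. (\<Sum>i\<in>A. map (item_number cls n m) ?xs ! i) = target cls n m"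
    then obtain A where A: "A \<subseteq> {..<length ?xs}" "(\<Sum>i\<in>A. map (item_number cls n m) ?xs ! i) = target cls n m" by (elim exE conjE)
    show "\<exists>gs. feasible (partition_instance (map (item_number cls n m) ?xs) (target cls n m)) gs"
      by (rule partition_imp_feasible[OF _ A(2) total]) (use A(1) in simp)
  next
    assume "\<exists>gs. feasible (partition_instance (map (item_number cls n m) ?xs) (target cls n m)) gs"
    then obtain gs where gs: "feasible (partition_instance (map (item_number cls n m) ?xs) (target cls n m)) gs" by (elim exE)
    show "\<exists>A\<subseteq>{..<length ?xs}. (\<Sum>i\<in>A. map (item_number cls n m) ?xs ! i) = target cls n m"
      using feasible_imp_partition[OF gs total] by simp
  qed
  finally show ?thesis unfolding nae_sat_iff .
qed

end

section \<open>From satisfiability to not-all-equal satisfiability\<close>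

definition cnf_sat :: "(bool \<times> nat) list list \<Rightarrow> bool" where
  "cnf_sat cls \<longleftrightarrow> (\<exists>\<phi>. \<forall>cl\<in>set cls. \<exists>(b, u)\<in>set cl. \<phi> u = b)"

text \<open>The digit encoding wants all clauses to have the same width \<open>m\<close>. Lists
  shorter than \<open>m\<close> receive at least one copy of the padding literal.\<close>

definition pad :: "nat \<Rightarrow> 'a \<Rightarrow> 'a list \<Rightarrow> 'a list" where
  "pad m x xs = xs @ replicate (m - length xs) x"

lemma set_pad: "length xs < m \<Longrightarrow> set (pad m x xs) = insert x (set xs)"
  by (auto simp: pad_def)

text \<open>The fresh variable \<open>F\<close> plays the role of falsity.\<close>

lemma nae_sat_pad:
  assumes len: "\<And>cl. cl \<in> set cls \<Longrightarrow> length cl < m"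
    and vars: "\<And>cl b u. cl \<in> set cls \<Longrightarrow> (b, u) \<in> set cl \<Longrightarrow> u < F"
  shows "nae_sat (map (pad m (True, F)) cls) \<longleftrightarrow> cnf_sat cls"
proof
  assume "nae_sat (map (pad m (True, F)) cls)"
  then obtain \<phi> where \<phi>: "\<And>cl. cl \<in> set cls \<Longrightarrow> (\<exists>(b, u)\<in>set (pad m (True, F) cl). \<phi> u = b) \<and>
      (\<exists>(b, u)\<in>set (pad m (True, F) cl). \<phi> u \<noteq> b)"
    unfolding nae_sat_def by auto
  \<comment> \<open>Not-all-equal satisfaction is invariant under complementing the assignment;
    \<open>\<psi>\<close> is the version in which \<open>F\<close> is false.\<close>
  define \<psi> where "\<psi> u = (\<phi> u \<noteq> \<phi> F)" for u
  have "\<exists>(b, u)\<in>set cl. \<psi> u = b" if cl: "cl \<in> set cls" for cl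
    using \<phi>[OF cl] unfolding set_pad[OF len[OF cl]] by (cases "\<phi> F") (auto simp: \<psi>_def)
  then show "cnf_sat cls" unfolding cnf_sat_def by (intro exI[of _ \<psi>]) simp
next
  assume "cnf_sat cls"
  then obtain \<phi> where \<phi>: "\<And>cl. cl \<in> set cls \<Longrightarrow> \<exists>(b, u)\<in>set cl. \<phi> u = b" by (auto simp: cnf_sat_def)
  let ?\<psi> = "\<phi>(F := False)"
  have "(\<exists>(b, u)\<in>set (pad m (True, F) cl). ?\<psi> u = b) \<and> (\<exists>(b, u)\<in>set (pad m (True, F) cl). ?\<psi> u \<noteq> b)"
    if cl: "cl \<in> set cls" for cl
  proof
    obtain b u where "(b, u) \<in> set cl" "\<phi> u = b" using \<phi>[OF cl] by auto
    then show "\<exists>(b, u)\<in>set (pad m (True, F) cl). ?\<psi> u = b"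
      unfolding set_pad[OF len[OF cl]] using vars[OF cl, of b u] by (intro bexI[of _ "(b, u)"]) auto
    show "\<exists>(b, u)\<in>set (pad m (True, F) cl). ?\<psi> u \<noteq> b"
      unfolding set_pad[OF len[OF cl]] by simp
  qed
  then show "nae_sat (map (pad m (True, F)) cls)" unfolding nae_sat_def
    by (intro exI[of _ ?\<psi>]) simp
qed

section \<open>Printing the instance of a uniform family of clauses\<close>

lemma nval_cong: "(\<And>r. r \<in> nvars e \<Longrightarrow> v r = v' r) \<Longrightarrow> nval x v e = nval x v' e"
  by (induction e) auto

lemma concat_map_concat: "concat (map f (concat xss)) = concat (map (\<lambda>xs. concat (map f xs)) xss)"
  by (induction xss) simp_all

text \<open>Horner's scheme in the input length.\<close>

definition npoly :: "nat poly \<Rightarrow> nexp" where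
  "npoly p = foldr (\<lambda>a e. Add (Const a) (Mul Len e)) (coeffs p) (Const 0)"

lemma nval_npoly [simp]: "nval x v (npoly p) = poly p (length x)"
proof -
  have "nval x v (foldr (\<lambda>a e. Add (Const a) (Mul Len e)) as (Const 0)) =
      horner_sum id (length x) as" for as
    by (induction as) auto
  then show ?thesis by (simp add: npoly_def poly_def)
qed

lemma nvars_npoly [simp]: "nvars (npoly p) = {}"
proof -
  have "nvars (foldr (\<lambda>a e. Add (Const a) (Mul Len e)) as (Const 0)) = {}" for as
    by (induction as) auto
  then show ?thesis by (simp add: npoly_def)
qed

definition cats :: "pr list \<Rightarrow> pr" where
  "cats Ps = foldr Cat Ps (Out [])"

lemma out_cats [simp]: "out x v (cats Ps) = concat (map (out x v) Ps)"
  by (induction Ps) (auto simp: cats_def)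

lemma wf_cats [simp]: "wf_pr D A (cats Ps) \<longleftrightarrow> (\<forall>P\<in>set Ps. wf_pr D A P)"
  by (induction Ps) (auto simp: cats_def)

section \<open>Binary words and blocks of fixed width\<close>

fun val :: "bool list \<Rightarrow> nat" where
  "val [] = 0"
| "val (b # bs) = of_bool b + 2 * val bs"

definition digits :: "bool list \<Rightarrow> bool list" where
  "digits bs = concat (map (\<lambda>b. [True, b]) bs)"

lemma digits_simps [simp]:
  "digits [] = []" "digits (b # bs) = True # b # digits bs" "digits (bs @ bs') = digits bs @ digits bs'"
  by (simp_all add: digits_def)

lemma digits_concat [simp]: "digits (concat bss) = concat (map digits bss)"
  by (induction bss) simp_all

lemma val_pos: "bs \<noteq> [] \<Longrightarrow> last bs \<Longrightarrow> val bs \<noteq> 0"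
  by (induction bs) (auto split: if_splits)

text \<open>Words are least significant bit first, so \<open>last bs\<close> excludes the leading
  zeros that \<open>enc_nat\<close> never prints.\<close>

lemma enc_nat_val: "bs = [] \<or> last bs \<Longrightarrow> enc_nat (val bs) = digits bs @ [False]"
proof (induction bs)
  case (Cons b bs)
  have bs: "bs = [] \<or> last bs" using Cons.prems by (cases bs) auto
  have pos: "val (b # bs) \<noteq> 0" using Cons.prems by (intro val_pos) simp_all
  have "val (b # bs) div 2 = val bs" "odd (val (b # bs)) = b" by simp_all
  then show ?case using Cons.IH[OF bs] by (simp only: enc_nat_pos[OF pos] digits_simps append_Cons)
qed simp

lemma val_append: "val (xs @ ys) = val xs + 2 ^ length xs * val ys"
  by (induction xs) (auto simp: algebra_simps)

fun bits :: "nat \<Rightarrow> nat \<Rightarrow> bool list" where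
  "bits 0 k = []"
| "bits (Suc b) k = odd k # bits b (k div 2)"

lemma length_bits [simp]: "length (bits b k) = b"
  by (induction b arbitrary: k) auto

lemma val_bits: "k < 2 ^ b \<Longrightarrow> val (bits b k) = k"
proof (induction b arbitrary: k)
  case (Suc b)
  then have "val (bits b (k div 2)) = k div 2" by (intro Suc.IH) auto
  then show ?case by (simp add: mod2_eq_if[symmetric] flip: mod2_eq_if odd_iff_mod_2_eq_one)
qed simp

lemma length_concat_bits: "length (concat (map (\<lambda>c. bits b (f c)) cs)) = b * length cs"
  by (induction cs) auto

lemma val_concat_bits:
  "(\<And>c. c < k \<Longrightarrow> f c < 2 ^ b) \<Longrightarrow> val (concat (map (\<lambda>c. bits b (f c)) [0..<k])) = numeral_of (2 ^ b) k f"
proof (induction k)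
  case (Suc k)
  then show ?case
    by (simp add: numeral_of_def val_append length_concat_bits val_bits power_mult)
qed (simp add: numeral_of_def)

text \<open>A family \<open>(p, q, tpl)\<close> has one clause for each value of its loop variables \<open>Var 1\<close> and \<open>Var 2\<close>,
  which are bounded by \<open>p\<close> and \<open>q\<close> at the input length. \<open>Var 0\<close> is left to the printer,
  for the item whose digits are being printed.\<close>

type_synonym family = "nat poly \<times> nat poly \<times> (bool \<times> nexp) list"

definition lits :: "bool list \<Rightarrow> (nat \<Rightarrow> nat) \<Rightarrow> (bool \<times> nexp) list \<Rightarrow> (bool \<times> nat) list" where
  "lits x v tpl = map (\<lambda>(b, e). (b, nval x v e)) tpl"

definition loop_env :: "nat \<Rightarrow> nat \<Rightarrow> nat \<Rightarrow> nat" where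
  "loop_env t i = (\<lambda>_. 0)(1 := t, 2 := i)"

definition family_clauses :: "bool list \<Rightarrow> family \<Rightarrow> (bool \<times> nat) list list" where
  "family_clauses x = (\<lambda>(p, q, tpl). concat (map (\<lambda>t. map (\<lambda>i. lits x (loop_env t i) tpl)
     [0..<poly q (length x)]) [0..<poly p (length x)]))"

definition cnf :: "family list \<Rightarrow> bool list \<Rightarrow> (bool \<times> nat) list list" where
  "cnf fams x = concat (map (family_clauses x) fams)"

definition num_clauses :: "family list \<Rightarrow> nat poly" where
  "num_clauses fams = sum_list (map (\<lambda>(p, q, tpl). p * q) fams)"

lemma length_cnf: "length (cnf fams x) = poly (num_clauses fams) (length x)"
proof -
  have "length (family_clauses x fam) = (case fam of (p, q, tpl) \<Rightarrow> poly (p * q) (length x))" for fam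
    by (auto simp: family_clauses_def length_concat comp_def sum_list_triv split: prod.split)
  then show ?thesis unfolding cnf_def num_clauses_def
    by (induction fams) (auto simp: split: prod.splits)
qed

definition closed :: "family list \<Rightarrow> bool" where
  "closed fams \<longleftrightarrow> (\<forall>(p, q, tpl)\<in>set fams. \<forall>(b, e)\<in>set tpl. nvars e \<subseteq> {1, 2})"

text \<open>The count \<open>k\<close> lives in the syntax and not in a register: a tree of tests
  branches on the template's literals, and each leaf prints a constant block. The tree may be
  exponential in the length of the template, which is independent of the input.\<close>

fun count_pr :: "nat \<Rightarrow> bool \<Rightarrow> (bool \<times> nexp) list \<Rightarrow> nat \<Rightarrow> pr" where
  "count_pr w b [] k = Out (digits (bits w k))"
| "count_pr w b ((b', e) # tpl) k =
     (if b' = b then IfEq e (Var 0) (count_pr w b tpl (Suc k)) (count_pr w b tpl k)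
      else count_pr w b tpl k)"

lemma out_count_pr:
  "out x v (count_pr w b tpl k) = digits (bits w (k + count_list (lits x v tpl) (b, v 0)))"
  by (induction w b tpl k rule: count_pr.induct) (auto simp: lits_def)

lemma wf_count_pr:
  "\<forall>l\<in>set tpl. nvars (snd l) \<subseteq> {..<3} \<Longrightarrow> wf_pr 3 A (count_pr w b tpl k)"
  by (induction w b tpl k rule: count_pr.induct) simp_all

definition row_pr :: "nat \<Rightarrow> bool \<Rightarrow> family list \<Rightarrow> pr" where
  "row_pr w b fams =
     cats (map (\<lambda>(p, q, tpl). For 1 (npoly p) (For 2 (npoly q) (count_pr w b tpl 0))) fams)"

lemma out_row_pr:
  assumes "closed fams"
  shows "out x ((\<lambda>_. 0)(0 := u)) (row_pr w b fams) =
     digits (concat (map (\<lambda>cl. bits w (count_list cl (b, u))) (cnf fams x)))"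
proof -
  have lits: "lits x ((\<lambda>_. 0)(0 := u, Suc 0 := t, 2 := i)) tpl = lits x (loop_env t i) tpl"
    if "(p, q, tpl) \<in> set fams" for p q tpl t i
    unfolding lits_def
  proof (rule map_cong[OF refl])
    fix l assume "l \<in> set tpl"
    then have "nvars (snd l) \<subseteq> {1, 2}" using assms that unfolding closed_def by fastforce
    then have "nval x ((\<lambda>_. 0)(0 := u, Suc 0 := t, 2 := i)) (snd l) = nval x (loop_env t i) (snd l)"
      by (intro nval_cong) (auto simp: loop_env_def)
    then show "(case l of (b, e) \<Rightarrow> (b, nval x ((\<lambda>_. 0)(0 := u, Suc 0 := t, 2 := i)) e)) =
        (case l of (b, e) \<Rightarrow> (b, nval x (loop_env t i) e))"
      by (simp add: case_prod_unfold)
  qed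
  have "out x ((\<lambda>_. 0)(0 := u)) (For 1 (npoly p) (For 2 (npoly q) (count_pr w b tpl 0))) =
      digits (concat (map (\<lambda>cl. bits w (count_list cl (b, u))) (family_clauses x (p, q, tpl))))"
    if "(p, q, tpl) \<in> set fams" for p q tpl
    using lits[OF that]
    by (simp add: out_count_pr family_clauses_def concat_map_concat comp_def)
  then have "map (\<lambda>fam. out x ((\<lambda>_. 0)(0 := u))
        (case fam of (p, q, tpl) \<Rightarrow> For 1 (npoly p) (For 2 (npoly q) (count_pr w b tpl 0)))) fams =
      map (\<lambda>fam. digits (concat (map (\<lambda>cl. bits w (count_list cl (b, u))) (family_clauses x fam)))) fams"
    by (intro map_cong refl) (simp only: split_paired_all prod.case)
  then show ?thesis
    by (simp only: row_pr_def out_cats cnf_def concat_map_concat map_map comp_def digits_concat)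
qed

lemma wf_row_pr:
  assumes "closed fams"
  shows "wf_pr 3 {0} (row_pr w b fams)"
proof -
  have "wf_pr 3 A (count_pr w b tpl 0)" if "(p, q, tpl) \<in> set fams" for p q tpl A
  proof (rule wf_count_pr, rule ballI)
    fix l assume "l \<in> set tpl"
    then have "nvars (snd l) \<subseteq> {1, 2}" using assms that unfolding closed_def by fastforce
    then show "nvars (snd l) \<subseteq> {..<3}" by auto
  qed
  then show ?thesis by (auto simp: row_pr_def)
qed

text \<open>The entry of one destination, with \<open>P\<close> printing the lower digits of the
  item. The low bit \<open>False\<close> doubles the number, and the single bit \<open>True\<close>
  is its leading digit 1 without the zeros of its block.\<close>

definition item_pr :: "pr \<Rightarrow> pr" where
  "item_pr P = cats [Out (True # enc_int 0), Out (False # digits [False]), P,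
     Out (digits [True] @ [False]), Out (enc_int 0)]"

text \<open>After the clause columns, the loop up to \<open>Var 0\<close> prints the zero columns of
  the variables with smaller index.\<close>

definition literal_pr :: "nat \<Rightarrow> family list \<Rightarrow> bool \<Rightarrow> pr" where
  "literal_pr w fams b = item_pr (Cat (row_pr w b fams) (For 1 (Var 0) (Out (digits (bits w 0)))))"

definition slack_pr :: "nat \<Rightarrow> pr" where
  "slack_pr w = item_pr (For 1 (Var 0) (Out (digits (bits w 0))))"

text \<open>Here the low bit \<open>True\<close> supplies the \<open>+ 1\<close> in
  \<open>2 * T + 1\<close>. There are \<open>F + 1\<close> variables including the fresh one; the
  last variable column is the leading bit.\<close>

definition time_pr :: "nat \<Rightarrow> nat \<Rightarrow> nat poly \<Rightarrow> nat poly \<Rightarrow> pr" where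
  "time_pr w m C F = cats [Out (False # digits [True]), For 0 (npoly C) (Out (digits (bits w (m - 1)))),
     For 0 (npoly F) (Out (digits (bits w 1))), Out (digits [True] @ [False])]"

definition instance_pr :: "nat \<Rightarrow> family list \<Rightarrow> nat poly \<Rightarrow> pr" where
  "instance_pr m fams F = cats
     [Out (enc_list enc_nat [0..<1]),
      Out (enc_list (\<lambda>c. enc_int 0 @ enc_list (\<lambda>s. enc_int 0) [0..<1]) [0..<1]),
      For 0 (npoly (F + 1)) (Cat (literal_pr (Suc m) fams True) (literal_pr (Suc m) fams False)),
      For 0 (npoly (num_clauses fams)) (cats (replicate (m - 2) (slack_pr (Suc m)))),
      Out [False],
      time_pr (Suc m) m (num_clauses fams) F,
      Out (enc_list enc_nat [0..<2] @ enc_nat 1),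
      For 0 (npoly (2 * (F + 1) + [:m - 2:] * num_clauses fams))
        (cats [Out (True # enc_nat 0), OutNat (Var 0), Out (enc_int 0)]),
      Out [False],
      time_pr (Suc m) m (num_clauses fams) F,
      Out (enc_rat 0)]"

lemma wf_instance_pr: "closed fams \<Longrightarrow> wf_pr 3 {} (instance_pr m fams F)"
  by (auto simp: instance_pr_def literal_pr_def slack_pr_def item_pr_def time_pr_def wf_row_pr)

lemma enc_int_of_nat: "enc_int (int k) = False # enc_nat k"
  by (simp add: enc_int_def)

lemma enc_partition_instance:
  "enc_ilmtp (partition_instance as T) =
     enc_list enc_nat [0..<1]
     @ enc_list (\<lambda>c. enc_int 0 @ enc_list (\<lambda>s. enc_int 0) [0..<1]) [0..<1]
     @ concat (map (\<lambda>a. True # enc_int 0 @ False # enc_nat (2 * a) @ enc_int 0) as) @ [False]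
     @ False # enc_nat (2 * T + 1)
     @ enc_list enc_nat [0..<2] @ enc_nat 1
     @ concat (map (\<lambda>j. True # enc_nat 0 @ enc_nat j @ enc_int 0) [0..<length as]) @ [False]
     @ False # enc_nat (2 * T + 1)
     @ enc_rat 0"
proof -
  have "map (\<lambda>d. True # enc_int 0 @ enc_int (int (2 * as ! d)) @ enc_int 0) [0..<length as] =
      map (\<lambda>a. True # enc_int 0 @ False # enc_nat (2 * a) @ enc_int 0) as"
    by (rule nth_equalityI) (simp_all add: enc_int_of_nat del: of_nat_mult)
  moreover have "enc_int (t_max (partition_instance as T)) = False # enc_nat (2 * T + 1)"
    "enc_int (t_win (partition_instance as T)) = False # enc_nat (2 * T + 1)"
    by (simp_all only: partition_instance_simps enc_int_of_nat)
  ultimately show ?thesis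
    by (simp add: enc_ilmtp_def enc_list_def del: of_nat_mult partition_instance_simps(9,16))
qed

lemma numeral_of_top:
  assumes "k0 < k" "f k0 = 1" "\<And>c. k0 < c \<Longrightarrow> c < k \<Longrightarrow> f c = 0"
  shows "numeral_of B k f = numeral_of B k0 f + B ^ k0"
proof -
  have "numeral_of B k f = (\<Sum>c\<in>{..<Suc k0}. f c * B ^ c)"
    unfolding numeral_of_def using assms by (intro sum.mono_neutral_right) auto
  then show ?thesis using assms(2) by (simp add: numeral_of_def)
qed

text \<open>With leading digit 1 in column \<open>k\<close>, the top block shrinks to one bit and no
  leading zeros arise; \<open>b\<close> is the bit put below the number.\<close>

lemma enc_numeral:
  assumes "\<And>c. c < k \<Longrightarrow> f c < 2 ^ w" "f k = 1" "k < n" "\<And>c. k < c \<Longrightarrow> c < n \<Longrightarrow> f c = 0"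
  shows "enc_nat (of_bool b + 2 * numeral_of (2 ^ w) n f) =
     digits [b] @ digits (concat (map (\<lambda>c. bits w (f c)) [0..<k])) @ digits [True] @ [False]"
proof -
  let ?bs = "b # concat (map (\<lambda>c. bits w (f c)) [0..<k]) @ [True]"
  have "val ?bs = of_bool b + 2 * numeral_of (2 ^ w) n f"
    using numeral_of_top[of k n f "2 ^ w"] assms
    by (simp add: val_append val_concat_bits length_concat_bits power_mult)
  then show ?thesis using enc_nat_val[of ?bs] by simp
qed

lemma map_upt_append: "map f [0..<j + k] = map f [0..<j] @ map (\<lambda>i. f (j + i)) [0..<k]"
  by (induction k) auto

lemma map_nth_upt: "map (\<lambda>c. g (xs ! c)) [0..<length xs] = map g xs"
  by (rule nth_equalityI) auto

context
  fixes fams :: "family list" and F :: "nat poly" and m :: nat and x :: "bool list"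
  assumes closed: "closed fams" and m: "2 \<le> m"
    and len: "\<And>cl. cl \<in> set (cnf fams x) \<Longrightarrow> length cl = m"
    and vars: "\<And>cl b u. cl \<in> set (cnf fams x) \<Longrightarrow> (b, u) \<in> set cl \<Longrightarrow> u < poly (F + 1) (length x)"
begin

abbreviation (input) cs where "cs \<equiv> cnf fams x"
abbreviation (input) nv where "nv \<equiv> poly (F + 1) (length x)"

lemma out_literal_pr:
  assumes "u < nv"
  shows "out x ((\<lambda>_. 0)(0 := u)) (literal_pr (Suc m) fams b) =
     True # enc_int 0 @ False # enc_nat (2 * item_number cs nv m (Lit u b)) @ enc_int 0"
proof -
  have count: "count_list (cs ! c) (b, u) < 2 ^ Suc m" if "c < length cs" for c
  proof -
    have "count_list (cs ! c) (b, u) \<le> m"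
      using count_le_length[of "cs ! c" "(b, u)"] len[of "cs ! c"] that by simp
    then show ?thesis using less_exp[of "Suc m"] by linarith
  qed
  have "enc_nat (of_bool False + 2 * item_number cs nv m (Lit u b)) =
     digits [False] @ digits (concat (map (\<lambda>c. bits (Suc m) (digit cs (Lit u b) c)) [0..<length cs + u]))
     @ digits [True] @ [False]"
    unfolding item_number_def
    by (rule enc_numeral) (use assms count in auto)
  also have "map (\<lambda>c. bits (Suc m) (digit cs (Lit u b) c)) [0..<length cs + u] =
      map (\<lambda>cl. bits (Suc m) (count_list cl (b, u))) cs @ map (\<lambda>_. bits (Suc m) 0) [0..<u]"
    unfolding map_upt_append map_nth_upt[of "\<lambda>cl. bits (Suc m) (count_list cl (b, u))" cs, symmetric]
    by (intro arg_cong2[where f = append] map_cong) auto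
  finally show ?thesis
    by (simp add: literal_pr_def item_pr_def out_row_pr[OF closed] comp_def)
qed

lemma out_slack_pr:
  assumes "c < length cs"
  shows "out x ((\<lambda>_. 0)(0 := c)) (slack_pr (Suc m)) =
     True # enc_int 0 @ False # enc_nat (2 * item_number cs nv m (Slack c l)) @ enc_int 0"
proof -
  have "enc_nat (of_bool False + 2 * item_number cs nv m (Slack c l)) =
     digits [False] @ digits (concat (map (\<lambda>c'. bits (Suc m) (digit cs (Slack c l) c')) [0..<c]))
     @ digits [True] @ [False]"
    unfolding item_number_def
    by (rule enc_numeral) (use assms in auto)
  also have "map (\<lambda>c'. bits (Suc m) (digit cs (Slack c l) c')) [0..<c] = map (\<lambda>_. bits (Suc m) 0) [0..<c]"
    by (intro map_cong) auto
  finally show ?thesis by (simp add: slack_pr_def item_pr_def comp_def)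
qed

lemma out_time_pr:
  "out x (\<lambda>_. 0) (time_pr (Suc m) m (num_clauses fams) F) = False # enc_nat (2 * target cs nv m + 1)"
proof -
  let ?F = "poly F (length x)" and ?f = "\<lambda>c. if c < length cs then m - 1 else 1"
  have small: "?f c < 2 ^ Suc m" for c
  proof -
    have "?f c \<le> m" using m by simp
    also have "m < 2 ^ Suc m" using less_exp[of "Suc m"] by linarith
    finally show ?thesis .
  qed
  have "enc_nat (of_bool True + 2 * target cs nv m) =
     digits [True] @ digits (concat (map (\<lambda>c. bits (Suc m) (?f c)) [0..<length cs + ?F]))
     @ digits [True] @ [False]"
    unfolding target_def
    by (rule enc_numeral[OF small]) auto
  also have "map (\<lambda>c. bits (Suc m) (?f c)) [0..<length cs + ?F] =
      map (\<lambda>_. bits (Suc m) (m - 1)) [0..<length cs] @ map (\<lambda>_. bits (Suc m) 1) [0..<?F]"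
    unfolding map_upt_append by (intro arg_cong2[where f = append] map_cong) auto
  finally show ?thesis by (simp add: time_pr_def length_cnf comp_def)
qed

lemma out_instance_pr:
  "out x (\<lambda>_. 0) (instance_pr m fams F) =
     enc_ilmtp (partition_instance (map (item_number cs nv m) (items cs nv m)) (target cs nv m))"
proof -
  let ?g = "\<lambda>y. True # enc_int 0 @ False # enc_nat (2 * item_number cs nv m y) @ enc_int 0"
  let ?l = "Cat (literal_pr (Suc m) fams True) (literal_pr (Suc m) fams False)"
  let ?s = "cats (replicate (m - 2) (slack_pr (Suc m)))"
  have "concat (map (\<lambda>u. out x ((\<lambda>_. 0)(0 := u)) ?l) [0..<nv]) =
     concat (map (\<lambda>u. concat (map ?g [Lit u True, Lit u False])) [0..<nv])"
  proof (intro arg_cong[where f = concat] map_cong refl)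
    fix u assume "u \<in> set [0..<nv]"
    then have "u < nv" by (simp only: set_upt atLeastLessThan_iff)
    then show "out x ((\<lambda>_. 0)(0 := u)) ?l = concat (map ?g [Lit u True, Lit u False])"
      unfolding out.simps by (simp only: out_literal_pr) simp
  qed
  moreover have "concat (map (\<lambda>c. out x ((\<lambda>_. 0)(0 := c)) ?s) [0..<length cs]) =
     concat (map (\<lambda>c. concat (map ?g (map (Slack c) [0..<m - 2]))) [0..<length cs])"
  proof (intro arg_cong[where f = concat] map_cong refl)
    fix c assume "c \<in> set [0..<length cs]"
    then have "out x ((\<lambda>_. 0)(0 := c)) (slack_pr (Suc m)) = ?g (Slack c l)" for l
      using out_slack_pr[of c l] by simp
    then have "map (?g \<circ> Slack c) [0..<m - 2] = map (\<lambda>_. out x ((\<lambda>_. 0)(0 := c)) (slack_pr (Suc m))) [0..<m - 2]"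
      by (intro map_cong refl) simp
    then show "out x ((\<lambda>_. 0)(0 := c)) ?s = concat (map ?g (map (Slack c) [0..<m - 2]))"
      by (simp add: map_replicate_trivial map_replicate_const)
  qed
  moreover have "concat (map ?g (items cs nv m)) =
      concat (map (\<lambda>u. concat (map ?g [Lit u True, Lit u False])) [0..<nv]) @
      concat (map (\<lambda>c. concat (map ?g (map (Slack c) [0..<m - 2]))) [0..<length cs])"
    by (simp only: items_def map_append concat_append concat_map_concat map_map comp_def)
  moreover have "length (items cs nv m) = poly (2 * (F + 1) + [:m - 2:] * num_clauses fams) (length x)"
    by (simp add: items_def length_concat comp_def sum_list_triv length_cnf)
  ultimately show ?thesis
    unfolding enc_partition_instance instance_pr_def
    by (simp add: out_time_pr length_cnf comp_def)
qed

end

section \<open>A polynomial bound on variable indices\<close>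

fun nbound :: "nexp \<Rightarrow> nat poly" where
  "nbound (Const c) = [:c:]"
| "nbound Len = [:0, 1:]"
| "nbound (Var r) = [:0, 1:]"
| "nbound (Add a b) = nbound a + nbound b"
| "nbound (Mul a b) = nbound a * nbound b"
| "nbound (Inp a) = [:2:]"

lemma nval_le_nbound:
  "length x \<le> B \<Longrightarrow> (\<And>r. v r \<le> B) \<Longrightarrow> nval x v e \<le> poly (nbound e) B"
proof (induction e)
  case (Inp e)
  then show ?case by (auto simp: tape_of_def)
qed (auto intro: add_mono mult_mono)

text \<open>Coefficients are natural, so a sum of polynomials dominates each summand, and input
  length and loop variables are all bounded by \<open>[:0, 1:] + p + q\<close>. The leading 1 makes
  the bound strict, so its value is the index of a fresh variable.\<close>

definition var_bound :: "family list \<Rightarrow> nat poly" where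
  "var_bound fams = 1 + sum_list (map (\<lambda>(p, q, tpl).
     sum_list (map (\<lambda>(b, e). pcompose (nbound e) ([:0, 1:] + p + q)) tpl)) fams)"

lemma poly_sum_list: "poly (sum_list ps) y = sum_list (map (\<lambda>p. poly p y) ps)"
  by (induction ps) auto

lemma var_bound:
  assumes "cl \<in> set (cnf fams x)" "(b, u) \<in> set cl"
  shows "u < poly (var_bound fams) (length x)"
proof -
  let ?n = "length x"
  obtain p q tpl t i where fam: "(p, q, tpl) \<in> set fams" and ti: "t < poly p ?n" "i < poly q ?n"
    and cl: "cl = lits x (loop_env t i) tpl"
    using assms(1) by (fastforce simp: cnf_def family_clauses_def)
  obtain e where e: "(b, e) \<in> set tpl" "u = nval x (loop_env t i) e"
    using assms(2) unfolding cl lits_def by auto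
  let ?f = "\<lambda>(b :: bool, e). pcompose (nbound e) ([:0, 1:] + p + q)"
  have "u \<le> poly (nbound e) (?n + poly p ?n + poly q ?n)"
    unfolding e(2) using ti by (intro nval_le_nbound) (auto simp: loop_env_def)
  also have "\<dots> = poly (?f (b, e)) ?n" by (simp add: poly_pcompose add.assoc)
  also have "\<dots> \<le> sum_list (map (\<lambda>p. poly p ?n) (map ?f tpl))"
    using e(1) by (intro member_le_sum_list) (force, simp)
  also have "\<dots> = poly (sum_list (map ?f tpl)) ?n" by (simp only: poly_sum_list)
  also have "\<dots> \<le> sum_list (map (\<lambda>p. poly p ?n) (map (\<lambda>(p, q, tpl).
     sum_list (map (\<lambda>(b, e). pcompose (nbound e) ([:0, 1:] + p + q)) tpl)) fams))"
    using fam by (intro member_le_sum_list) (force, simp)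
  also have "\<dots> < poly (var_bound fams) ?n" by (simp only: poly_sum_list[symmetric] var_bound_def) simp
  finally show ?thesis .
qed

theorem uniform_cnf_reducible:
  assumes closed: "closed fams"
    and correct: "\<And>x. x \<in> L \<longleftrightarrow> cnf_sat (cnf fams x)"
  shows "turing_reducible L ILMTP_SD"
proof -
  define F where "F = var_bound fams"
  have vars: "u < poly F (length x)" if "cl \<in> set (cnf fams x)" "(b, u) \<in> set cl" for x cl b u
    unfolding F_def using that by (rule var_bound)
  \<comment> \<open>Strictly above the length of every template, so that padding always adds the
    fresh literal, and at least 2 for the slack count \<open>m - 2\<close>.\<close>
  define m where "m = 2 + sum_list (map (\<lambda>(p, q, tpl). length tpl) fams)"
  \<comment> \<open>Padding the templates rather than the clauses keeps the formula a uniform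
    family, since the fresh index is itself an expression.\<close>
  define fams' where "fams' = map (\<lambda>(p, q, tpl). (p, q, pad m (True, npoly F) tpl)) fams"
  have m: "2 \<le> m" by (simp add: m_def)
  have len: "length tpl < m" if "(p, q, tpl) \<in> set fams" for p q tpl
  proof -
    have "length tpl \<in> set (map (\<lambda>(p, q, tpl). length tpl) fams)" using that by force
    then show ?thesis using member_le_sum_list by (fastforce simp: m_def)
  qed
  have family: "set (family_clauses x (p, q, tpl)) = {lits x (loop_env t i) tpl |t i. t < poly p (length x) \<and> i < poly q (length x)}"
    for x p q tpl
    by (auto simp: family_clauses_def) blast
  have cnf_len: "length cl < m" if "cl \<in> set (cnf fams x)" for x cl
    using that len by (auto simp: cnf_def family lits_def split_paired_all)
  have cnf': "cnf fams' x = map (pad m (True, poly F (length x))) (cnf fams x)" for x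
  proof -
    have "lits x v (pad m (True, npoly F) tpl) = pad m (True, poly F (length x)) (lits x v tpl)" for v tpl
      by (simp add: lits_def pad_def)
    then have "family_clauses x (p, q, pad m (True, npoly F) tpl) =
        map (pad m (True, poly F (length x))) (family_clauses x (p, q, tpl))" for p q tpl
      by (simp add: family_clauses_def map_concat comp_def)
    then show ?thesis by (simp add: cnf_def fams'_def map_concat comp_def case_prod_unfold)
  qed
  have closed': "closed fams'"
    using closed by (fastforce simp: closed_def fams'_def pad_def)
  have len': "length cl = m" if "cl \<in> set (cnf fams' x)" for x cl
    using that cnf_len by (auto simp: cnf' pad_def less_imp_le)
  have vars': "u < poly (F + 1) (length x)" if "cl \<in> set (cnf fams' x)" "(b, u) \<in> set cl" for x cl b u
    using that vars[of _ x b u] by (auto simp: cnf' pad_def less_Suc_eq split: if_splits)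
  let ?I = "\<lambda>x. partition_instance
     (map (item_number (cnf fams' x) (poly (F + 1) (length x)) m) (items (cnf fams' x) (poly (F + 1) (length x)) m))
     (target (cnf fams' x) (poly (F + 1) (length x)) m)"
  show ?thesis
  proof (rule turing_reducible_by_printer[where I = ?I])
    show "wf_pr 3 {} (instance_pr m fams' F)" using closed' by (rule wf_instance_pr)
    show "out x (\<lambda>_. 0) (instance_pr m fams' F) = encode_instance ILMTP_SD (?I x)" for x
      using out_instance_pr[OF closed' m len' vars'] by (simp add: ILMTP_SD_def)
    show "?I x \<in> instances ILMTP_SD" for x
      using ilmtp_instance_partition by (simp add: ILMTP_SD_def items_def)
    show "x \<in> L \<longleftrightarrow> solutions ILMTP_SD (?I x) \<noteq> {}" for x
    proof -
      have "x \<in> L \<longleftrightarrow> nae_sat (cnf fams' x)"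
        unfolding correct cnf' using nae_sat_pad[of "cnf fams x" m "poly F (length x)"] cnf_len vars by blast
      also have "\<dots> \<longleftrightarrow> (\<exists>gs. feasible (?I x) gs)"
        by (rule nae_sat_iff_feasible[OF m len' vars'])
      finally show ?thesis by (simp add: ILMTP_SD_def)
    qed
  qed
qed

definition family_holds :: "bool list \<Rightarrow> (nat \<Rightarrow> bool) \<Rightarrow> family \<Rightarrow> bool" where
  "family_holds x \<phi> = (\<lambda>(p, q, tpl). \<forall>t<poly p (length x). \<forall>i<poly q (length x).
     \<exists>(b, e)\<in>set tpl. \<phi> (nval x (loop_env t i) e) = b)"

lemma cnf_sat_iff: "cnf_sat (cnf fams x) \<longleftrightarrow> (\<exists>\<phi>. \<forall>fam\<in>set fams. family_holds x \<phi> fam)"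
proof -
  have "(\<forall>cl\<in>set (family_clauses x fam). \<exists>(b, u)\<in>set cl. \<phi> u = b) \<longleftrightarrow> family_holds x \<phi> fam" for fam \<phi>
    by (cases fam) (auto simp: family_clauses_def family_holds_def lits_def case_prod_unfold)
  then show ?thesis by (simp add: cnf_sat_def cnf_def)
qed

section \<open>The computation of a verifier as a uniform family of clauses\<close>

text \<open>Halting is turned into idling, so that acceptance can be read off at one fixed time.\<close>

fun next_action :: "nat \<Rightarrow> nat list \<Rightarrow> action \<Rightarrow> nat \<times> (nat \<times> move) list" where
  "next_action st rs (Step q as) = (q, as)"
| "next_action st rs (Query q) = (st, keep rs)"
| "next_action st rs (Halt b) = (st, keep rs)"

text \<open>Positions are shifted by one so that they stay natural numbers.\<close>

fun shift :: "move \<Rightarrow> nat" where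
  "shift MoveL = 2"
| "shift Stay = 1"
| "shift MoveR = 0"

lemma int_shift: "int (shift m) = 1 - offset m"
  by (cases m) auto

lemma shift_le: "shift m \<le> 2"
  by (cases m) auto

text \<open>Cells are addressed relative to the head, which always sits at position \<open>W\<close>; thus the
  tableau need not record head positions.\<close>

definition cell :: "nat \<Rightarrow> tape list \<Rightarrow> nat \<Rightarrow> nat \<Rightarrow> nat" where
  "cell W ts k i = fst (ts ! k) (snd (ts ! k) + int i - int W)"

text \<open>In coordinates relative to the head, a move shifts the whole tape: the content of
  \<open>a + 1\<close> reappears at \<open>a + shift m\<close>, because
  \<open>shift m = 1 - offset m\<close>. The case \<open>a = B\<close> is the cell \<open>W\<close>
  under the head.\<close>

lemma cell_write:
  assumes "k < length ts" "length as = length ts" "W = Suc B"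
  shows "cell W (map2 write_move as ts) k (a + shift (snd (as ! k))) =
     (if a = B then fst (as ! k) else cell W ts k (a + 1))"
  using assms by (auto simp: cell_def write_move_def int_shift)

locale verifier =
  fixes M :: machine and p q :: "nat poly"
  assumes machine: "turing_machine M" and no_query: "oracle_free M"
begin

abbreviation "K \<equiv> num_tapes M"
abbreviation "G \<equiv> num_symbols M"
abbreviation "N \<equiv> length (program M)"

definition act :: "nat \<Rightarrow> nat list \<Rightarrow> nat \<times> (nat \<times> move) list" where
  "act st rs = next_action st rs ((program M ! st) rs)"

definition good :: "config \<Rightarrow> bool" where
  "good c \<longleftrightarrow> fst c < N \<and> length (snd c) = K \<and> (\<forall>t\<in>set (snd c). range (fst t) \<subseteq> {..<G})"

lemma K_ge: "2 \<le> K" and G_ge: "3 \<le> G" and N_pos: "0 < N"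
  using machine by (auto simp: turing_machine_def)

lemma act_ok:
  assumes "st < N" "rs \<in> read_lists M"
  shows "fst (act st rs) < N" "length (snd (act st rs)) = K" "fst ` set (snd (act st rs)) \<subseteq> {..<G}"
proof -
  have ok: "action_ok M ((program M ! st) rs)"
    using machine assms unfolding turing_machine_def by (auto intro: nth_mem)
  have rs: "length rs = K" "set rs \<subseteq> {..<G}" using assms by (auto simp: read_lists_def)
  have "fst (act st rs) < N \<and> length (snd (act st rs)) = K \<and> fst ` set (snd (act st rs)) \<subseteq> {..<G}"
    using ok assms(1) rs unfolding act_def
    by (cases "(program M ! st) rs") (auto simp: keep_def)
  then show "fst (act st rs) < N" "length (snd (act st rs)) = K" "fst ` set (snd (act st rs)) \<subseteq> {..<G}"
    by blast+
qed

lemma reads_good: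
  assumes "good c"
  shows "reads (snd c) \<in> read_lists M"
proof -
  have "fst t z < G" if "t \<in> set (snd c)" for t z
    using assms that unfolding good_def by blast
  then show ?thesis using assms by (auto simp: good_def read_lists_def reads_def)
qed

lemma nth_reads: "k < length ts \<Longrightarrow> reads ts ! k = cell W ts k W"
  by (simp add: reads_def cell_def case_prod_unfold)

lemma step_act:
  assumes "good c"
  shows "step orc M c = (fst (act (fst c) (reads (snd c))), map2 write_move (snd (act (fst c) (reads (snd c)))) (snd c))"
proof -
  have "program M ! fst c \<in> set (program M)" using assms by (simp add: good_def)
  then have "\<forall>r. (program M ! fst c) (reads (snd c)) \<noteq> Query r"
    using no_query reads_good[OF assms] unfolding oracle_free_def by blast
  moreover have "current_action M c = (program M ! fst c) (reads (snd c))"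
    by (simp add: current_action_def reads_def)
  ultimately show ?thesis
    by (cases "(program M ! fst c) (reads (snd c))") (simp_all add: step_def act_def)
qed

lemma good_step:
  assumes "good c"
  shows "good (step orc M c)"
proof -
  let ?a = "act (fst c) (reads (snd c))"
  note ok = act_ok[OF _ reads_good[OF assms], of "fst c"]
  have len: "length (snd c) = K" "fst c < N" using assms by (auto simp: good_def)
  have "fst (write_move b t) z < G" if "b \<in> set (snd ?a)" "t \<in> set (snd c)" for b t z
  proof -
    have "fst b < G" using ok(3) len that(1) by auto
    moreover have "fst t z < G" for z using assms that(2) unfolding good_def by blast
    ultimately show ?thesis by (auto simp: write_move_def)
  qed
  then have "range (fst t') \<subseteq> {..<G}" if t': "t' \<in> set (map2 write_move (snd ?a) (snd c))" for t'
  proof -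
    obtain b t where "(b, t) \<in> set (zip (snd ?a) (snd c))" "t' = write_move b t" using t' by auto
    then show ?thesis using \<open>\<And>b t z. b \<in> set (snd ?a) \<Longrightarrow> t \<in> set (snd c) \<Longrightarrow> fst (write_move b t) z < G\<close>[of b t]
      by (blast dest: set_zip_leftD set_zip_rightD)
  qed
  then show ?thesis unfolding step_act[OF assms] good_def
    using ok(1,2) len by simp
qed

lemma good_initial: "good (initial M x y)"
  using K_ge G_ge N_pos by (auto simp: good_def initial_def tape_of_def)

abbreviation cfg :: "bool list \<Rightarrow> bool list \<Rightarrow> nat \<Rightarrow> config" where
  "cfg x y t \<equiv> (step (\<lambda>_. []) M ^^ t) (initial M x y)"

lemma good_cfg: "good (cfg x y t)"
  by (induction t) (auto intro: good_initial good_step)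

lemma halted: "current_action M c = Halt b \<Longrightarrow> (step orc M ^^ t) c = c"
  by (induction t) (auto simp: step_def)

section \<open>The clause families of a verifier\<close>

text \<open>\<open>Tp\<close> bounds the time for every certificate of length at most
  \<open>q\<close>. The head stands in the middle of a window of \<open>Rp\<close> cells, with
  \<open>Wp\<close> cells on either side; this exceeds the input length, \<open>q\<close> and
  \<open>Tp\<close> together.\<close>

definition Tp :: "nat poly" where "Tp = pcompose p ([:0, 1:] + q)"
definition Bp :: "nat poly" where "Bp = [:0, 1:] + q + Tp + 1"
definition Wp :: "nat poly" where "Wp = Bp + 1"
definition Rp :: "nat poly" where "Rp = 2 * Wp + 1"

text \<open>A mixed radix number with digits \<open>t\<close>, \<open>i\<close> and
  \<open>a\<close>. The last digit is \<open>k * G + s\<close> for symbol \<open>s\<close> on tape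
  \<open>k\<close>, or \<open>K * G + st\<close> for a state, which is filed under
  \<open>i = 0\<close>.\<close>

definition var :: "nat \<Rightarrow> nat \<Rightarrow> nat \<Rightarrow> nat \<Rightarrow> nat" where
  "var R t i a = (t * R + i) * (K * G + N) + a"

definition varE :: "nexp \<Rightarrow> nexp \<Rightarrow> nexp \<Rightarrow> nexp" where
  "varE t i a = Add (Mul (Add (Mul t (npoly Rp)) i) (Const (K * G + N))) a"

lemma nval_varE [simp]:
  "nval x v (varE t i a) = var (poly Rp (length x)) (nval x v t) (nval x v i) (nval x v a)"
  by (simp add: varE_def var_def)

lemma nvars_varE [simp]: "nvars (varE t i a) = nvars t \<union> nvars i \<union> nvars a"
  by (auto simp: varE_def)

definition stE :: "nexp \<Rightarrow> nat \<Rightarrow> nexp" where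
  "stE t st = varE t (Const 0) (Const (K * G + st))"

definition cellE :: "nexp \<Rightarrow> nat \<Rightarrow> nexp \<Rightarrow> nat \<Rightarrow> nexp" where
  "cellE t k i s = varE t i (Const (k * G + s))"

definition pre :: "nexp \<Rightarrow> nat \<Rightarrow> nat list \<Rightarrow> (bool \<times> nexp) list" where
  "pre t st rs = (False, stE t st) # map (\<lambda>k. (False, cellE t k (npoly Wp) (rs ! k))) [0..<K]"

text \<open>\<open>pre\<close> contributes the negated premises, so each clause is an implication.
  The copied cells \<open>i + 1\<close> range over those left of the head except cell 0, and
  \<open>Wp + i + 1\<close> over those right of it except the last; the outermost cells may leave
  the window or lack a known neighbour.\<close>

definition trans_fams :: "nat \<Rightarrow> nat list \<Rightarrow> family list" where
  "trans_fams st rs = (let (st', as) = act st rs; t = Var 1; t' = Add (Var 1) (Const 1); i = Var 2 in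
     (Tp, 1, pre t st rs @ [(True, stE t' st')]) #
     concat (map (\<lambda>k.
       (Tp, 1, pre t st rs @ [(True, cellE t' k (Add (npoly Bp) (Const (shift (snd (as ! k))))) (fst (as ! k)))]) #
       concat (map (\<lambda>s.
         [(Tp, Bp, pre t st rs @ [(False, cellE t k (Add i (Const 1)) s),
             (True, cellE t' k (Add i (Const (shift (snd (as ! k))))) s)]),
          (Tp, Bp, pre t st rs @ [(False, cellE t k (Add (Add (npoly Wp) i) (Const 1)) s),
             (True, cellE t' k (Add (Add (npoly Wp) i) (Const (shift (snd (as ! k))))) s)])])
         [0..<G])) [0..<K]))"

text \<open>Acceptance is stated negatively: at time \<open>Tp\<close> no combination of state and
  read symbols may be present unless it accepts.\<close>

definition reject_fams :: "nat \<Rightarrow> nat list \<Rightarrow> family list" where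
  "reject_fams st rs = (if (program M ! st) rs = Halt True then [] else [(1, 1, pre (npoly Tp) st rs)])"

text \<open>The input symbol \<open>Inp i\<close> serves as part of the variable index, which writes
  the input into the formula. The first \<open>q\<close> cells of the certificate are free up to the
  rule that a blank is followed by a blank. Its remaining \<open>3 + length x + Tp\<close> cells are
  blank and end exactly at the last cell \<open>2 * Wp\<close> of the window.\<close>

definition init_fams :: "family list" where
  "init_fams = (let t = Const 0; i = Var 2; w = Add (npoly Wp) (Var 2) in
     [(1, 1, [(True, stE t 0)]),
      (1, Wp, [(True, cellE t 0 i 0)]),
      (1, Wp + 1, [(True, varE t w (Inp i))]),
      (1, Wp, [(True, cellE t 1 i 0)]),
      (1, q, [(True, cellE t 1 w 0), (True, cellE t 1 w 1), (True, cellE t 1 w 2)]),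
      (1, q, [(False, cellE t 1 w 0), (True, cellE t 1 (Add w (Const 1)) 0)]),
      (1, [:3, 1:] + Tp, [(True, cellE t 1 (Add w (npoly q)) 0)])] @
     map (\<lambda>k. (1, Rp, [(True, cellE t k i 0)])) [2..<K])"

definition fams :: "family list" where
  "fams = concat (map (\<lambda>st. concat (map (\<lambda>rs. trans_fams st rs @ reject_fams st rs) (List.n_lists K [0..<G])))
     [0..<N]) @ init_fams"

lemma closed_fams: "closed fams"
proof -
  have pre: "(b, e) \<in> set (pre (Var (Suc 0)) st rs) \<Longrightarrow> r \<in> nvars e \<Longrightarrow> r = Suc 0"
    "(b, e) \<in> set (pre (npoly Tp) st rs) \<Longrightarrow> r \<in> nvars e \<Longrightarrow> False" for b e st rs r
    by (auto simp: pre_def stE_def cellE_def)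
  have "\<forall>(b, e)\<in>set tpl. nvars e \<subseteq> {1, 2}" if "(a, c, tpl) \<in> set (trans_fams st rs)" for a c tpl st rs
    using that by (auto simp: trans_fams_def Let_def case_prod_unfold stE_def cellE_def dest: pre)
  moreover have "\<forall>(b, e)\<in>set tpl. nvars e \<subseteq> {1, 2}" if "(a, c, tpl) \<in> set (reject_fams st rs)" for a c tpl st rs
    using that by (auto simp: reject_fams_def dest: pre split: if_splits)
  moreover have "\<forall>(b, e)\<in>set tpl. nvars e \<subseteq> {1, 2}" if "(a, c, tpl) \<in> set init_fams" for a c tpl
    using that by (auto simp: init_fams_def Let_def stE_def cellE_def)
  ultimately show ?thesis by (fastforce simp: closed_def fams_def)
qed

section \<open>The clauses read as a tableau\<close>

definition T :: "bool list \<Rightarrow> nat" where "T x = poly Tp (length x)"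
definition Q :: "bool list \<Rightarrow> nat" where "Q x = poly q (length x)"
definition B :: "bool list \<Rightarrow> nat" where "B x = length x + Q x + T x + 1"
definition W :: "bool list \<Rightarrow> nat" where "W x = Suc (B x)"
definition R :: "bool list \<Rightarrow> nat" where "R x = 2 * W x + 1"

lemma poly_simps [simp]:
  "poly Tp (length x) = T x" "poly q (length x) = Q x" "poly Bp (length x) = B x"
  "poly Wp (length x) = W x" "poly Rp (length x) = R x"
  by (simp_all add: T_def Q_def B_def W_def R_def Bp_def Wp_def Rp_def)

lemma T_eq: "T x = poly p (length x + Q x)"
  by (simp add: T_def Tp_def poly_pcompose)

text \<open>\<open>S t st\<close> and \<open>C t k i s\<close> express that at time \<open>t\<close> the state is \<open>st\<close> and the symbol in
  cell \<open>i\<close> of tape \<open>k\<close> is \<open>s\<close>.\<close>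

definition premise :: "bool list \<Rightarrow> (nat \<Rightarrow> nat \<Rightarrow> bool) \<Rightarrow> (nat \<Rightarrow> nat \<Rightarrow> nat \<Rightarrow> nat \<Rightarrow> bool) \<Rightarrow>
    nat \<Rightarrow> nat \<Rightarrow> nat list \<Rightarrow> bool" where
  "premise x S C t st rs \<longleftrightarrow> S t st \<and> (\<forall>k<K. C t k (W x) (rs ! k))"

text \<open>The content of \<open>trans_fams\<close>, kept in the shape of its clauses so that
  \<open>trans_fams_iff\<close> is mere rewriting.\<close>

definition tableau_step where
  "tableau_step x S C st rs \<longleftrightarrow> (let (st', as) = act st rs in
     (\<forall>t<T x. premise x S C t st rs \<longrightarrow> S (t + 1) st') \<and>
     (\<forall>k<K.
       (\<forall>t<T x. premise x S C t st rs \<longrightarrow> C (t + 1) k (B x + shift (snd (as ! k))) (fst (as ! k))) \<and>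
       (\<forall>s<G.
         (\<forall>t<T x. \<forall>i<B x. premise x S C t st rs \<longrightarrow> \<not> C t k (i + 1) s \<or>
            C (t + 1) k (i + shift (snd (as ! k))) s) \<and>
         (\<forall>t<T x. \<forall>i<B x. premise x S C t st rs \<longrightarrow> \<not> C t k (W x + i + 1) s \<or>
            C (t + 1) k (W x + i + shift (snd (as ! k))) s))))"

definition tableau_init where
  "tableau_init x S C \<longleftrightarrow> S 0 0 \<and>
     (\<forall>i<W x. C 0 0 i 0) \<and>
     (\<forall>i<W x + 1. C 0 0 (W x + i) (fst (tape_of x) (int i))) \<and>
     (\<forall>i<W x. C 0 1 i 0) \<and>
     (\<forall>i<Q x. C 0 1 (W x + i) 0 \<or> C 0 1 (W x + i) 1 \<or> C 0 1 (W x + i) 2) \<and>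
     (\<forall>i<Q x. \<not> C 0 1 (W x + i) 0 \<or> C 0 1 (W x + i + 1) 0) \<and>
     (\<forall>i<3 + length x + T x. C 0 1 (W x + i + Q x) 0) \<and>
     (\<forall>k\<in>{2..<K}. \<forall>i<R x. C 0 k i 0)"

definition state_of :: "bool list \<Rightarrow> (nat \<Rightarrow> bool) \<Rightarrow> nat \<Rightarrow> nat \<Rightarrow> bool" where
  "state_of x \<phi> t st = \<phi> (var (R x) t 0 (K * G + st))"

definition cell_of :: "bool list \<Rightarrow> (nat \<Rightarrow> bool) \<Rightarrow> nat \<Rightarrow> nat \<Rightarrow> nat \<Rightarrow> nat \<Rightarrow> bool" where
  "cell_of x \<phi> t k i s = \<phi> (var (R x) t i (k * G + s))"

lemma loop_env_simps [simp]: "loop_env t i (Suc 0) = t" "loop_env t i 1 = t" "loop_env t i 2 = i"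
  by (simp_all add: loop_env_def)

lemma ball_upt: "(\<forall>k\<in>{0..<n::nat}. P k) \<longleftrightarrow> (\<forall>k<n. P k)"
  by auto

lemma bex_upt: "(\<exists>k\<in>{0..<n::nat}. P k) \<longleftrightarrow> (\<exists>k<n. P k)"
  by auto

lemma family_holds_simp:
  "family_holds x \<phi> (a, c, tpl) \<longleftrightarrow> (\<forall>t<poly a (length x). \<forall>i<poly c (length x).
     \<exists>(b, e)\<in>set tpl. \<phi> (nval x (loop_env t i) e) = b)"
  by (simp add: family_holds_def)

lemma pre_holds:
  "(\<exists>(b, e)\<in>set (pre t st rs). \<phi> (nval x v e) = b) \<longleftrightarrow>
   \<not> premise x (state_of x \<phi>) (cell_of x \<phi>) (nval x v t) st rs"
  by (simp add: pre_def premise_def stE_def cellE_def state_of_def cell_of_def bex_upt)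

lemma trans_fams_iff:
  "(\<forall>fam\<in>set (trans_fams st rs). family_holds x \<phi> fam) \<longleftrightarrow>
   tableau_step x (state_of x \<phi>) (cell_of x \<phi>) st rs"
proof -
  let ?P = "\<lambda>t. premise x (state_of x \<phi>) (cell_of x \<phi>) t st rs"
  have tpl: "(\<exists>l\<in>set (pre t st rs @ tpl). (case l of (b, e) \<Rightarrow> \<phi> (nval x v e) = b)) \<longleftrightarrow>
      (?P (nval x v t) \<longrightarrow> (\<exists>l\<in>set tpl. (case l of (b, e) \<Rightarrow> \<phi> (nval x v e) = b)))" for t v tpl
    unfolding set_append bex_Un pre_holds by blast
  obtain st' as where act: "act st rs = (st', as)" by fastforce
  show ?thesis
    unfolding trans_fams_def tableau_step_def act Let_def prod.case
    by (simp only: list.set ball_simps set_concat ball_UN set_map set_upt ball_upt family_holds_simp tpl nval.simps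
       loop_env_simps poly_1 less_one prod.case bex_simps nval_varE poly_simps stE_def cellE_def state_of_def cell_of_def simp_thms nval_npoly)
qed

lemma reject_fams_iff:
  "(\<forall>fam\<in>set (reject_fams st rs). family_holds x \<phi> fam) \<longleftrightarrow>
   ((program M ! st) rs \<noteq> Halt True \<longrightarrow> \<not> premise x (state_of x \<phi>) (cell_of x \<phi>) (T x) st rs)"
  by (simp add: reject_fams_def family_holds_simp pre_holds)

lemma init_fams_iff:
  "(\<forall>fam\<in>set init_fams. family_holds x \<phi> fam) \<longleftrightarrow> tableau_init x (state_of x \<phi>) (cell_of x \<phi>)"
  unfolding init_fams_def tableau_init_def Let_def
  by (simp only: list.set set_append ball_Un ball_simps set_map set_upt family_holds_simp nval.simps
       loop_env_simps poly_1 less_one prod.case bex_simps nval_varE poly_simps stE_def cellE_def state_of_def cell_of_def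
       simp_thms nval_npoly poly_add poly_pCons mult_0_right mult_1_right mult_0 add_0_left poly_0)
    (simp add: loop_env_def)

lemma cnf_sat_tableau:
  "cnf_sat (cnf fams x) \<longleftrightarrow> (\<exists>\<phi>. (\<forall>st<N. \<forall>rs\<in>read_lists M. tableau_step x (state_of x \<phi>) (cell_of x \<phi>) st rs \<and>
       ((program M ! st) rs \<noteq> Halt True \<longrightarrow> \<not> premise x (state_of x \<phi>) (cell_of x \<phi>) (T x) st rs)) \<and>
     tableau_init x (state_of x \<phi>) (cell_of x \<phi>))"
proof -
  have reads: "set (List.n_lists K [0..<G]) = read_lists M"
    by (auto simp: set_n_lists read_lists_def atLeast0LessThan)
  show ?thesis
    unfolding cnf_sat_iff fams_def
    by (simp only: set_append ball_Un init_fams_iff set_concat set_map ball_UN ball_simps set_upt ball_upt reads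
      trans_fams_iff reject_fams_iff)
qed

lemma cell_step:
  assumes "good c" "k < K"
  shows "cell (W x) (snd (step orc M c)) k (a + shift (snd (snd (act (fst c) (reads (snd c))) ! k))) =
     (if a = B x then fst (snd (act (fst c) (reads (snd c))) ! k) else cell (W x) (snd c) k (a + 1))"
proof -
  have "fst c < N" "length (snd c) = K" using assms(1) by (auto simp: good_def)
  then show ?thesis unfolding step_act[OF assms(1)]
    using act_ok(2)[OF _ reads_good[OF assms(1)]] assms(2) by (simp add: cell_write W_def)
qed

lemma cell_initial:
  assumes "k < K"
  shows "cell w (snd (initial M x y)) k i =
     (if k = 0 then fst (tape_of x) (int i - int w)
      else if k = 1 then fst (tape_of y) (int i - int w) else 0)"
proof (cases "k < 2")
  case True
  then have "k = 0 \<or> k = 1" by auto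
  then show ?thesis by (auto simp: initial_def cell_def tape_of_def)
next
  case False
  then obtain k' where "k = Suc (Suc k')" by (metis add_2_eq_Suc le_add_diff_inverse not_less)
  then show ?thesis using assms by (simp add: initial_def cell_def tape_of_def)
qed

lemma tape_of_neg: "z < 0 \<Longrightarrow> fst (tape_of w) z = 0"
  by (simp add: tape_of_def)

lemma tape_of_nat: "fst (tape_of w) (int i) = (if i < length w then if w ! i then 2 else 1 else 0)"
  by (simp add: tape_of_def)

text \<open>No clause forbids several states or several symbols in a cell. It is enough that the
  facts of the true run are forced step by step: at the end the rejection clause for the true state
  and read symbols would be violated unless the run accepts.\<close>

lemma tableau_sound:
  assumes step: "\<And>st rs. st < N \<Longrightarrow> rs \<in> read_lists M \<Longrightarrow> tableau_step x S C st rs"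
    and reject: "\<And>st rs. st < N \<Longrightarrow> rs \<in> read_lists M \<Longrightarrow> (program M ! st) rs \<noteq> Halt True \<Longrightarrow>
       \<not> premise x S C (T x) st rs"
    and init: "tableau_init x S C"
  shows "\<exists>y. length y \<le> Q x \<and> current_action M (cfg x y (T x)) = Halt True"
proof -
  have S0: "S 0 0"
    and c0: "\<And>i. i < W x \<Longrightarrow> C 0 0 i 0"
    and c0': "\<And>i. i < W x + 1 \<Longrightarrow> C 0 0 (W x + i) (fst (tape_of x) (int i))"
    and c1: "\<And>i. i < W x \<Longrightarrow> C 0 1 i 0"
    and c1_bit: "\<And>i. i < Q x \<Longrightarrow> C 0 1 (W x + i) 0 \<or> C 0 1 (W x + i) 1 \<or> C 0 1 (W x + i) 2"
    and c1_next: "\<And>i. i < Q x \<Longrightarrow> C 0 1 (W x + i) 0 \<Longrightarrow> C 0 1 (W x + i + 1) 0"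
    and c1_rest: "\<And>i. i < 3 + length x + T x \<Longrightarrow> C 0 1 (W x + i + Q x) 0"
    and ck: "\<And>k i. k \<in> {2..<K} \<Longrightarrow> i < R x \<Longrightarrow> C 0 k i 0"
    using init unfolding tableau_init_def by blast+
  \<comment> \<open>The length of the certificate: the first cell marked blank, capped at
    \<open>Q x\<close>.\<close>
  define m where "m = (LEAST i. i = Q x \<or> C 0 1 (W x + i) 0)"
  have m: "m = Q x \<or> C 0 1 (W x + m) 0" unfolding m_def by (rule LeastI[of _ "Q x"]) simp
  have m_le: "m \<le> Q x" unfolding m_def by (rule Least_le) simp
  have before: "i \<noteq> Q x \<and> \<not> C 0 1 (W x + i) 0" if "i < m" for i
    using not_less_Least[OF that[unfolded m_def]] by simp
  \<comment> \<open>A cell may be marked with both bits; then \<open>True\<close> is chosen, and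
    \<open>bits\<close> needs only that the chosen mark is present.\<close>
  define y where "y = map (\<lambda>i. C 0 1 (W x + i) 2) [0..<m]"
  have bits: "C 0 1 (W x + i) (if y ! i then 2 else 1)" if "i < m" for i
  proof -
    have "C 0 1 (W x + i) 1 \<or> C 0 1 (W x + i) 2"
      using before[OF that] c1_bit[of i] that m_le by auto
    then show ?thesis using that by (auto simp: y_def)
  qed
  have beyond: "C 0 1 (W x + i) 0" if "Q x \<le> i" "i < W x + 1" for i
  proof -
    have "i - Q x < 3 + length x + T x" using that by (simp add: W_def B_def)
    then have "C 0 1 (W x + (i - Q x) + Q x) 0" by (rule c1_rest)
    then show ?thesis using that by (simp add: add.assoc)
  qed
  have blank: "C 0 1 (W x + i) 0" if "m \<le> i" "i \<le> Q x" for i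
    using that
  proof (induction i rule: dec_induct)
    case base
    then show ?case using m beyond[of m] by (auto simp: W_def B_def)
  next
    case (step i)
    then have "C 0 1 (W x + i) 0" "i < Q x" by auto
    then have "C 0 1 (W x + i + 1) 0" using c1_next by blast
    then show ?case by simp
  qed
  have initial: "C 0 k i (cell (W x) (snd (initial M x y)) k i)" if "k < K" "i < R x" for k i
  proof (cases "i < W x")
    case True
    have "k = 0 \<or> k = 1 \<or> k \<in> {2..<K}" using that(1) by auto
    then show ?thesis using c0[OF True] c1[OF True] ck[of k i] that(2) True
      by (auto simp: cell_initial[OF that(1)] tape_of_neg)
  next
    case False
    then obtain j where j: "i = W x + j" by (metis le_add_diff_inverse not_less)
    have jW: "j < W x + 1" using that(2) unfolding j R_def by simp
    have y: "C 0 1 (W x + j) (fst (tape_of y) (int j))"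
    proof (cases "j < m")
      case True
      then show ?thesis using bits[of j] by (simp add: tape_of_nat y_def)
    next
      case False
      then have "C 0 1 (W x + j) 0" using blank[of j] beyond[of j] jW by (cases "j \<le> Q x") simp_all
      then show ?thesis using False by (simp add: tape_of_nat y_def)
    qed
    have "k = 0 \<or> k = 1 \<or> k \<in> {2..<K}" using that(1) by auto
    then show ?thesis using c0'[OF jW] y ck[of k i] that(2) unfolding j
      by (auto simp: cell_initial[OF that(1)])
  qed
  \<comment> \<open>The reliable part of the window loses one cell at each end per step, since
    nothing is known about cells shifted in from outside. It still contains the head cell at time
    \<open>T x\<close>, as \<open>T x + 1 \<le> W x\<close>.\<close>
  have inv: "S t (fst (cfg x y t)) \<and>
      (\<forall>k<K. \<forall>i. t + 1 \<le> i \<longrightarrow> i + t + 1 \<le> 2 * W x \<longrightarrow> C t k i (cell (W x) (snd (cfg x y t)) k i))"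
    if "t \<le> T x" for t
    using that
  proof (induction t)
    case 0
    show ?case using S0 initial by (auto simp: initial_def R_def)
  next
    case (Suc t)
    let ?c = "cfg x y t"
    let ?a = "act (fst ?c) (reads (snd ?c))"
    have good: "good ?c" by (rule good_cfg)
    have st: "fst ?c < N" and rs: "reads (snd ?c) \<in> read_lists M" and len: "length (snd ?c) = K"
      using good reads_good[OF good] by (auto simp: good_def)
    have IH: "S t (fst ?c)" "\<And>k i. k < K \<Longrightarrow> t + 1 \<le> i \<Longrightarrow> i + t + 1 \<le> 2 * W x \<Longrightarrow> C t k i (cell (W x) (snd ?c) k i)"
      using Suc by auto
    have tT: "t < T x" using Suc.prems by simp
    then have tW: "t + 1 \<le> W x" by (simp add: W_def B_def)
    have premise: "premise x S C t (fst ?c) (reads (snd ?c))"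
      using IH tW by (auto simp: premise_def nth_reads[of _ _ "W x"] len)
    obtain st' as where a: "?a = (st', as)" by (cases ?a)
    note tab = step[OF st rs, unfolded tableau_step_def a Let_def prod.case]
    have S': "S (Suc t) st'" using tab tT premise by simp
    have written: "C (t + 1) k (B x + shift (snd (as ! k))) (fst (as ! k))" if "k < K" for k
      using conjunct2[OF tab, rule_format, OF that] tT premise by simp
    have left: "C (t + 1) k (i + shift (snd (as ! k))) s"
      if "k < K" "s < G" "i < B x" "C t k (i + 1) s" for k s i
      using conjunct2[OF conjunct2[OF tab, rule_format, OF that(1)], rule_format, OF that(2)] tT premise that(3,4)
      by simp
    have right: "C (t + 1) k (W x + i + shift (snd (as ! k))) s"
      if "k < K" "s < G" "i < B x" "C t k (W x + i + 1) s" for k s i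
      using conjunct2[OF conjunct2[OF tab, rule_format, OF that(1)], rule_format, OF that(2)] tT premise that(3,4)
      by simp
    have "C (Suc t) k i (cell (W x) (snd (step (\<lambda>_. []) M ?c)) k i)"
      if k: "k < K" and i: "Suc t + 1 \<le> i" "i + Suc t + 1 \<le> 2 * W x" for k i
    proof -
      let ?sh = "shift (snd (as ! k))"
      have "?sh \<le> i" using shift_le[of "snd (as ! k)"] i by simp
      then obtain j where j: "i = j + ?sh" by (metis le_add_diff_inverse2)
      have range: "t + 1 \<le> j + 1" "j + 1 + t + 1 \<le> 2 * W x"
        using i j shift_le[of "snd (as ! k)"] by auto
      have cell: "cell (W x) (snd (step (\<lambda>_. []) M ?c)) k i =
          (if j = B x then fst (as ! k) else cell (W x) (snd ?c) k (j + 1))"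
        using cell_step[OF good k, of x "\<lambda>_. []" j] by (simp only: a snd_conv j)
      have small: "cell (W x) (snd ?c) k (j + 1) < G"
      proof -
        have "range (fst (snd ?c ! k)) \<subseteq> {..<G}"
          using good k len nth_mem[of k "snd ?c"] by (simp add: good_def)
        then show ?thesis by (auto simp: cell_def)
      qed
      consider "j = B x" | "j < B x" | "B x < j" by linarith
      then show ?thesis
      proof cases
        case 1
        then show ?thesis using written[OF k] unfolding cell unfolding j by simp
      next
        case 2
        have "C (t + 1) k (j + ?sh) (cell (W x) (snd ?c) k (j + 1))"
          by (rule left[OF k small 2 IH(2)[OF k range]])
        then show ?thesis using 2 unfolding cell unfolding j by simp
      next
        case 3
        then obtain l where l: "j = W x + l" by (metis Suc_leI W_def le_add_diff_inverse)
        have "l < B x" using range(2) unfolding l W_def by simp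
        then have "C (t + 1) k (W x + l + ?sh) (cell (W x) (snd ?c) k (j + 1))"
          using right[OF k small] IH(2)[OF k range] unfolding l by simp
        then show ?thesis using 3 unfolding cell unfolding j l by simp
      qed
    qed
    then show ?case using S' step_act[OF good, of "\<lambda>_. []"] a by simp
  qed
  let ?c = "cfg x y (T x)"
  have good: "good ?c" by (rule good_cfg)
  have len: "length (snd ?c) = K" and st: "fst ?c < N" using good by (auto simp: good_def)
  have "premise x S C (T x) (fst ?c) (reads (snd ?c))"
    using inv[of "T x"] by (auto simp: premise_def nth_reads[of _ _ "W x"] len W_def B_def)
  then have "(program M ! fst ?c) (reads (snd ?c)) = Halt True"
    using reject[OF st reads_good[OF good]] by blast
  then have "current_action M ?c = Halt True" by (simp add: current_action_def reads_def)
  moreover have "length y \<le> Q x" using m_le by (simp add: y_def)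
  ultimately show ?thesis by blast
qed

text \<open>The assignment records exactly the run on \<open>y\<close>. A premise therefore holds
  only for the actual state and read symbols, and each clause becomes a statement about one step of
  the run.\<close>

lemma tableau_complete:
  assumes y: "length y \<le> Q x" and accept: "current_action M (cfg x y (T x)) = Halt True"
  shows "\<exists>\<phi>. (\<forall>st<N. \<forall>rs\<in>read_lists M. tableau_step x (state_of x \<phi>) (cell_of x \<phi>) st rs \<and>
       ((program M ! st) rs \<noteq> Halt True \<longrightarrow> \<not> premise x (state_of x \<phi>) (cell_of x \<phi>) (T x) st rs)) \<and>
     tableau_init x (state_of x \<phi>) (cell_of x \<phi>)"
proof -
  let ?A = "K * G + N"
  \<comment> \<open>\<open>div\<close> and \<open>mod\<close> invert the numbering
    \<open>var\<close>; the decoded fact is then looked up in the run.\<close>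
  define \<phi> where "\<phi> v = (let a = v mod ?A; t = v div ?A div R x; i = v div ?A mod R x in
     if a < K * G then cell (W x) (snd (cfg x y t)) (a div G) i = a mod G
     else fst (cfg x y t) = a - K * G)" for v
  have R: "0 < R x" by (simp add: R_def)
  have decode: "var (R x) t i a mod ?A = a" "var (R x) t i a div ?A div R x = t" "var (R x) t i a div ?A mod R x = i"
    if "a < ?A" "i < R x" for t i a
  proof -
    have *: "(z * n + b) div n = z \<and> (z * n + b) mod n = b" if "b < n" for z n b :: nat
      using that by simp
    have "var (R x) t i a div ?A = t * R x + i" unfolding var_def using *[OF that(1)] by blast
    then show "var (R x) t i a div ?A div R x = t" "var (R x) t i a div ?A mod R x = i" using that(2) by simp_all
    show "var (R x) t i a mod ?A = a" unfolding var_def using *[OF that(1)] by blast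
  qed
  have S: "state_of x \<phi> t st \<longleftrightarrow> fst (cfg x y t) = st" if "st < N" for t st
    using that R by (simp add: state_of_def \<phi>_def decode)
  have C: "cell_of x \<phi> t k i s \<longleftrightarrow> cell (W x) (snd (cfg x y t)) k i = s"
    if "k < K" "i < R x" "s < G" for t k i s
  proof -
    have "k * G + s < Suc k * G" using that(3) by simp
    also have "\<dots> \<le> K * G" using that(1) by (intro mult_le_mono1) simp
    finally have "k * G + s < K * G" .
    then show ?thesis using that by (simp add: cell_of_def \<phi>_def decode)
  qed
  have W: "W x < R x" by (simp add: R_def)
  have premise: "fst (cfg x y t) = st \<and> reads (snd (cfg x y t)) = rs"
    if "premise x (state_of x \<phi>) (cell_of x \<phi>) t st rs" "st < N" "rs \<in> read_lists M" for t st rs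
  proof -
    have rs: "length rs = K" "set rs \<subseteq> {..<G}" using that(3) by (simp_all add: read_lists_def)
    have rs_G: "rs ! k < G" if "k < K" for k using subsetD[OF rs(2), of "rs ! k"] nth_mem[of k rs] rs(1) that by simp
    have len: "length (snd (cfg x y t)) = K" using good_cfg by (simp add: good_def)
    have "reads (snd (cfg x y t)) = rs"
    proof (rule nth_equalityI)
      fix k assume "k < length (reads (snd (cfg x y t)))"
      then have k: "k < K" by (simp add: len)
      then have "cell_of x \<phi> t k (W x) (rs ! k)" using that(1) by (simp add: premise_def)
      then show "reads (snd (cfg x y t)) ! k = rs ! k"
        unfolding C[OF k W rs_G[OF k]] using nth_reads[of k "snd (cfg x y t)" "W x"] k len by simp
    qed (simp add: rs len)
    moreover have "fst (cfg x y t) = st" using that(1) S[OF that(2), of t] by (simp add: premise_def)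
    ultimately show ?thesis by simp
  qed
  have "tableau_step x (state_of x \<phi>) (cell_of x \<phi>) st rs" if st: "st < N" "rs \<in> read_lists M" for st rs
  proof -
    obtain st' as where a: "act st rs = (st', as)" by fastforce
    have st': "st' < N" and as: "length as = K" "fst ` set as \<subseteq> {..<G}"
      using act_ok[OF st] unfolding a by simp_all
    have as: "fst (as ! k) < G" if "k < K" for k
      using subsetD[OF as(2), OF imageI, of "as ! k"] as(1) that by simp
    have step: "fst (cfg x y (t + 1)) = st'"
        "\<And>k j. k < K \<Longrightarrow> cell (W x) (snd (cfg x y (t + 1))) k (j + shift (snd (as ! k))) =
          (if j = B x then fst (as ! k) else cell (W x) (snd (cfg x y t)) k (j + 1))"
      if "premise x (state_of x \<phi>) (cell_of x \<phi>) t st rs" for t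
      using premise[OF that st] step_act[OF good_cfg[of t x y], of "\<lambda>_. []"]
        cell_step[OF good_cfg[of t x y], where x = x and orc = "\<lambda>_. []"] a
      by simp_all
    have "cell_of x \<phi> (t + 1) k (B x + shift (snd (as ! k))) (fst (as ! k))"
      if "premise x (state_of x \<phi>) (cell_of x \<phi>) t st rs" "k < K" for t k
      using step(2)[OF that(1,2), of "B x"] that(2) as shift_le[of "snd (as ! k)"]
      by (subst C) (simp_all add: R_def W_def)
    moreover have "\<not> cell_of x \<phi> t k (i + 1) s \<or> cell_of x \<phi> (t + 1) k (i + shift (snd (as ! k))) s"
      if "premise x (state_of x \<phi>) (cell_of x \<phi>) t st rs" "k < K" "s < G" "i < B x" for t k s i
      using step(2)[OF that(1,2), of i] that shift_le[of "snd (as ! k)"]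
      by (subst (1 2) C) (simp_all add: R_def W_def)
    moreover have "\<not> cell_of x \<phi> t k (W x + i + 1) s \<or> cell_of x \<phi> (t + 1) k (W x + i + shift (snd (as ! k))) s"
      if "premise x (state_of x \<phi>) (cell_of x \<phi>) t st rs" "k < K" "s < G" "i < B x" for t k s i
      using step(2)[OF that(1,2), of "W x + i"] that shift_le[of "snd (as ! k)"]
      by (subst (1 2) C) (simp_all add: R_def W_def)
    ultimately show ?thesis
      unfolding tableau_step_def a Let_def prod.case using step(1) S st' by simp
  qed
  moreover have "\<not> premise x (state_of x \<phi>) (cell_of x \<phi>) (T x) st rs"
    if "st < N" "rs \<in> read_lists M" "(program M ! st) rs \<noteq> Halt True" for st rs
  proof
    assume "premise x (state_of x \<phi>) (cell_of x \<phi>) (T x) st rs"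
    from premise[OF this that(1,2)] that(3) accept show False by (simp add: current_action_def reads_def)
  qed
  moreover have "tableau_init x (state_of x \<phi>) (cell_of x \<phi>)"
  proof -
    have G: "0 < G" "1 < G" "2 < G" and K: "0 < K" "1 < K" using G_ge K_ge by auto
    have x: "fst (tape_of x) (int i) < G" for i using G by (simp add: tape_of_nat)
    have cell1: "cell (W x) (snd (initial M x y)) 1 (W x + i) = (if i < length y then if y ! i then 2 else 1 else 0)" for i
      using cell_initial[OF K(2), of "W x" x y "W x + i"] by (simp add: tape_of_nat)
    have C0: "cell_of x \<phi> 0 k i s \<longleftrightarrow> cell (W x) (snd (initial M x y)) k i = s"
      if "k < K" "i < R x" "s < G" for k i s
      using C[OF that, of 0] by simp
    show ?thesis unfolding tableau_init_def
    proof (intro conjI allI impI ballI)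
      show "state_of x \<phi> 0 0" using N_pos by (simp add: S initial_def)
      show "cell_of x \<phi> 0 0 i 0" if "i < W x" for i
        using that G K by (subst C0) (simp_all add: R_def cell_initial tape_of_neg)
      show "cell_of x \<phi> 0 0 (W x + i) (fst (tape_of x) (int i))" if "i < W x + 1" for i
        using that x K by (subst C0) (simp_all add: R_def cell_initial)
      show "cell_of x \<phi> 0 1 i 0" if "i < W x" for i
        using that G K by (subst C0) (simp_all add: R_def cell_initial tape_of_neg)
      have QR: "W x + i < R x" if "i \<le> Q x" for i using that by (simp add: R_def W_def B_def)
      show "cell_of x \<phi> 0 1 (W x + i) 0 \<or> cell_of x \<phi> 0 1 (W x + i) 1 \<or> cell_of x \<phi> 0 1 (W x + i) 2" if "i < Q x" for i
        using QR[of i] that G K by (simp only: C0 cell1 less_imp_le) simp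
      show "\<not> cell_of x \<phi> 0 1 (W x + i) 0 \<or> cell_of x \<phi> 0 1 (W x + i + 1) 0" if "i < Q x" for i
        using QR[of i] QR[of "i + 1"] that G K by (simp only: C0 cell1 add.assoc less_imp_le) simp
      show "cell_of x \<phi> 0 1 (W x + i + Q x) 0" if "i < 3 + length x + T x" for i
      proof -
        have "W x + (i + Q x) < R x" using that by (simp add: R_def W_def B_def)
        then show ?thesis using y G K by (simp only: C0 cell1 add.assoc) simp
      qed
      show "cell_of x \<phi> 0 k i 0" if "k \<in> {2..<K}" "i < R x" for k i
        using that G by (subst C0) (simp_all add: cell_initial)
    qed
  qed
  ultimately show ?thesis by (intro exI[of _ \<phi>]) simp
qed

end

text \<open>Halted configurations stay put, so for every admissible certificate the verdict can be
  read at the one time \<open>T x\<close>, although the bound on halting depends on the length of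
  \<open>y\<close>.\<close>

theorem NP_turing_reducible:
  assumes "L \<in> NP"
  shows "turing_reducible L ILMTP_SD"
proof -
  from assms[unfolded NP_def mem_Collect_eq]
  obtain M and p q :: "nat poly" where M: "turing_machine M" "oracle_free M"
    and halts: "\<forall>x y. \<exists>b. halts_within (\<lambda>_. []) M x y (poly p (length x + length y)) b"
    and L: "\<forall>x. x \<in> L \<longleftrightarrow> (\<exists>y. length y \<le> poly q (length x) \<and>
          halts_within (\<lambda>_. []) M x y (poly p (length x + length y)) True)"
    by (elim exE conjE)
  interpret verifier M p q by unfold_locales (rule M)+
  have stays: "current_action M (cfg x y (T x)) = Halt b"
    if y: "length y \<le> Q x" and h: "halts_within (\<lambda>_. []) M x y (poly p (length x + length y)) b" for x y b
  proof -
    obtain n where n: "n \<le> poly p (length x + length y)" "current_action M (cfg x y n) = Halt b"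
      using h by (auto simp: halts_within_def)
    have "poly p (length x + length y) \<le> T x" unfolding T_eq using y by (intro poly_nat_mono) simp
    then obtain k where k: "T x = k + n" using n(1) by (metis le_add_diff_inverse2 le_trans)
    have "cfg x y (T x) = cfg x y n" unfolding k funpow_add comp_apply by (rule halted[OF n(2)])
    then show ?thesis using n(2) by simp
  qed
  have "x \<in> L \<longleftrightarrow> cnf_sat (cnf fams x)" for x
  proof
    assume "x \<in> L"
    then obtain y where y: "length y \<le> Q x" "halts_within (\<lambda>_. []) M x y (poly p (length x + length y)) True"
      using L unfolding Q_def by blast
    show "cnf_sat (cnf fams x)"
      unfolding cnf_sat_tableau by (rule tableau_complete[OF y(1) stays[OF y]])
  next
    assume "cnf_sat (cnf fams x)"
    then obtain \<phi> where
      "\<forall>st<N. \<forall>rs\<in>read_lists M. tableau_step x (state_of x \<phi>) (cell_of x \<phi>) st rs \<and>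
       ((program M ! st) rs \<noteq> Halt True \<longrightarrow> \<not> premise x (state_of x \<phi>) (cell_of x \<phi>) (T x) st rs)"
      "tableau_init x (state_of x \<phi>) (cell_of x \<phi>)"
      unfolding cnf_sat_tableau by (elim exE conjE)
    then have "\<exists>y. length y \<le> Q x \<and> current_action M (cfg x y (T x)) = Halt True"
      by (intro tableau_sound[of x "state_of x \<phi>" "cell_of x \<phi>"]) simp_all
    then obtain y where y: "length y \<le> Q x" "current_action M (cfg x y (T x)) = Halt True" by blast
    \<comment> \<open>Acceptance is known at time \<open>T x\<close>, which may lie beyond the bound
      for this \<open>y\<close>. Some verdict is reached within that bound and persists until
      \<open>T x\<close>, so it is acceptance.\<close>
    obtain b where b: "halts_within (\<lambda>_. []) M x y (poly p (length x + length y)) b" using halts by blast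
    then have "b" using stays[OF y(1) b] y(2) by simp
    then show "x \<in> L" using L y(1) b unfolding Q_def by auto
  qed
  then show ?thesis by (rule uniform_cnf_reducible[OF closed_fams])
qed

theorem corollary1:
  shows "NP_hard ILMTP_SD"
  unfolding NP_hard_def using NP_turing_reducible by blast

end
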